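(* Let $k$ be a non-negative integer and suppose $\varphi\in\mathcal{F}_0^{k,2}(\mathbb{C}^n)$, i.e. $\varphi=Gm$ with $m\in L_k^\infty(\mathbb{R}^n)$. Then $S_\varphi$ is bounded on $\mathcal{F}^{k,2}(\mathbb{C}^n)$.
   Context: For $z,w\in\mathbb{C}^n$ write $z\cdot w=\sum_j z_jw_j$, $z^2=z\cdot z$. Let $d\nu(z)=c_ne^{-\frac12|z|^2}dz$ on $\mathbb{C}^n$ with $c_n=(2\pi)^{-n}$; the Fock space $\mathcal{F}(\mathbb{C}^n)$ is the Hilbert space of entire functions square integrable with respect to $\nu$. The Bargmann transform $B:L^2(\mathbb{R}^n)\to\mathcal{F}(\mathbb{C}^n)$ is, up to a positive normalizing constant making it unitary, $Bf(z)=e^{-\frac14z^2}\int_{\mathbb{R}^n}f(u)e^{-\frac12|u|^2}e^{u\cdot z}du$. With $d\gamma(x)=e^{-|x|^2}dx$, the Gauss-Bargmann transform is $Gf(z)=\int_{\mathbb{R}^n}f(\xi)e^{-(\xi-\frac i2z)^2}d\xi$ for $f\in L^2(\mathbb{R}^n,d\gamma)$. Let $H=-\Delta+|x|^2$ be the Hermite operator on $\mathbb{R}^n$ with powers defined spectrally. The Hermite-Sobolev space is $W_H^{k,2}(\mathbb{R}^n)=\{f\in L^2(\mathbb{R}^n):H^{k/2}f\in L^2(\mathbb{R}^n)\}$ with norm $\|H^{k/2}f\|_2$. The Fock-Sobolev space $\mathcal{F}^{k,2}(\mathbb{C}^n)$ is the image of $W_H^{k,2}(\mathbb{R}^n)$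 under $B$, with norm $\|F\|=\|H^{k/2}B^*F\|_2$. $L_k^\infty(\mathbb{R}^n)$ is the space of functions $m$ on $\mathbb{R}^n$ whose (weak) derivatives satisfy $|\partial^\alpha m(x)|\le C(1+|x|)^{|\alpha|}$ for (almost) all $x$ and all $|\alpha|\le k$, with some constant $C$. $\mathcal{F}_0^{k,2}(\mathbb{C}^n)$ is the image of $L_k^\infty(\mathbb{R}^n)$ under $G$. For $\varphi\in\mathcal{F}(\mathbb{C}^n)$, $S_\varphi F(z)=\int_{\mathbb{C}^n}F(w)\varphi(z-\bar w)e^{\frac12z\cdot\bar w}d\nu(w)$, which converges absolutely for holomorphic polynomials $F$; $S_\varphi$ is called bounded on $\mathcal{F}^{k,2}(\mathbb{C}^n)$ if it extends from the (dense) space of holomorphic polynomials to a bounded linear operator of $\mathcal{F}^{k,2}(\mathbb{C}^n)$ into itself. *)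

theory Defs
  imports "HOL-Analysis.Analysis"
begin

section \<open>Smooth functions and weak derivatives on \<open>\<real>\<^sup>n\<close>\<close>

definition partial_deriv :: "'n \<Rightarrow> (real^'n \<Rightarrow> 'b::real_normed_vector) \<Rightarrow> real^'n \<Rightarrow> 'b::real_normed_vector" where
  "partial_deriv j f x = vector_derivative (\<lambda>t. f (x + t *\<^sub>R axis j 1)) (at 0)"

text \<open>A list \<open>js\<close> of coordinate indices encodes the multi-index counting the entries of \<open>js\<close>;
  its order \<open>|\<alpha>|\<close> is \<open>length js\<close>.\<close>

primrec iter_partial :: "'n list \<Rightarrow> (real^'n \<Rightarrow> 'b::real_normed_vector) \<Rightarrow> real^'n \<Rightarrow> 'b" where
  "iter_partial [] f = f"
| "iter_partial (j # js) f = partial_deriv j (iter_partial js f)"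

definition smooth :: "(real^'n \<Rightarrow> 'b::real_normed_vector) \<Rightarrow> bool" where
  "smooth f \<longleftrightarrow> (\<forall>js x. iter_partial js f differentiable (at x))"

definition test_functions :: "(real^'n \<Rightarrow> complex) set" where
  "test_functions = {\<psi>. smooth \<psi> \<and> (\<exists>K. compact K \<and> (\<forall>x. x \<notin> K \<longrightarrow> \<psi> x = 0))}"

definition locally_integrable :: "(real^'n \<Rightarrow> complex) \<Rightarrow> bool" where
  "locally_integrable f \<longleftrightarrow> f \<in> borel_measurable lebesgue \<and>
     (\<forall>K. compact K \<longrightarrow> set_integrable lebesgue K f)"

definition weak_deriv :: "'n list \<Rightarrow> (real^'n \<Rightarrow> complex) \<Rightarrow> (real^'n \<Rightarrow> complex) \<Rightarrow> bool" where
  "weak_deriv js f g \<longleftrightarrow> locally_integrable f \<and> locally_integrable g \<and>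
     (\<forall>\<psi>\<in>test_functions.
        (LINT x|lebesgue. f x * iter_partial js \<psi> x) =
        (-1) ^ length js * (LINT x|lebesgue. g x * \<psi> x))"

definition L_infty :: "nat \<Rightarrow> (real^'n \<Rightarrow> complex) set" where
  "L_infty k = {m. \<exists>C. \<forall>js. length js \<le> k \<longrightarrow>
     (\<exists>g. weak_deriv js m g \<and>
        (AE x in lebesgue. cmod (g x) \<le> C * (1 + norm x) ^ length js))}"

section \<open>\<open>L\<^sup>2(\<real>\<^sup>n)\<close> and the Hermite operator\<close>

definition L2 :: "(real^'n \<Rightarrow> complex) set" where
  "L2 = {f. f \<in> borel_measurable lebesgue \<and> integrable lebesgue (\<lambda>x. (cmod (f x))\<^sup>2)}"

definition L2_inner :: "(real^'n \<Rightarrow> complex) \<Rightarrow> (real^'n \<Rightarrow> complex) \<Rightarrow> complex" where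
  "L2_inner f g = (LINT x|lebesgue. f x * cnj (g x))"

definition L2_nrm :: "(real^'n \<Rightarrow> complex) \<Rightarrow> real" where
  "L2_nrm f = sqrt (LINT x|lebesgue. (cmod (f x))\<^sup>2)"

definition hermite_op :: "(real^'n \<Rightarrow> complex) \<Rightarrow> real^'n \<Rightarrow> complex" where
  "hermite_op f x =
     - (\<Sum>j\<in>UNIV. partial_deriv j (partial_deriv j f) x) + of_real ((norm x)\<^sup>2) * f x"

fun hermite_poly :: "nat \<Rightarrow> real \<Rightarrow> real" where
  "hermite_poly 0 x = 1"
| "hermite_poly (Suc 0) x = 2 * x"
| "hermite_poly (Suc (Suc k)) x =
     2 * x * hermite_poly (Suc k) x - 2 * real (Suc k) * hermite_poly k x"

definition hermite_fun1 :: "nat \<Rightarrow> real \<Rightarrow> real" where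
  "hermite_fun1 k x = hermite_poly k x * exp (- x\<^sup>2 / 2) / sqrt (2 ^ k * fact k * sqrt pi)"

definition hermite_fun :: "('n \<Rightarrow> nat) \<Rightarrow> real^'n \<Rightarrow> complex" where
  "hermite_fun \<alpha> x = of_real (\<Prod>j\<in>UNIV. hermite_fun1 (\<alpha> j) (x $ j))"

definition hermite_eigenvalue :: "('n::finite \<Rightarrow> nat) \<Rightarrow> real" where
  "hermite_eigenvalue \<alpha> = 2 * real (\<Sum>j\<in>UNIV. \<alpha> j) + real CARD('n)"

text \<open>The Hermite functions are the orthonormal basis of \<open>L\<^sup>2(\<real>\<^sup>n)\<close> that diagonalises
  \<open>H = -\<Delta> + |x|\<^sup>2\<close>; the eigenvalue equation is proved in
  \<open>hermite_op_hermite_fun\<close> below.\<close>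

lemma DERIV_hermite_poly:
  "(hermite_poly k has_real_derivative 2 * real k * hermite_poly (k - 1) x) (at x)"
proof (induction k x rule: hermite_poly.induct)
  case (1 x)
  have "hermite_poly 0 = (\<lambda>_. 1)" by auto
  then show ?case by simp
next
  case (2 x)
  have "hermite_poly (Suc 0) = (\<lambda>x. 2 * x)" by auto
  then show ?case by (auto intro!: derivative_eq_intros)
next
  case (3 k x)
  have eq: "hermite_poly (Suc (Suc k)) =
      (\<lambda>x. 2 * x * hermite_poly (Suc k) x - 2 * real (Suc k) * hermite_poly k x)"
    by auto
  have "((\<lambda>x. 2 * x * hermite_poly (Suc k) x - 2 * real (Suc k) * hermite_poly k x)
      has_real_derivative
      2 * hermite_poly (Suc k) x + 2 * x * (2 * real (Suc k) * hermite_poly k x)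
        - 2 * real (Suc k) * (2 * real k * hermite_poly (k - 1) x)) (at x)"
    using 3 by (auto intro!: derivative_eq_intros)
  moreover have "2 * hermite_poly (Suc k) x + 2 * x * (2 * real (Suc k) * hermite_poly k x)
        - 2 * real (Suc k) * (2 * real k * hermite_poly (k - 1) x)
      = 2 * real (Suc (Suc k)) * hermite_poly (Suc k) x"
    by (cases k) (auto simp: algebra_simps)
  ultimately show ?case unfolding eq by simp
qed

lemma hermite_poly_rec:
  "4 * real k * real (k - 1) * hermite_poly (k - 1 - 1) x - 4 * real k * x * hermite_poly (k - 1) x
     = - 2 * real k * hermite_poly k x"
proof (cases k)
  case (Suc i)
  then show ?thesis by (cases i) (auto simp: algebra_simps)
qed simp

definition hermite_fun1' :: "nat \<Rightarrow> real \<Rightarrow> real" where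
  "hermite_fun1' k x = (2 * real k * hermite_poly (k - 1) x - x * hermite_poly k x) *
     exp (- x\<^sup>2 / 2) / sqrt (2 ^ k * fact k * sqrt pi)"

lemma DERIV_hermite_fun1: "(hermite_fun1 k has_real_derivative hermite_fun1' k x) (at x)"
  unfolding hermite_fun1_def [abs_def] hermite_fun1'_def
  by (rule derivative_eq_intros DERIV_hermite_poly refl | simp)+ (simp add: field_simps)

lemma DERIV_hermite_fun1':
  "(hermite_fun1' k has_real_derivative (x\<^sup>2 - (2 * real k + 1)) * hermite_fun1 k x) (at x)"
proof -
  define c where "c = sqrt (2 ^ k * fact k * sqrt pi)"
  have c: "c \<noteq> 0" by (simp add: c_def)
  let ?P = "\<lambda>x. 2 * real k * hermite_poly (k - 1) x - x * hermite_poly k x"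
  let ?P' = "4 * real k * real (k - 1) * hermite_poly (k - 1 - 1) x
       - hermite_poly k x - x * (2 * real k * hermite_poly (k - 1) x)"
  have P: "(?P has_real_derivative ?P') (at x)"
    by (rule derivative_eq_intros DERIV_hermite_poly refl | simp)+
  have E: "((\<lambda>x. exp (- x\<^sup>2 / 2)) has_real_derivative - x * exp (- x\<^sup>2 / 2)) (at x)"
    by (rule derivative_eq_intros refl | simp)+
  have "((\<lambda>x. ?P x * exp (- x\<^sup>2 / 2) / c) has_real_derivative
      (?P' * exp (- x\<^sup>2 / 2) + - x * exp (- x\<^sup>2 / 2) * ?P x) / c) (at x)"
    by (rule DERIV_cdivide[OF DERIV_mult[OF P E]])
  moreover have "?P' * exp (- x\<^sup>2 / 2) + - x * exp (- x\<^sup>2 / 2) * ?P x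
      = (?P' - x * ?P x) * exp (- x\<^sup>2 / 2)"
    by (simp add: algebra_simps)
  moreover have "?P' - x * ?P x = (x\<^sup>2 - (2 * real k + 1)) * hermite_poly k x"
    using hermite_poly_rec[of k x] by (simp add: algebra_simps power2_eq_square)
  ultimately show ?thesis
    unfolding hermite_fun1_def hermite_fun1'_def [abs_def] c_def[symmetric]
    by (simp add: mult.assoc)
qed

lemma partial_deriv_tensor:
  fixes f :: "'n::finite \<Rightarrow> real \<Rightarrow> real"
  assumes "\<And>y. (f j has_real_derivative g y) (at y)"
  shows "partial_deriv j (\<lambda>x. complex_of_real (\<Prod>i\<in>UNIV. f i (x $ i)))
       = (\<lambda>x. complex_of_real (\<Prod>i\<in>UNIV. (f(j := g)) i (x $ i)))"
proof
  fix x :: "real^'n"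
  define R where "R = (\<Prod>i\<in>UNIV - {j}. f i (x $ i))"
  have 1: "(\<lambda>t. complex_of_real (\<Prod>i\<in>UNIV. f i ((x + t *\<^sub>R axis j 1) $ i)))
      = (\<lambda>t. complex_of_real (f j (x $ j + t) * R))"
    by (rule ext, subst prod.remove[of UNIV j])
       (auto simp: R_def axis_def intro!: prod.cong)
  have "((\<lambda>t. f j (x $ j + t) * R) has_real_derivative g (x $ j) * R) (at 0)"
  proof -
    have "((\<lambda>t. f j (x $ j + t)) has_real_derivative g (x $ j)) (at 0)"
      using assms[of "x $ j"] DERIV_at_within_shift[of "f j" "g (x $ j)" "x $ j" 0 UNIV] by simp
    then show ?thesis by (auto intro!: derivative_eq_intros)
  qed
  then have "((\<lambda>t. complex_of_real (f j (x $ j + t) * R)) has_vector_derivative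
      complex_of_real (g (x $ j) * R)) (at 0)"
    by (rule has_vector_derivative_of_real)
  then have "partial_deriv j (\<lambda>x. complex_of_real (\<Prod>i\<in>UNIV. f i (x $ i))) x
      = complex_of_real (g (x $ j) * R)"
    unfolding partial_deriv_def 1 by (rule vector_derivative_at)
  also have "g (x $ j) * R = (\<Prod>i\<in>UNIV. (f(j := g)) i (x $ i))"
    by (subst prod.remove[of UNIV j]) (auto simp: R_def intro!: prod.cong)
  finally show "partial_deriv j (\<lambda>x. complex_of_real (\<Prod>i\<in>UNIV. f i (x $ i))) x
      = complex_of_real (\<Prod>i\<in>UNIV. (f(j := g)) i (x $ i))" .
qed

lemma partial_deriv2_hermite_fun:
  fixes \<alpha> :: "'n::finite \<Rightarrow> nat"
  shows "partial_deriv j (partial_deriv j (hermite_fun \<alpha>)) x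
     = of_real ((x $ j)\<^sup>2 - (2 * real (\<alpha> j) + 1)) * hermite_fun \<alpha> x"
proof -
  let ?f = "\<lambda>i. hermite_fun1 (\<alpha> i)"
  let ?g2 = "\<lambda>y. (y\<^sup>2 - (2 * real (\<alpha> j) + 1)) * hermite_fun1 (\<alpha> j) y"
  have 1: "partial_deriv j (hermite_fun \<alpha>)
      = (\<lambda>x. complex_of_real (\<Prod>i\<in>UNIV. (?f(j := hermite_fun1' (\<alpha> j))) i (x $ i)))"
    unfolding hermite_fun_def [abs_def]
    by (rule partial_deriv_tensor) (rule DERIV_hermite_fun1)
  have "partial_deriv j (partial_deriv j (hermite_fun \<alpha>)) x
      = complex_of_real (\<Prod>i\<in>UNIV. (?f(j := hermite_fun1' (\<alpha> j), j := ?g2)) i (x $ i))"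
    unfolding 1
    by (rule fun_cong[OF partial_deriv_tensor]) (simp add: DERIV_hermite_fun1')
  also have "(\<Prod>i\<in>UNIV. (?f(j := hermite_fun1' (\<alpha> j), j := ?g2)) i (x $ i))
      = ?g2 (x $ j) * (\<Prod>i\<in>UNIV - {j}. ?f i (x $ i))"
    by (subst prod.remove[of UNIV j]) (auto intro!: prod.cong)
  also have "\<dots> = ((x $ j)\<^sup>2 - (2 * real (\<alpha> j) + 1)) * (\<Prod>i\<in>UNIV. ?f i (x $ i))"
    using prod.remove[of UNIV j "\<lambda>i. ?f i (x $ i)"] by simp
  finally show ?thesis
    by (simp only: hermite_fun_def[of \<alpha> x] of_real_mult)
qed

lemma hermite_op_hermite_fun:
  fixes \<alpha> :: "'n::finite \<Rightarrow> nat"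
  shows "hermite_op (hermite_fun \<alpha>) x = of_real (hermite_eigenvalue \<alpha>) * hermite_fun \<alpha> x"
proof -
  have n: "(norm x)\<^sup>2 = (\<Sum>j\<in>UNIV. (x $ j)\<^sup>2)"
    by (simp add: norm_vec_def L2_set_def sum_nonneg)
  have "hermite_op (hermite_fun \<alpha>) x
     = of_real (- (\<Sum>j\<in>UNIV. (x $ j)\<^sup>2 - (2 * real (\<alpha> j) + 1)) + (norm x)\<^sup>2) * hermite_fun \<alpha> x"
    unfolding hermite_op_def partial_deriv2_hermite_fun sum_distrib_right[symmetric]
    by (simp only: of_real_add of_real_minus of_real_sum distrib_right minus_mult_left)
  also have "- (\<Sum>j\<in>UNIV. (x $ j)\<^sup>2 - (2 * real (\<alpha> j) + 1)) + (norm x)\<^sup>2 = hermite_eigenvalue \<alpha>"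
    unfolding n hermite_eigenvalue_def
    by (simp add: sum_subtractf sum.distrib sum_distrib_left)
  finally show ?thesis .
qed

text \<open>Graph of the spectrally defined power \<open>H\<^sup>s\<close>, \<open>H\<^sup>s f = \<Sum>\<^sub>\<alpha> (2|\<alpha>| + n)\<^sup>s \<langle>f, \<Phi>\<^sub>\<alpha>\<rangle> \<Phi>\<^sub>\<alpha>\<close>
  (as an equality in \<open>L\<^sup>2\<close>, hence up to null sets). Its domain consists of those
  \<open>f \<in> L\<^sup>2\<close> for which an image in \<open>L\<^sup>2\<close> exists.\<close>

definition hermite_power :: "real \<Rightarrow> (real^'n \<Rightarrow> complex) \<Rightarrow> (real^'n \<Rightarrow> complex) \<Rightarrow> bool" where
  "hermite_power s f g \<longleftrightarrow> f \<in> L2 \<and> g \<in> L2 \<and>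
     (\<forall>\<alpha>. L2_inner g (hermite_fun \<alpha>) =
          of_real (hermite_eigenvalue \<alpha> powr s) * L2_inner f (hermite_fun \<alpha>))"

definition hermite_sobolev :: "nat \<Rightarrow> (real^'n \<Rightarrow> complex) set" where
  "hermite_sobolev k = {f \<in> L2. \<exists>g. hermite_power (real k / 2) f g}"

definition hermite_sobolev_nrm :: "nat \<Rightarrow> (real^'n \<Rightarrow> complex) \<Rightarrow> real" where
  "hermite_sobolev_nrm k f = L2_nrm (SOME g. hermite_power (real k / 2) f g)"

section \<open>Bargmann and Gauss-Bargmann transforms\<close>

definition cdot :: "complex^'n \<Rightarrow> complex^'n \<Rightarrow> complex" where
  "cdot z w = (\<Sum>j\<in>UNIV. z $ j * w $ j)"

definition cvec :: "real^'n \<Rightarrow> complex^'n" where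
  "cvec x = (\<chi> j. of_real (x $ j))"

definition cnjv :: "complex^'n \<Rightarrow> complex^'n" where
  "cnjv z = (\<chi> j. cnj (z $ j))"

definition fock_measure :: "(complex^'n::finite) measure" where
  "fock_measure =
     density lborel (\<lambda>z. ennreal ((2 * pi) powr (- real CARD('n)) * exp (- (norm z)\<^sup>2 / 2)))"

definition fock_inner :: "(complex^'n \<Rightarrow> complex) \<Rightarrow> (complex^'n \<Rightarrow> complex) \<Rightarrow> complex" where
  "fock_inner F G = (LINT z|fock_measure. F z * cnj (G z))"

text \<open>The factor \<open>\<pi>\<^bsup>-n/4\<^esup>\<close> is the positive constant making the transform unitary: the unit
  vector \<open>\<pi>\<^bsup>-n/4\<^esup> exp (-|x|\<^sup>2/2)\<close> is mapped to the constant function \<open>1\<close>.\<close>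

definition bargmann :: "(real^'n::finite \<Rightarrow> complex) \<Rightarrow> complex^'n \<Rightarrow> complex" where
  "bargmann f z = of_real (pi powr (- real CARD('n) / 4)) * exp (- cdot z z / 4) *
     (LINT u|lebesgue. f u * of_real (exp (- (norm u)\<^sup>2 / 2)) * exp (cdot (cvec u) z))"

definition bargmann_adj :: "(complex^'n \<Rightarrow> complex) \<Rightarrow> real^'n \<Rightarrow> complex" where
  "bargmann_adj F = (SOME f. f \<in> L2 \<and> (\<forall>g\<in>L2. fock_inner (bargmann g) F = L2_inner g f))"

definition gauss_bargmann :: "(real^'n \<Rightarrow> complex) \<Rightarrow> complex^'n \<Rightarrow> complex" where
  "gauss_bargmann f z = (LINT \<xi>|lebesgue.
     f \<xi> * exp (- cdot (cvec \<xi> - (\<i> / 2) *s z) (cvec \<xi> - (\<i> / 2) *s z)))"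

section \<open>Fock-Sobolev spaces and the operators \<open>S\<^sub>\<phi>\<close>\<close>

definition fock_sobolev :: "nat \<Rightarrow> (complex^'n \<Rightarrow> complex) set" where
  "fock_sobolev k = bargmann ` hermite_sobolev k"

definition fock_sobolev_nrm :: "nat \<Rightarrow> (complex^'n \<Rightarrow> complex) \<Rightarrow> real" where
  "fock_sobolev_nrm k F = hermite_sobolev_nrm k (bargmann_adj F)"

definition fock_sobolev0 :: "nat \<Rightarrow> (complex^'n \<Rightarrow> complex) set" where
  "fock_sobolev0 k = gauss_bargmann ` L_infty k"

definition S_op :: "(complex^'n \<Rightarrow> complex) \<Rightarrow> (complex^'n \<Rightarrow> complex) \<Rightarrow> complex^'n \<Rightarrow> complex" where
  "S_op \<phi> F z = (LINT w|fock_measure. F w * \<phi> (z - cnjv w) * exp (cdot z (cnjv w) / 2))"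

definition holomorphic_polynomials :: "(complex^'n \<Rightarrow> complex) set" where
  "holomorphic_polynomials =
     {\<lambda>z. \<Sum>\<alpha>\<in>A. c \<alpha> * (\<Prod>j\<in>UNIV. z $ j ^ \<alpha> j) | A (c :: ('n \<Rightarrow> nat) \<Rightarrow> complex). finite A}"

definition S_bounded :: "nat \<Rightarrow> (complex^'n \<Rightarrow> complex) \<Rightarrow> bool" where
  "S_bounded k \<phi> \<longleftrightarrow> (\<exists>T.
     (\<forall>F\<in>fock_sobolev k. T F \<in> fock_sobolev k) \<and>
     (\<forall>F\<in>fock_sobolev k. \<forall>G\<in>fock_sobolev k. T (\<lambda>z. F z + G z) = (\<lambda>z. T F z + T G z)) \<and>
     (\<forall>F\<in>fock_sobolev k. \<forall>c. T (\<lambda>z. c * F z) = (\<lambda>z. c * T F z)) \<and>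
     (\<exists>C. \<forall>F\<in>fock_sobolev k. fock_sobolev_nrm k (T F) \<le> C * fock_sobolev_nrm k F) \<and>
     (\<forall>P\<in>holomorphic_polynomials. T P = S_op \<phi> P))"

end

theory Submission imports Defs "HOL-Probability.Probability" begin

text \<open>
  Write \<open>\<phi> = gauss_bargmann m\<close>. Expanding the square in the Gauss--Bargmann kernel gives
  \<open>\<phi> (z - w\<^sup>*) e\<^bsup>z \<cdot> w\<^sup>*/2\<^esup> = c \<integral> m(\<xi>) B(\<xi>, \<i>z) B(\<xi>, \<i>w)\<^sup>* d\<xi>\<close>, where \<open>B(\<xi>, z)\<close> is the kernel of
  the Bargmann transform and \<open>\<^sup>*\<close> denotes complex conjugation. Hence \<open>S\<^sub>\<phi>\<close> is multiplication by
  \<open>m\<close>, conjugated by the unitary map \<open>f \<mapsto> (z \<mapsto> bargmann f (\<i> z))\<close> and multiplied by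
  \<open>\<pi>\<^bsup>n/2\<^esup>\<close> (\<open>S_op_eq_multiplication\<close>). Rotating the argument by \<open>\<i>\<close> multiplies the Hermite
  coefficients of \<open>f\<close> by numbers of modulus one (\<open>bargmann_rotate\<close>) and so preserves the
  Hermite--Sobolev norm. What remains is that multiplication by \<open>m\<close> is bounded on the
  Hermite--Sobolev space of order \<open>k\<close>.

  That norm is a weighted \<open>\<ell>\<^sup>2\<close> norm of Hermite coefficients, with weight
  \<open>(2|\<alpha>| + n)\<^sup>k\<close>. One factor \<open>2|\<alpha>| + n\<close> is produced by one raising operator; moved across the
  product \<open>m f\<close> by the Leibniz rule, it becomes a lowering operator acting on \<open>f\<close>, plus
  multiplication by \<open>\<partial>\<^sub>j m\<close>. The latter grows one power of \<open>1 + |x|\<close> faster than \<open>m\<close>, and such a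
  power costs at most one order of the Sobolev scale (\<open>weighted_lc_bound\<close>). Induction on \<open>k\<close>, over
  all growth exponents simultaneously, yields \<open>multiplication_bound\<close> for finite Hermite expansions,
  and truncation yields \<open>multiplication_bounded_sobolev\<close> in general.

  The supporting theory consists of three parts. Riesz--Fischer and the completeness of the Hermite
  functions in \<open>L\<^sup>2\<close> identify functions with their coefficients. Completeness holds because a function
  orthogonal to all Hermite functions has, once multiplied by a Gaussian, vanishing Gaussian averages (\<open>hermite_complete\<close>,
  \<open>AE_zero_of_gaussian_averages\<close>). Unitarity of the Bargmann transform follows because it maps the
  Hermite basis to normalised monomials, which are orthonormal for the Gaussian measure
  (\<open>bargmann_hermite\<close>, \<open>orthonormal_zbasis\<close>). Weak derivatives are tested against compactly
  supported functions only, whereas products of Hermite functions merely decay; explicit cut-offs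
  bridge the difference (\<open>wpair_gdec\<close>).
\<close>

section \<open>Square integrable functions over a measure\<close>

definition sqint :: "'a measure \<Rightarrow> ('a \<Rightarrow> complex) \<Rightarrow> bool" where
  "sqint M f \<longleftrightarrow> f \<in> borel_measurable M \<and> integrable M (\<lambda>x. (cmod (f x))\<^sup>2)"

definition ip :: "'a measure \<Rightarrow> ('a \<Rightarrow> complex) \<Rightarrow> ('a \<Rightarrow> complex) \<Rightarrow> complex" where
  "ip M f g = (LINT x|M. f x * cnj (g x))"

definition nsq :: "'a measure \<Rightarrow> ('a \<Rightarrow> complex) \<Rightarrow> real" where
  "nsq M f = (LINT x|M. (cmod (f x))\<^sup>2)"

lemma sqint_measurable [measurable_dest]: "sqint M f \<Longrightarrow> f \<in> borel_measurable M"
  by (simp add: sqint_def)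

lemma sqint_bound:
  assumes "sqint M g" "f \<in> borel_measurable M" "AE x in M. cmod (f x) \<le> C * cmod (g x)"
  shows "sqint M f" "nsq M f \<le> C\<^sup>2 * nsq M g"
proof -
  have i: "integrable M (\<lambda>x. C\<^sup>2 * (cmod (g x))\<^sup>2)"
    using assms(1) by (auto simp: sqint_def)
  have b: "AE x in M. (cmod (f x))\<^sup>2 \<le> C\<^sup>2 * (cmod (g x))\<^sup>2"
    using assms(3)
  proof eventually_elim
    case (elim x)
    then have "(cmod (f x))\<^sup>2 \<le> (C * cmod (g x))\<^sup>2" by (intro power_mono) auto
    then show ?case by (simp add: power_mult_distrib)
  qed
  have j: "integrable M (\<lambda>x. (cmod (f x))\<^sup>2)"
    by (rule Bochner_Integration.integrable_bound[OF i]) (use assms(2) b in auto)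
  then show "sqint M f" using assms(2) by (simp add: sqint_def)
  have "nsq M f \<le> (LINT x|M. C\<^sup>2 * (cmod (g x))\<^sup>2)"
    unfolding nsq_def by (rule integral_mono_AE[OF j i b])
  then show "nsq M f \<le> C\<^sup>2 * nsq M g" by (simp add: nsq_def)
qed

lemma sqint_zero [simp]: "sqint M (\<lambda>x. 0)"
  by (simp add: sqint_def)

lemma sqint_scale: "sqint M f \<Longrightarrow> sqint M (\<lambda>x. c * f x)"
  by (auto simp: sqint_def norm_mult power_mult_distrib)

lemma sqint_cnj: "sqint M f \<Longrightarrow> sqint M (\<lambda>x. cnj (f x))"
proof -
  have "cnj \<in> borel_measurable borel"
    by (intro borel_measurable_continuous_onI continuous_intros)
  then show "sqint M f \<Longrightarrow> sqint M (\<lambda>x. cnj (f x))"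
    using measurable_compose[of f M borel cnj borel] by (auto simp: sqint_def)
qed

lemma sqint_add:
  assumes "sqint M f" "sqint M g" shows "sqint M (\<lambda>x. f x + g x)"
proof -
  have [measurable]: "f \<in> borel_measurable M" "g \<in> borel_measurable M"
    using assms by (auto simp: sqint_def)
  have "integrable M (\<lambda>x. 2 * (cmod (f x))\<^sup>2 + 2 * (cmod (g x))\<^sup>2)"
    using assms by (auto simp: sqint_def)
  then have "integrable M (\<lambda>x. (cmod (f x + g x))\<^sup>2)"
  proof (rule Bochner_Integration.integrable_bound, measurable, intro AE_I2)
    fix x
    have "(cmod (f x + g x))\<^sup>2 \<le> (cmod (f x) + cmod (g x))\<^sup>2"
      by (intro power_mono norm_triangle_ineq) auto
    also have "\<dots> \<le> 2 * (cmod (f x))\<^sup>2 + 2 * (cmod (g x))\<^sup>2"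
      using sum_squares_bound[of "cmod (f x)" "cmod (g x)"] by (simp add: power2_sum)
    finally show "norm ((cmod (f x + g x))\<^sup>2) \<le> norm (2 * (cmod (f x))\<^sup>2 + 2 * (cmod (g x))\<^sup>2)"
      by simp
  qed
  then show ?thesis by (simp add: sqint_def)
qed

lemma sqint_diff: "sqint M f \<Longrightarrow> sqint M g \<Longrightarrow> sqint M (\<lambda>x. f x - g x)"
  using sqint_add[of M f "\<lambda>x. (-1) * g x"] sqint_scale[of M g "-1"] by simp

lemma sqint_sum: "(\<And>i. i \<in> A \<Longrightarrow> sqint M (f i)) \<Longrightarrow> sqint M (\<lambda>x. \<Sum>i\<in>A. f i x)"
  by (induction A rule: infinite_finite_induct) (auto intro: sqint_add)

lemma ip_integrable:
  assumes "sqint M f" "sqint M g" shows "integrable M (\<lambda>x. f x * cnj (g x))"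
proof -
  have [measurable]: "f \<in> borel_measurable M" "g \<in> borel_measurable M"
    using assms by (auto simp: sqint_def)
  have "integrable M (\<lambda>x. (cmod (f x))\<^sup>2 + (cmod (g x))\<^sup>2)"
    using assms by (auto simp: sqint_def)
  then show ?thesis
  proof (rule Bochner_Integration.integrable_bound)
    show "(\<lambda>x. f x * cnj (g x)) \<in> borel_measurable M"
      using sqint_cnj[OF assms(2)] by (auto simp: sqint_def)
  next
   show "AE x in M. norm (f x * cnj (g x)) \<le> norm ((cmod (f x))\<^sup>2 + (cmod (g x))\<^sup>2)"
   proof (rule AE_I2)
    fix x
    have "2 * (cmod (f x) * cmod (g x)) \<le> (cmod (f x))\<^sup>2 + (cmod (g x))\<^sup>2"
      using sum_squares_bound[of "cmod (f x)" "cmod (g x)"] by simp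
    moreover have "0 \<le> cmod (f x) * cmod (g x)" by simp
    ultimately have "cmod (f x) * cmod (g x) \<le> (cmod (f x))\<^sup>2 + (cmod (g x))\<^sup>2" by linarith
    then show "norm (f x * cnj (g x)) \<le> norm ((cmod (f x))\<^sup>2 + (cmod (g x))\<^sup>2)"
      by (simp add: norm_mult)
   qed
  qed
qed

lemma ip_add_left: "sqint M f \<Longrightarrow> sqint M g \<Longrightarrow> sqint M h \<Longrightarrow> ip M (\<lambda>x. f x + g x) h = ip M f h + ip M g h"
  unfolding ip_def distrib_right by (intro Bochner_Integration.integral_add ip_integrable)

lemma ip_diff_left: "sqint M f \<Longrightarrow> sqint M g \<Longrightarrow> sqint M h \<Longrightarrow> ip M (\<lambda>x. f x - g x) h = ip M f h - ip M g h"
  unfolding ip_def left_diff_distrib by (intro Bochner_Integration.integral_diff ip_integrable)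

lemma ip_scale_left: "ip M (\<lambda>x. c * f x) h = c * ip M f h"
  by (simp add: ip_def mult.assoc)

lemma ip_sum_left:
  assumes "\<And>i. i \<in> A \<Longrightarrow> sqint M (f i)" "sqint M h"
  shows "ip M (\<lambda>x. \<Sum>i\<in>A. f i x) h = (\<Sum>i\<in>A. ip M (f i) h)"
  unfolding ip_def sum_distrib_right
  by (rule Bochner_Integration.integral_sum) (use assms in \<open>auto intro: ip_integrable\<close>)

lemma ip_commute: "ip M f g = cnj (ip M g f)"
proof -
  have "cnj (LINT x|M. g x * cnj (f x)) = (LINT x|M. cnj (g x * cnj (f x)))"
    by (rule Bochner_Integration.integral_cnj[symmetric])
  then show ?thesis by (simp add: ip_def mult.commute)
qed

lemma ip_cong_AE:
  assumes "sqint M f" "sqint M g" "sqint M h" "AE x in M. f x = g x"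
  shows "ip M f h = ip M g h"
  unfolding ip_def
proof (rule integral_cong_AE)
  show "(\<lambda>x. f x * cnj (h x)) \<in> borel_measurable M" "(\<lambda>x. g x * cnj (h x)) \<in> borel_measurable M"
    using borel_measurable_integrable[OF ip_integrable] assms by auto
qed (use assms(4) in auto)

lemma nsq_eq_ip: "complex_of_real (nsq M f) = ip M f f"
  unfolding nsq_def ip_def integral_complex_of_real[symmetric] complex_norm_square ..

lemma nsq_nonneg [simp]: "0 \<le> nsq M f"
  by (simp add: nsq_def)

lemma nsq_scale: "nsq M (\<lambda>x. c * f x) = (cmod c)\<^sup>2 * nsq M f"
  by (simp add: nsq_def norm_mult power_mult_distrib)

lemma nsq_minus_commute: "nsq M (\<lambda>x. f x - g x) = nsq M (\<lambda>x. g x - f x)"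
  by (simp add: nsq_def norm_minus_commute)

lemma nsq_add:
  assumes f: "sqint M f" and g: "sqint M g"
  shows "nsq M (\<lambda>x. f x + g x) = nsq M f + nsq M g + 2 * Re (ip M f g)"
proof -
  note s = f g sqint_add[OF f g]
  have "complex_of_real (nsq M (\<lambda>x. f x + g x)) = ip M f (\<lambda>x. f x + g x) + ip M g (\<lambda>x. f x + g x)"
    unfolding nsq_eq_ip by (rule ip_add_left) (use s in auto)
  also have "ip M f (\<lambda>x. f x + g x) = cnj (ip M f f + ip M g f)"
    by (subst ip_commute, subst ip_add_left) (use s in auto)
  also have "ip M g (\<lambda>x. f x + g x) = cnj (ip M f g + ip M g g)"
    by (subst ip_commute, subst ip_add_left) (use s in auto)
  finally have "complex_of_real (nsq M (\<lambda>x. f x + g x))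
      = complex_of_real (nsq M f) + complex_of_real (nsq M g) + (ip M f g + cnj (ip M f g))"
    using ip_commute[of M g f] by (simp flip: nsq_eq_ip)
  then have "Re (complex_of_real (nsq M (\<lambda>x. f x + g x)))
      = Re (complex_of_real (nsq M f) + complex_of_real (nsq M g) + (ip M f g + cnj (ip M f g)))"
    by simp
  then show ?thesis by simp
qed

lemma nsq_add_le:
  assumes f: "sqint M f" and g: "sqint M g"
  shows "nsq M (\<lambda>x. f x + g x) \<le> 2 * nsq M f + 2 * nsq M g"
proof -
  have "nsq M (\<lambda>x. f x + (-1) * g x) = nsq M f + nsq M g - 2 * Re (ip M f g)"
    using nsq_add[OF f sqint_scale[OF g, of "-1"]] ip_commute[of M f "\<lambda>x. (-1) * g x"]
      ip_scale_left[of M "-1" g f] ip_commute[of M g f] nsq_scale[of M "-1" g] by simp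
  moreover have "0 \<le> nsq M (\<lambda>x. f x + (-1) * g x)" by simp
  ultimately show ?thesis using nsq_add[OF f g] by linarith
qed

lemma Cauchy_Schwarz_ip:
  assumes f: "sqint M f" and g: "sqint M g"
  shows "(cmod (ip M f g))\<^sup>2 \<le> nsq M f * nsq M g"
proof -
  \<comment> \<open>expand \<open>0 \<le> \<parallel>t a f + g\<parallel>\<^sup>2\<close> with \<open>a = cnj (ip f g)\<close> and every real \<open>t\<close>\<close>
  define c where "c = ip M f g"
  have q: "0 \<le> t\<^sup>2 * (cmod c)\<^sup>2 * nsq M f + nsq M g + 2 * t * (cmod c)\<^sup>2" for t :: real
  proof -
    have "0 \<le> nsq M (\<lambda>x. (complex_of_real t * cnj c) * f x + g x)" by simp
    also have "\<dots> = (cmod (complex_of_real t * cnj c))\<^sup>2 * nsq M f + nsq M g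
        + 2 * Re (complex_of_real t * cnj c * c)"
      by (subst nsq_add[OF sqint_scale[OF f] g]) (simp add: nsq_scale ip_scale_left c_def)
    also have "Re (complex_of_real t * cnj c * c) = t * (cmod c)\<^sup>2"
      by (simp add: mult.assoc mult.commute[of "cnj c"] complex_norm_square[symmetric])
    finally show ?thesis by (simp add: norm_mult power_mult_distrib)
  qed
  show ?thesis
  proof (cases "nsq M f = 0")
    case True
    have "(cmod c)\<^sup>2 \<le> 0"
    proof (rule ccontr)
      assume "\<not> (cmod c)\<^sup>2 \<le> 0"
      then have p: "0 < (cmod c)\<^sup>2" by simp
      have "0 \<le> nsq M g + 2 * (- (nsq M g + 1) / (2 * (cmod c)\<^sup>2)) * (cmod c)\<^sup>2"
        using q[of "- (nsq M g + 1) / (2 * (cmod c)\<^sup>2)"] True by simp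
      also have "\<dots> = -1" using p by (simp add: field_simps)
      finally show False by simp
    qed
    then show ?thesis by (simp add: c_def True)
  next
    case False
    then have p: "0 < nsq M f" using nsq_nonneg[of M f] by linarith
    have "0 \<le> (- 1 / nsq M f)\<^sup>2 * (cmod c)\<^sup>2 * nsq M f + nsq M g + 2 * (- 1 / nsq M f) * (cmod c)\<^sup>2"
      by (rule q)
    also have "\<dots> = nsq M g - (cmod c)\<^sup>2 / nsq M f"
      using p by (simp add: field_simps power2_eq_square)
    finally show ?thesis using p by (simp add: c_def field_simps)
  qed
qed

lemma tendsto_ip:
  assumes G: "sqint M G" and g: "\<And>k. sqint M (g k)" and h: "sqint M h"
    and lim: "((\<lambda>k. nsq M (\<lambda>x. G x - g k x)) \<longlongrightarrow> 0) F"
  shows "((\<lambda>k. ip M (g k) h) \<longlongrightarrow> ip M G h) F"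
proof -
  have "((\<lambda>k. sqrt (nsq M (\<lambda>x. G x - g k x) * nsq M h)) \<longlongrightarrow> sqrt (0 * nsq M h)) F"
    by (intro tendsto_intros lim)
  then have t: "((\<lambda>k. sqrt (nsq M (\<lambda>x. G x - g k x) * nsq M h)) \<longlongrightarrow> 0) F" by simp
  have "((\<lambda>k. ip M (g k) h - ip M G h) \<longlongrightarrow> 0) F"
  proof (rule Lim_null_comparison[OF _ t], intro always_eventually allI)
    fix k
    have "norm (ip M (g k) h - ip M G h) = cmod (ip M (\<lambda>x. G x - g k x) h)"
      using ip_diff_left[OF G g h] by (simp add: norm_minus_commute)
    also have "\<dots> = sqrt ((cmod (ip M (\<lambda>x. G x - g k x) h))\<^sup>2)" by simp
    also have "\<dots> \<le> sqrt (nsq M (\<lambda>x. G x - g k x) * nsq M h)"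
      by (intro real_sqrt_le_mono Cauchy_Schwarz_ip sqint_diff G g h)
    finally show "norm (ip M (g k) h - ip M G h) \<le> sqrt (nsq M (\<lambda>x. G x - g k x) * nsq M h)" .
  qed
  then show ?thesis by (rule LIM_zero_cancel)
qed

lemma tendsto_nsq:
  assumes G: "sqint M G" and g: "\<And>k. sqint M (g k)"
    and lim: "((\<lambda>k. nsq M (\<lambda>x. G x - g k x)) \<longlongrightarrow> 0) F"
  shows "((\<lambda>k. nsq M (g k)) \<longlongrightarrow> nsq M G) F"
proof -
  have "nsq M (g k) = 2 * Re (ip M (g k) G) - nsq M G + nsq M (\<lambda>x. G x - g k x)" for k
  proof -
    have "nsq M (\<lambda>x. G x + (-1) * g k x) = nsq M G + nsq M (g k) + 2 * Re (ip M G (\<lambda>x. (-1) * g k x))"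
      using nsq_add[OF G sqint_scale[OF g, of "-1"]] nsq_scale[of M "-1" "g k"] by simp
    also have "ip M G (\<lambda>x. (-1) * g k x) = - cnj (ip M (g k) G)"
      using ip_commute[of M G "\<lambda>x. (-1) * g k x"] ip_scale_left[of M "-1" "g k" G] by simp
    finally show ?thesis by simp
  qed
  then have eq: "(\<lambda>k. nsq M (g k)) = (\<lambda>k. 2 * Re (ip M (g k) G) - nsq M G + nsq M (\<lambda>x. G x - g k x))"
    by auto
  have "((\<lambda>k. 2 * Re (ip M (g k) G) - nsq M G + nsq M (\<lambda>x. G x - g k x))
      \<longlongrightarrow> 2 * Re (ip M G G) - nsq M G + 0) F"
    by (intro tendsto_intros lim tendsto_ip[OF G g G lim])
  then show ?thesis unfolding eq by (simp flip: nsq_eq_ip)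
qed

text \<open>Fatou's lemma turns a pointwise limit of a Cauchy sequence into its limit in mean square. The lemma
  serves twice: for completeness, and for the isometry of the Bargmann transform.\<close>

lemma sqint_limit:
  fixes g :: "nat \<Rightarrow> 'a \<Rightarrow> complex"
  assumes g: "\<And>k. sqint M (g k)" and G: "G \<in> borel_measurable M"
    and lim: "AE x in M. (\<lambda>k. g k x) \<longlonglongrightarrow> G x"
    and cauchy: "\<And>k l. k \<le> l \<Longrightarrow> nsq M (\<lambda>x. g l x - g k x) \<le> \<delta> k"
  shows "sqint M G" "\<And>k. nsq M (\<lambda>x. G x - g k x) \<le> \<delta> k"
proof -
  have [measurable]: "\<And>k. g k \<in> borel_measurable M" "G \<in> borel_measurable M"
    using g G by (auto simp: sqint_def)
  have d0: "0 \<le> \<delta> k" for k using cauchy[of k k] by (simp add: nsq_def)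
  have fatou: "(\<integral>\<^sup>+x. ennreal ((cmod (G x - g k x))\<^sup>2) \<partial>M) \<le> ennreal (\<delta> k)" for k
  proof -
    have "(\<integral>\<^sup>+x. ennreal ((cmod (G x - g k x))\<^sup>2) \<partial>M)
        = (\<integral>\<^sup>+x. liminf (\<lambda>l. ennreal ((cmod (g l x - g k x))\<^sup>2)) \<partial>M)"
    proof (rule nn_integral_cong_AE)
      show "AE x in M. ennreal ((cmod (G x - g k x))\<^sup>2) = liminf (\<lambda>l. ennreal ((cmod (g l x - g k x))\<^sup>2))"
        using lim
      proof eventually_elim
        case (elim x)
        have "(\<lambda>l. ennreal ((cmod (g l x - g k x))\<^sup>2)) \<longlonglongrightarrow> ennreal ((cmod (G x - g k x))\<^sup>2)"
          by (intro tendsto_intros elim)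
        then show ?case by (intro lim_imp_Liminf[symmetric]) auto
      qed
    qed
    also have "\<dots> \<le> liminf (\<lambda>l. \<integral>\<^sup>+x. ennreal ((cmod (g l x - g k x))\<^sup>2) \<partial>M)"
      by (rule nn_integral_liminf) auto
    also have "\<dots> \<le> liminf (\<lambda>l. ennreal (\<delta> k))"
    proof (rule Liminf_mono)
      show "\<forall>\<^sub>F l in sequentially. (\<integral>\<^sup>+x. ennreal ((cmod (g l x - g k x))\<^sup>2) \<partial>M) \<le> ennreal (\<delta> k)"
        using eventually_ge_at_top[of k]
      proof eventually_elim
        case (elim l)
        have "(\<integral>\<^sup>+x. ennreal ((cmod (g l x - g k x))\<^sup>2) \<partial>M) = ennreal (nsq M (\<lambda>x. g l x - g k x))"
          unfolding nsq_def
          by (rule nn_integral_eq_integral) (use sqint_diff[OF g g] in \<open>auto simp: sqint_def\<close>)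
        then show ?case using cauchy[OF elim] by (simp add: ennreal_leI)
      qed
    qed
    finally show ?thesis by (simp add: Liminf_const)
  qed
  have i: "integrable M (\<lambda>x. (cmod (G x - g k x))\<^sup>2)" for k
  proof (rule integrableI_bounded)
    show "(\<integral>\<^sup>+x. ennreal (norm ((cmod (G x - g k x))\<^sup>2)) \<partial>M) < \<infinity>"
      using le_less_trans[OF fatou[of k]] by simp
  qed auto
  have "sqint M (\<lambda>x. (G x - g 0 x) + g 0 x)"
    by (rule sqint_add) (use i g in \<open>auto simp: sqint_def\<close>)
  then show "sqint M G" by simp
  show "nsq M (\<lambda>x. G x - g k x) \<le> \<delta> k" for k
  proof -
    have "ennreal (nsq M (\<lambda>x. G x - g k x)) \<le> ennreal (\<delta> k)"
      using fatou[of k] nn_integral_eq_integral[OF i[of k]] by (simp add: nsq_def)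
    then show ?thesis using d0 by (simp add: ennreal_le_iff)
  qed
qed

text \<open>Completeness. Weighting the consecutive differences \<open>d\<^sub>k\<close> by \<open>4\<^sup>k\<close> makes
  \<open>\<Sum> 4\<^sup>k |d\<^sub>k|\<^sup>2\<close> integrable, so at almost every point \<open>|d\<^sub>k| \<le> C 2\<^sup>-\<^sup>k\<close> and the
  sequence converges; Fatou's lemma then identifies the limit.\<close>

lemma sqint_complete_fast:
  fixes g :: "nat \<Rightarrow> 'a \<Rightarrow> complex"
  assumes g: "\<And>k. sqint M (g k)"
    and cauchy: "\<And>k l. k \<le> l \<Longrightarrow> nsq M (\<lambda>x. g l x - g k x) \<le> (1/8) ^ k"
  shows "\<exists>G. sqint M G \<and> (\<lambda>k. nsq M (\<lambda>x. G x - g k x)) \<longlonglongrightarrow> 0"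
proof -
  have [measurable]: "\<And>k. g k \<in> borel_measurable M" using g by (auto simp: sqint_def)
  define d where "d k x = g (Suc k) x - g k x" for k x
  have [measurable]: "\<And>k. d k \<in> borel_measurable M" unfolding d_def by measurable
  have i: "integrable M (\<lambda>x. 4 ^ k * (cmod (d k x))\<^sup>2)" for k
    using sqint_diff[OF g g] by (auto simp: sqint_def d_def)
  have "(\<integral>\<^sup>+x. (\<Sum>k. ennreal (4 ^ k * (cmod (d k x))\<^sup>2)) \<partial>M)
      = (\<Sum>k. \<integral>\<^sup>+x. ennreal (4 ^ k * (cmod (d k x))\<^sup>2) \<partial>M)"
    by (rule nn_integral_suminf) auto
  also have "\<dots> \<le> (\<Sum>k. ennreal ((1/2) ^ k))"
  proof (intro suminf_le allI)
    fix k
    have "(\<integral>\<^sup>+x. ennreal (4 ^ k * (cmod (d k x))\<^sup>2) \<partial>M) = ennreal (LINT x|M. 4 ^ k * (cmod (d k x))\<^sup>2)"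
      by (rule nn_integral_eq_integral[OF i]) auto
    also have "(LINT x|M. 4 ^ k * (cmod (d k x))\<^sup>2) = 4 ^ k * nsq M (\<lambda>x. g (Suc k) x - g k x)"
      by (simp add: nsq_def d_def)
    also have "\<dots> \<le> 4 ^ k * (1/8) ^ k"
      by (intro mult_left_mono cauchy) auto
    also have "\<dots> = (1/2::real) ^ k" by (simp flip: power_mult_distrib)
    finally show "(\<integral>\<^sup>+x. ennreal (4 ^ k * (cmod (d k x))\<^sup>2) \<partial>M) \<le> ennreal ((1/2) ^ k)"
      by (simp add: ennreal_leI)
  qed auto
  also have "\<dots> = ennreal (\<Sum>k. (1/2) ^ k)"
    by (rule suminf_ennreal2) (auto intro: summable_geometric)
  finally have fin: "(\<integral>\<^sup>+x. (\<Sum>k. ennreal (4 ^ k * (cmod (d k x))\<^sup>2)) \<partial>M) \<noteq> \<infinity>"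
    by (auto simp: top_unique)
  have "AE x in M. (\<Sum>k. ennreal (4 ^ k * (cmod (d k x))\<^sup>2)) \<noteq> \<infinity>"
    by (rule nn_integral_PInf_AE[OF _ fin]) measurable
  moreover have "convergent (\<lambda>k. g k x)"
    if elim: "(\<Sum>k. ennreal (4 ^ k * (cmod (d k x))\<^sup>2)) \<noteq> \<infinity>" for x
  proof -
    obtain S where S: "(\<Sum>k. ennreal (4 ^ k * (cmod (d k x))\<^sup>2)) = ennreal S" "0 \<le> S"
      using ennreal_cases[of "(\<Sum>k. ennreal (4 ^ k * (cmod (d k x))\<^sup>2))"] elim
      unfolding infinity_ennreal_def by blast
    have b: "norm (d k x) \<le> sqrt S * (1/2) ^ k" for k
    proof -
      have "sum (\<lambda>k. ennreal (4 ^ k * (cmod (d k x))\<^sup>2)) {k} \<le> (\<Sum>k. ennreal (4 ^ k * (cmod (d k x))\<^sup>2))"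
        by (rule sum_le_suminf) auto
      then have "ennreal (4 ^ k * (cmod (d k x))\<^sup>2) \<le> ennreal S"
        unfolding S(1) by simp
      then have "4 ^ k * (cmod (d k x))\<^sup>2 \<le> S"
        unfolding ennreal_le_iff[OF S(2)] .
      moreover have "(4::real) ^ k = 2 ^ k * 2 ^ k" by (simp flip: power_mult_distrib)
      ultimately have "(2 ^ k * cmod (d k x))\<^sup>2 \<le> S"
        by (simp add: power2_eq_square mult_ac)
      then have "2 ^ k * cmod (d k x) \<le> sqrt S" by (rule real_le_rsqrt)
      then show ?thesis by (simp add: power_one_over field_simps)
    qed
    have "summable (\<lambda>k. sqrt S * (1/2) ^ k)" by (intro summable_mult summable_geometric) auto
    then have "summable (\<lambda>k. d k x)" using b by (rule summable_comparison_test'[where N=0])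
    then have "convergent (\<lambda>n. \<Sum>k<n. d k x)" by (simp add: summable_iff_convergent)
    moreover have "(\<Sum>k<n. d k x) = g n x - g 0 x" for n
      unfolding d_def by (rule sum_lessThan_telescope)
    ultimately have "convergent (\<lambda>n. g n x - g 0 x)" by simp
    then have "convergent (\<lambda>n. (g n x - g 0 x) + g 0 x)" by (rule convergent_add) (rule convergent_const)
    then show ?thesis by simp
  qed
  ultimately have conv: "AE x in M. convergent (\<lambda>k. g k x)"
    by (rule eventually_mono)
  define G where "G x = lim (\<lambda>k. g k x)" for x
  have G: "G \<in> borel_measurable M" unfolding G_def by measurable
  have L: "AE x in M. (\<lambda>k. g k x) \<longlonglongrightarrow> G x"
    using conv by eventually_elim (simp add: G_def convergent_LIMSEQ_iff)
  note lim = sqint_limit[OF g G L cauchy]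
  have "(\<lambda>k. nsq M (\<lambda>x. G x - g k x)) \<longlonglongrightarrow> 0"
    by (rule tendsto_sandwich[of "\<lambda>_. 0" _ _ "\<lambda>k. (1/8) ^ k"])
       (use lim(2) in \<open>auto intro!: always_eventually LIMSEQ_power_zero\<close>)
  then show ?thesis using lim(1) by blast
qed

section \<open>Orthonormal families\<close>

definition orthonormal :: "'a measure \<Rightarrow> ('i \<Rightarrow> 'a \<Rightarrow> complex) \<Rightarrow> bool" where
  "orthonormal M e \<longleftrightarrow> (\<forall>i. sqint M (e i)) \<and> (\<forall>i j. ip M (e i) (e j) = (if i = j then 1 else 0))"

lemma orthonormal_sqint_comb: "orthonormal M e \<Longrightarrow> sqint M (\<lambda>x. \<Sum>i\<in>A. c i * e i x)"
  by (intro sqint_sum sqint_scale) (auto simp: orthonormal_def)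

lemma ip_comb:
  assumes "orthonormal M e" "finite A"
  shows "ip M (\<lambda>x. \<Sum>i\<in>A. c i * e i x) (e j) = (if j \<in> A then c j else 0)"
proof -
  have "ip M (\<lambda>x. \<Sum>i\<in>A. c i * e i x) (e j) = (\<Sum>i\<in>A. c i * ip M (e i) (e j))"
    using assms(1) by (subst ip_sum_left) (auto simp: orthonormal_def ip_scale_left intro: sqint_scale)
  also have "\<dots> = (\<Sum>i\<in>A. if i = j then c i else 0)"
    using assms(1) by (intro sum.cong) (auto simp: orthonormal_def)
  also have "\<dots> = (if j \<in> A then c j else 0)"
    using assms(2) by (rule sum.delta)
  finally show ?thesis .
qed

lemma nsq_comb:
  assumes e: "orthonormal M e" and "finite A"
  shows "nsq M (\<lambda>x. \<Sum>i\<in>A. c i * e i x) = (\<Sum>i\<in>A. (cmod (c i))\<^sup>2)"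
proof -
  let ?f = "\<lambda>x. \<Sum>i\<in>A. c i * e i x"
  have f: "sqint M ?f" by (rule orthonormal_sqint_comb[OF e])
  have "complex_of_real (nsq M ?f) = (\<Sum>i\<in>A. c i * ip M (e i) ?f)"
    unfolding nsq_eq_ip using e f
    by (subst ip_sum_left) (auto simp: orthonormal_def ip_scale_left intro: sqint_scale)
  also have "\<dots> = (\<Sum>i\<in>A. c i * cnj (c i))"
    by (intro sum.cong refl, subst ip_commute, subst ip_comb[OF e \<open>finite A\<close>]) auto
  also have "\<dots> = complex_of_real (\<Sum>i\<in>A. (cmod (c i))\<^sup>2)"
    unfolding of_real_sum complex_norm_square ..
  finally show ?thesis by (simp only: of_real_eq_iff)
qed

text \<open>Pythagoras for the orthogonal projection of \<open>f\<close> to the span of finitely many \<open>e i\<close>.\<close>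

lemma nsq_minus_projection:
  assumes e: "orthonormal M e" and A: "finite A" and f: "sqint M f"
  shows "nsq M (\<lambda>x. f x - (\<Sum>i\<in>A. ip M f (e i) * e i x)) = nsq M f - (\<Sum>i\<in>A. (cmod (ip M f (e i)))\<^sup>2)"
proof -
  let ?p = "\<lambda>x. \<Sum>i\<in>A. ip M f (e i) * e i x"
  have p: "sqint M ?p" by (rule orthonormal_sqint_comb[OF e])
  have pf: "ip M ?p f = complex_of_real (\<Sum>i\<in>A. (cmod (ip M f (e i)))\<^sup>2)"
  proof -
    have "ip M ?p f = (\<Sum>i\<in>A. ip M f (e i) * ip M (e i) f)"
      using e f by (subst ip_sum_left) (auto simp: orthonormal_def ip_scale_left intro: sqint_scale)
    also have "\<dots> = (\<Sum>i\<in>A. ip M f (e i) * cnj (ip M f (e i)))"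
      by (intro sum.cong refl, subst (2) ip_commute) simp
    finally show ?thesis unfolding of_real_sum complex_norm_square .
  qed
  have "nsq M (\<lambda>x. f x + (-1) * ?p x) = nsq M f + nsq M ?p + 2 * Re (ip M f (\<lambda>x. (-1) * ?p x))"
    by (subst nsq_add[OF f sqint_scale[OF p]]) (simp add: nsq_scale[of M "-1" ?p, simplified])
  also have "ip M f (\<lambda>x. (-1) * ?p x) = - cnj (ip M ?p f)"
    by (subst ip_commute, subst ip_scale_left) simp
  finally show ?thesis
    unfolding pf nsq_comb[OF e A] by simp
qed

lemma Bessel:
  assumes "orthonormal M e" "finite A" "sqint M f"
  shows "(\<Sum>i\<in>A. (cmod (ip M f (e i)))\<^sup>2) \<le> nsq M f"
  using nsq_minus_projection[OF assms] nsq_nonneg[of M "\<lambda>x. f x - (\<Sum>i\<in>A. ip M f (e i) * e i x)"] by linarith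

text \<open>Riesz--Fischer: finite sections \<open>F k\<close> of the index set whose tails are below \<open>8\<^sup>-\<^sup>k\<close>
  give a fast Cauchy sequence of linear combinations.\<close>

lemma Riesz_Fischer:
  fixes e :: "'i \<Rightarrow> 'a \<Rightarrow> complex"
  assumes e: "orthonormal M e" and a: "(\<lambda>i. (cmod (a i))\<^sup>2) summable_on UNIV"
  shows "\<exists>f. sqint M f \<and> (\<forall>i. ip M f (e i) = a i) \<and> nsq M f = (\<Sum>\<^sub>\<infinity>i. (cmod (a i))\<^sup>2)"
proof -
  let ?s = "\<lambda>A. \<Sum>i\<in>A. (cmod (a i))\<^sup>2"
  define S where "S = (\<Sum>\<^sub>\<infinity>i. (cmod (a i))\<^sup>2)"
  have le: "?s A \<le> S" if "finite A" for A
    unfolding S_def by (rule finite_sum_le_infsum) (use a that in auto)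
  have hs: "((\<lambda>i. (cmod (a i))\<^sup>2) has_sum S) UNIV"
    unfolding S_def using a by (rule has_sum_infsum)
  have ex: "\<exists>A. finite A \<and> S - (1/8)^k \<le> ?s A" for k :: nat
  proof -
    have "eventually (\<lambda>A. dist (?s A) S < (1/8)^k) (finite_subsets_at_top UNIV)"
      using hs unfolding has_sum_def by (rule tendstoD) simp
    then obtain A where "finite A" "dist (?s A) S < (1/8)^k"
      by (auto simp: eventually_finite_subsets_at_top)
    then show ?thesis by (intro exI[of _ A]) (auto simp: dist_real_def)
  qed
  then obtain A where A: "\<And>k. finite (A k)" "\<And>k. S - (1/8)^k \<le> ?s (A k)" by metis
  define F where "F k = (\<Union>j\<le>k. A j)" for k
  have F: "finite (F k)" "k \<le> l \<Longrightarrow> F k \<subseteq> F l" for k l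
    using A by (auto simp: F_def) (meson atMost_iff order_trans)
  have tail: "?s B \<le> (1/8)^k" if "finite B" "B \<inter> F k = {}" for B k
  proof -
    have "?s (B \<union> F k) = ?s B + ?s (F k)" using that F by (intro sum.union_disjoint) auto
    moreover have "?s (B \<union> F k) \<le> S" using that F by (intro le) auto
    moreover have "?s (A k) \<le> ?s (F k)" using F by (intro sum_mono2) (auto simp: F_def)
    ultimately show ?thesis using A(2)[of k] by linarith
  qed
  define g where "g k x = (\<Sum>i\<in>F k. a i * e i x)" for k x
  have g: "sqint M (g k)" for k
    unfolding g_def by (rule orthonormal_sqint_comb[OF e])
  have cauchy: "nsq M (\<lambda>x. g l x - g k x) \<le> (1/8)^k" if "k \<le> l" for k l
  proof -
    have "g l x - g k x = (\<Sum>i\<in>F l - F k. a i * e i x)" for x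
      unfolding g_def by (rule sum_diff[OF F(1) F(2)[OF that], symmetric])
    then have "nsq M (\<lambda>x. g l x - g k x) = ?s (F l - F k)"
      using nsq_comb[OF e, of "F l - F k" a] F by simp
    also have "\<dots> \<le> (1/8)^k" by (rule tail) (use F in auto)
    finally show ?thesis .
  qed
  obtain G where G: "sqint M G" and lim: "(\<lambda>k. nsq M (\<lambda>x. G x - g k x)) \<longlonglongrightarrow> 0"
    using sqint_complete_fast[OF g cauchy] by blast
  have "ip M G (e i) = a i" for i
  proof -
    have "(\<lambda>k. ip M (g k) (e i)) \<longlonglongrightarrow> ip M G (e i)"
      by (rule tendsto_ip[OF G g _ lim]) (use e in \<open>auto simp: orthonormal_def\<close>)
    moreover have "(\<lambda>k. ip M (g k) (e i)) \<longlonglongrightarrow> a i"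
    proof (cases "\<exists>k. i \<in> F k")
      case True
      then obtain k where "i \<in> F k" ..
      then have "eventually (\<lambda>l. ip M (g l) (e i) = a i) sequentially"
        using F ip_comb[OF e] unfolding g_def eventually_sequentially by (metis subsetD)
      then show ?thesis by (rule tendsto_eventually)
    next
      case False
      have "(cmod (a i))\<^sup>2 \<le> 0"
      proof (rule LIMSEQ_le_const)
        show "(\<lambda>k. (1/8::real)^k) \<longlonglongrightarrow> 0" by (intro LIMSEQ_power_zero) auto
        show "\<exists>N. \<forall>k\<ge>N. (cmod (a i))\<^sup>2 \<le> (1/8)^k" using tail[of "{i}"] False by auto
      qed
      then have "a i = 0" by simp
      then show ?thesis using False F ip_comb[OF e] unfolding g_def by simp
    qed
    ultimately show ?thesis by (rule LIMSEQ_unique)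
  qed
  moreover have "nsq M G = S"
  proof (rule LIMSEQ_unique)
    show "(\<lambda>k. nsq M (g k)) \<longlonglongrightarrow> nsq M G" by (rule tendsto_nsq[OF G g lim])
    have eq: "nsq M (g k) = ?s (F k)" for k unfolding g_def by (rule nsq_comb[OF e F(1)])
    show "(\<lambda>k. nsq M (g k)) \<longlonglongrightarrow> S"
    proof (rule tendsto_sandwich)
      show "(\<lambda>k. S - (1/8::real)^k) \<longlonglongrightarrow> S"
        using tendsto_diff[OF tendsto_const LIMSEQ_power_zero[of "1/8::real"]] by simp
      have "?s (A k) \<le> ?s (F k)" for k using F by (intro sum_mono2) (auto simp: F_def)
      then show "\<forall>\<^sub>F k in sequentially. S - (1/8)^k \<le> nsq M (g k)"
        unfolding eq using A(2) order_trans by (intro always_eventually) blast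
      show "\<forall>\<^sub>F k in sequentially. nsq M (g k) \<le> S"
        unfolding eq using le F by (intro always_eventually) blast
    qed simp
  qed
  ultimately show ?thesis using G by (auto simp: S_def)
qed

text \<open>By polarization a linear map that preserves norms preserves inner products. Linearity enters only
  through the norms of the combinations \<open>f + c g\<close> with \<open>c = 1\<close> and \<open>c = \<i>\<close>.\<close>

lemma ip_eq_of_nsq_eq:
  assumes f: "sqint M f" "sqint M g" and U: "sqint N (U f)" "sqint N (U g)"
    and lin: "\<And>c. nsq N (\<lambda>x. U f x + c * U g x) = nsq M (\<lambda>x. f x + c * g x)"
    and eq: "nsq N (U f) = nsq M f" "nsq N (U g) = nsq M g"
  shows "ip N (U f) (U g) = ip M f g"
proof -
  have R: "Re (cnj c * ip N (U f) (U g)) = Re (cnj c * ip M f g)" for c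
  proof -
    have s: "ip M' h (\<lambda>x. c * k x) = cnj c * ip M' h k" for M' :: "'z measure" and h k
      using ip_commute[of M' h "\<lambda>x. c * k x"] ip_commute[of M' k h] by (simp add: ip_scale_left)
    show ?thesis
      using lin[of c] nsq_add[OF f(1) sqint_scale[OF f(2)], of c] nsq_add[OF U(1) sqint_scale[OF U(2)], of c]
        eq by (simp add: nsq_scale s)
  qed
  show ?thesis using R[of 1] R[of \<i>] by (simp add: complex_eq_iff)
qed

section \<open>Gaussian integrals\<close>

lemma lborel_integral_affine:
  fixes h :: "'a::euclidean_space \<Rightarrow> 'b::{banach, second_countable_topology}"
  assumes [measurable]: "h \<in> borel_measurable borel" and "0 < c"
  shows "(LINT x|lborel. h x) = c ^ DIM('a) *\<^sub>R (LINT s|lborel. h (t + c *\<^sub>R s))"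
    and "integrable lborel h \<longleftrightarrow> integrable lborel (\<lambda>s. h (t + c *\<^sub>R s))"
proof -
  have D: "lborel = density (distr lborel borel (\<lambda>s::'a. t + c *\<^sub>R s)) (\<lambda>_. ennreal (c ^ DIM('a)))"
    using lborel_affine[of c t] \<open>0 < c\<close> by simp
  show "(LINT x|lborel. h x) = c ^ DIM('a) *\<^sub>R (LINT s|lborel. h (t + c *\<^sub>R s))"
    by (subst D, subst integral_density) (use \<open>0 < c\<close> in \<open>auto simp: integral_distr\<close>)
  show "integrable lborel h \<longleftrightarrow> integrable lborel (\<lambda>s. h (t + c *\<^sub>R s))"
  proof -
    have "integrable lborel h \<longleftrightarrow> integrable lborel (\<lambda>s. c ^ DIM('a) *\<^sub>R h (t + c *\<^sub>R s))"
      by (subst D, subst integrable_density) (use \<open>0 < c\<close> in \<open>auto simp: integrable_distr_eq\<close>)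
    moreover have "integrable lborel (\<lambda>s. h (t + c *\<^sub>R s))"
      if "integrable lborel (\<lambda>s. c ^ DIM('a) *\<^sub>R h (t + c *\<^sub>R s))"
      using integrable_scaleR_right[OF that, of "inverse (c ^ DIM('a))"] \<open>0 < c\<close> by simp
    ultimately show ?thesis by auto
  qed
qed

text \<open>Fubini for tensor products, with Lebesgue measure on a Euclidean space regarded as the product measure
  over an orthonormal basis.\<close>

lemma lborel_integral_prod_Basis:
  fixes f :: "'a::euclidean_space \<Rightarrow> real \<Rightarrow> complex"
  assumes f: "\<And>b. b \<in> Basis \<Longrightarrow> integrable lborel (f b)"
  shows "integrable lborel (\<lambda>x::'a. \<Prod>b\<in>Basis. f b (x \<bullet> b))"
    and "(LINT x|lborel. (\<Prod>b\<in>Basis. f b (x \<bullet> b))) = (\<Prod>b\<in>Basis. LINT t|lborel. f b t)"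
proof -
  interpret product_sigma_finite "\<lambda>_::'a. lborel :: real measure" by standard
  have f_meas [measurable]: "b \<in> Basis \<Longrightarrow> f b \<in> borel_measurable borel" for b
    using borel_measurable_integrable[OF f] by simp
  have m: "(\<lambda>x. \<Prod>b\<in>Basis. f b (x \<bullet> b)) \<in> borel_measurable borel"
    by (intro borel_measurable_prod) measurable
  have T: "(\<lambda>g. \<Sum>b\<in>Basis. g b *\<^sub>R b) \<in> measurable (\<Pi>\<^sub>M b\<in>Basis. lborel) (borel :: 'a measure)"
    by measurable
  have c: "(\<Prod>b\<in>Basis. f b ((\<Sum>b\<in>Basis. g b *\<^sub>R b) \<bullet> b)) = (\<Prod>b\<in>Basis. f b (g b))" for g :: "'a \<Rightarrow> real"
    by (intro prod.cong) auto
  show "integrable lborel (\<lambda>x::'a. \<Prod>b\<in>Basis. f b (x \<bullet> b))"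
    unfolding lborel_eq[where 'a='a] integrable_distr_eq[OF T m] c
    by (rule product_integrable_prod) (use f in auto)
  show "(LINT x|lborel. (\<Prod>b\<in>Basis. f b (x \<bullet> b))) = (\<Prod>b\<in>Basis. LINT t|lborel. f b t)"
    unfolding lborel_eq[where 'a='a] integral_distr[OF T m] c
    by (rule product_integral_prod) (use f in auto)
qed

text \<open>The one-dimensional Gaussian integral with a complex linear term is the characteristic
  function of the normal distribution, after the substitution \<open>s = \<surd>2 (u - Re z / 2)\<close>.\<close>

lemma has_bochner_integral_gaussian_complex:
  "has_bochner_integral lborel (\<lambda>u::real. exp (- (complex_of_real u)\<^sup>2 + of_real u * z))
     (of_real (sqrt pi) * exp (z\<^sup>2 / 4))"
proof -
  define a b where "a = Re z" and "b = Im z"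
  define F where "F s = std_normal_density s *\<^sub>R iexp (b / sqrt 2 * s)" for s
  have iF: "integrable lborel F"
  proof (rule Bochner_Integration.integrable_bound[of _ std_normal_density])
    show "F \<in> borel_measurable lborel" unfolding F_def by measurable
  qed (auto simp: F_def norm_mult)
  have "integral\<^sup>L lborel F = char std_normal_distribution (b / sqrt 2)"
    unfolding char_def F_def by (subst integral_density) auto
  also have "\<dots> = of_real (exp (- (b\<^sup>2 / 4)))"
    by (simp add: char_std_normal_distribution power_divide)
  finally have "has_bochner_integral lborel F (of_real (exp (- (b\<^sup>2 / 4))))"
    using iF by (simp add: has_bochner_integral_iff)
  then have 1: "has_bochner_integral lborel (\<lambda>u. F (- (a / sqrt 2) + sqrt 2 * u))
      (of_real (exp (- (b\<^sup>2 / 4))) /\<^sub>R sqrt 2)"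
    using lborel_has_bochner_integral_real_affine_iff[of "sqrt 2" F _ "- (a / sqrt 2)"] by simp
  have z: "z = of_real a + \<i> * of_real b" by (simp add: a_def b_def complex_eq_iff)
  have z2: "z\<^sup>2 = of_real (a\<^sup>2 - b\<^sup>2) + \<i> * of_real (2 * a * b)"
    by (simp add: z power2_eq_square algebra_simps)
  define K where "K = complex_of_real (sqrt (2 * pi)) * exp (of_real (a\<^sup>2 / 4) + \<i> * of_real (a * b / 2))"
  have eq: "K * F (- (a / sqrt 2) + sqrt 2 * u) = exp (- (complex_of_real u)\<^sup>2 + of_real u * z)" for u
  proof -
    have sq: "(- (a / sqrt 2) + sqrt 2 * u)\<^sup>2 = a\<^sup>2 / 2 - 2 * a * u + 2 * u\<^sup>2"
      by (simp add: power2_eq_square algebra_simps)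
    have ar: "b / sqrt 2 * (- (a / sqrt 2) + sqrt 2 * u) = b * u - a * b / 2"
      by (simp add: algebra_simps)
    have "K * F (- (a / sqrt 2) + sqrt 2 * u)
        = exp (of_real (a\<^sup>2 / 4) + \<i> * of_real (a * b / 2)) *
          (exp (of_real (- (a\<^sup>2 / 2 - 2 * a * u + 2 * u\<^sup>2) / 2)) * exp (\<i> * of_real (b * u - a * b / 2)))"
      unfolding F_def std_normal_density_def sq ar K_def exp_of_real
      by (simp add: scaleR_conv_of_real)
    also have "\<dots> = exp (- (complex_of_real u)\<^sup>2 + of_real u * z)"
      unfolding mult_exp_exp z by (rule arg_cong[where f=exp]) (simp add: field_simps)
    finally show ?thesis .
  qed
  have "has_bochner_integral lborel (\<lambda>u. K * F (- (a / sqrt 2) + sqrt 2 * u))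
      (K * (of_real (exp (- (b\<^sup>2 / 4))) /\<^sub>R sqrt 2))"
    by (rule has_bochner_integral_mult_right) (use 1 in auto)
  moreover have "K * (of_real (exp (- (b\<^sup>2 / 4))) /\<^sub>R sqrt 2) = of_real (sqrt pi) * exp (z\<^sup>2 / 4)"
  proof -
    have "K * (of_real (exp (- (b\<^sup>2 / 4))) /\<^sub>R sqrt 2) = of_real (sqrt pi) *
        (exp (of_real (a\<^sup>2 / 4) + \<i> * of_real (a * b / 2)) * exp (of_real (- (b\<^sup>2 / 4))))"
      unfolding K_def exp_of_real by (simp add: scaleR_conv_of_real real_sqrt_mult)
    also have "\<dots> = of_real (sqrt pi) * exp (z\<^sup>2 / 4)"
      unfolding mult_exp_exp z2
      by (rule arg_cong[where f="\<lambda>x. of_real (sqrt pi) * exp x"]) (simp add: field_simps)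
    finally show ?thesis .
  qed
  ultimately show ?thesis unfolding eq by simp
qed

lemma norm_power2_eq_sum_Basis:
  fixes x :: "'a::euclidean_space" shows "(norm x)\<^sup>2 = (\<Sum>b\<in>Basis. (x \<bullet> b)\<^sup>2)"
  unfolding power2_norm_eq_inner by (subst euclidean_inner) (simp add: power2_eq_square)

lemma has_bochner_integral_gaussian_euclidean:
  fixes w :: "'a::euclidean_space \<Rightarrow> complex"
  shows "has_bochner_integral lborel
      (\<lambda>x::'a. of_real (exp (- (norm x)\<^sup>2)) * exp (\<Sum>b\<in>Basis. of_real (x \<bullet> b) * w b))
      (of_real (sqrt pi ^ DIM('a)) * exp ((\<Sum>b\<in>Basis. (w b)\<^sup>2) / 4))"
proof -
  let ?f = "\<lambda>b u. exp (- (complex_of_real u)\<^sup>2 + of_real u * w b)"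
  have i: "integrable lborel (?f b)" "integral\<^sup>L lborel (?f b) = of_real (sqrt pi) * exp ((w b)\<^sup>2 / 4)" for b
    using has_bochner_integral_gaussian_complex[of "w b"] by (auto simp: has_bochner_integral_iff)
  have eq: "of_real (exp (- (norm x)\<^sup>2)) * exp (\<Sum>b\<in>Basis. of_real (x \<bullet> b) * w b)
      = (\<Prod>b\<in>Basis. ?f b (x \<bullet> b))" for x :: 'a
  proof -
    have "of_real (exp (- (norm x)\<^sup>2)) = exp (\<Sum>b\<in>Basis. - (complex_of_real (x \<bullet> b))\<^sup>2)"
      by (simp add: norm_power2_eq_sum_Basis sum_negf flip: exp_of_real)
    then show ?thesis
      by (simp only: mult_exp_exp flip: sum.distrib exp_sum[OF finite_Basis])
  qed
  have "(LINT x|lborel. (\<Prod>b\<in>Basis. ?f b (x \<bullet> b))) = (\<Prod>b\<in>(Basis::'a set). of_real (sqrt pi) * exp ((w b)\<^sup>2 / 4))"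
    by (subst lborel_integral_prod_Basis) (use i in auto)
  also have "\<dots> = of_real (sqrt pi ^ DIM('a)) * exp ((\<Sum>b\<in>Basis. (w b)\<^sup>2) / 4)"
    by (simp add: prod.distrib sum_divide_distrib flip: exp_sum[OF finite_Basis])
  finally show ?thesis
    unfolding eq using lborel_integral_prod_Basis(1)[of ?f] i by (simp add: has_bochner_integral_iff)
qed

lemma integral_gaussian:
  assumes "0 < a"
  shows "integrable lborel (\<lambda>x::'a::euclidean_space. exp (- a * (norm x)\<^sup>2))"
    and "(LINT x|lborel. exp (- a * (norm (x::'a))\<^sup>2)) = sqrt (pi / a) ^ DIM('a)"
proof -
  have "has_bochner_integral lborel (\<lambda>x::'a. complex_of_real (exp (- (norm x)\<^sup>2))) (of_real (sqrt pi ^ DIM('a)))"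
    using has_bochner_integral_gaussian_euclidean[of "\<lambda>_. 0"] by simp
  then have 1: "has_bochner_integral lborel (\<lambda>x::'a. exp (- (norm x)\<^sup>2)) (sqrt pi ^ DIM('a))"
    unfolding has_bochner_integral_iff by (metis complex_of_real_integrable_eq integral_complex_of_real of_real_eq_iff)
  have e: "exp (- (norm (0 + sqrt a *\<^sub>R x))\<^sup>2) = exp (- a * (norm x)\<^sup>2)" for x :: 'a
    using assms by (simp add: power_mult_distrib)
  have m: "(\<lambda>x::'a. exp (- (norm x)\<^sup>2)) \<in> borel_measurable borel" by measurable
  have sa: "0 < sqrt a" using assms by simp
  note aff = lborel_integral_affine[OF m sa, of 0, unfolded e]
  show "integrable lborel (\<lambda>x::'a::euclidean_space. exp (- a * (norm x)\<^sup>2))"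
    using 1 aff(2) by (simp add: has_bochner_integral_iff)
  have "sqrt a ^ DIM('a) * (LINT x|lborel. exp (- a * (norm (x::'a))\<^sup>2)) = sqrt pi ^ DIM('a)"
    using 1 aff(1) by (simp add: has_bochner_integral_iff)
  then show "(LINT x|lborel. exp (- a * (norm (x::'a))\<^sup>2)) = sqrt (pi / a) ^ DIM('a)"
    using assms by (simp add: real_sqrt_divide power_divide field_simps)
qed

section \<open>Functions growing more slowly than every Gaussian\<close>

text \<open>This class contains polynomials and exponentials of linear functions and is closed under products,
  which turns every integrability question about Gaussians with such factors into a closure property.\<close>

definition slow :: "('a::real_normed_vector \<Rightarrow> 'b::real_normed_vector) \<Rightarrow> bool" where
  "slow f \<longleftrightarrow> (\<forall>e>0. \<exists>C. \<forall>x. norm (f x) \<le> C * exp (e * (norm x)\<^sup>2))"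

lemma slowD:
  assumes "slow f" "0 < e"
  obtains C where "0 \<le> C" "\<And>x. norm (f x) \<le> C * exp (e * (norm x)\<^sup>2)"
proof -
  obtain C where C: "\<And>x. norm (f x) \<le> C * exp (e * (norm x)\<^sup>2)"
    using assms unfolding slow_def by blast
  have "0 \<le> C" using order_trans[OF norm_ge_zero C[of 0]] by simp
  with C show ?thesis using that by blast
qed

lemma slow_mono: "slow g \<Longrightarrow> (\<And>x. norm (f x) \<le> norm (g x)) \<Longrightarrow> slow f"
  unfolding slow_def by (meson order_trans)

lemma slow_const [simp]: "slow (\<lambda>x. c)"
  unfolding slow_def
proof (intro allI impI)
  fix e :: real assume "0 < e"
  then have "norm c * 1 \<le> norm c * exp (e * (norm x)\<^sup>2)" for x :: 'a
    by (intro mult_left_mono) auto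
  then show "\<exists>C. \<forall>x. norm c \<le> C * exp (e * (norm (x::'a))\<^sup>2)" by auto
qed

lemma slow_add:
  assumes "slow f" "slow g" shows "slow (\<lambda>x. f x + g x)"
  unfolding slow_def
proof (intro allI impI)
  fix e :: real assume e: "0 < e"
  obtain C where C: "\<And>x. norm (f x) \<le> C * exp (e * (norm x)\<^sup>2)" using slowD[OF assms(1) e] by blast
  obtain D where D: "\<And>x. norm (g x) \<le> D * exp (e * (norm x)\<^sup>2)" using slowD[OF assms(2) e] by blast
  have "norm (f x + g x) \<le> (C + D) * exp (e * (norm x)\<^sup>2)" for x
    using norm_triangle_ineq[of "f x" "g x"] C[of x] D[of x] by (simp add: distrib_right)
  then show "\<exists>C. \<forall>x. norm (f x + g x) \<le> C * exp (e * (norm x)\<^sup>2)" by blast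
qed

lemma slow_mult:
  fixes f g :: "'a::real_normed_vector \<Rightarrow> 'b::real_normed_algebra"
  assumes "slow f" "slow g" shows "slow (\<lambda>x. f x * g x)"
  unfolding slow_def
proof (intro allI impI)
  fix e :: real assume "0 < e"
  then have e: "0 < e / 2" by simp
  obtain C where C: "0 \<le> C" "\<And>x. norm (f x) \<le> C * exp (e / 2 * (norm x)\<^sup>2)" using slowD[OF assms(1) e] by blast
  obtain D where D: "\<And>x. norm (g x) \<le> D * exp (e / 2 * (norm x)\<^sup>2)" using slowD[OF assms(2) e] by blast
  have "norm (f x * g x) \<le> C * D * exp (e * (norm x)\<^sup>2)" for x
  proof -
    have "norm (f x * g x) \<le> norm (f x) * norm (g x)" by (rule norm_mult_ineq)
    also have "\<dots> \<le> (C * exp (e / 2 * (norm x)\<^sup>2)) * (D * exp (e / 2 * (norm x)\<^sup>2))"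
      by (intro mult_mono C D) (use C in auto)
    also have "\<dots> = C * D * (exp (e / 2 * (norm x)\<^sup>2) * exp (e / 2 * (norm x)\<^sup>2))" by (simp add: mult_ac)
    also have "\<dots> = C * D * exp (e * (norm x)\<^sup>2)" unfolding mult_exp_exp by simp
    finally show ?thesis .
  qed
  then show "\<exists>C. \<forall>x. norm (f x * g x) \<le> C * exp (e * (norm x)\<^sup>2)" by blast
qed

lemma slow_prod:
  fixes f :: "'i \<Rightarrow> 'a::real_normed_vector \<Rightarrow> 'b::{real_normed_algebra,comm_ring_1}"
  shows "(\<And>i. i \<in> A \<Longrightarrow> slow (f i)) \<Longrightarrow> slow (\<lambda>x. \<Prod>i\<in>A. f i x)"
  by (induction A rule: infinite_finite_induct) (auto intro: slow_mult)

lemma slow_power: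
  fixes f :: "'a::real_normed_vector \<Rightarrow> 'b::real_normed_algebra_1"
  shows "slow f \<Longrightarrow> slow (\<lambda>x. f x ^ k)"
  by (induction k) (auto intro: slow_mult)

lemma slow_norm_iff: "slow (\<lambda>x. norm (f x)) \<longleftrightarrow> slow f"
  by (simp add: slow_def)

lemma slow_of_real: "slow f \<Longrightarrow> slow (\<lambda>x. of_real (f x) :: 'b::real_normed_algebra_1)"
  by (simp add: slow_def)

lemma slow_exp_norm: "slow (\<lambda>x. exp (a * norm x))"
  unfolding slow_def
proof (intro allI impI)
  fix e :: real assume e: "0 < e"
  have "a * norm x \<le> a\<^sup>2 / (4 * e) + e * (norm x)\<^sup>2" for x :: 'a
  proof -
    have "0 \<le> e * (norm x - a / (2 * e))\<^sup>2" using e by simp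
    also have "\<dots> = a\<^sup>2 / (4 * e) + e * (norm x)\<^sup>2 - a * norm x"
      using e by (simp add: power2_eq_square field_simps)
    finally show ?thesis by simp
  qed
  then have "exp (a * norm x) \<le> exp (a\<^sup>2 / (4 * e)) * exp (e * (norm x)\<^sup>2)" for x :: 'a
    by (simp flip: exp_add)
  then show "\<exists>C. \<forall>x::'a. norm (exp (a * norm x)) \<le> C * exp (e * (norm x)\<^sup>2)" by auto
qed

lemma slow_norm: "slow (\<lambda>x. norm x)"
proof (rule slow_mono[OF slow_exp_norm[of 1]])
  show "norm (norm x) \<le> norm (exp (1 * norm x))" for x :: 'a
  proof -
    have "norm x \<le> exp (norm x)" using exp_ge_add_one_self[of "norm x"] by linarith
    then show ?thesis by simp
  qed
qed

lemma slow_bounded_linear: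
  assumes "bounded_linear f" shows "slow f"
proof -
  obtain K where K: "\<And>x. norm (f x) \<le> norm x * K" using bounded_linear.bounded[OF assms] by blast
  have "slow (\<lambda>x::'a. norm x * \<bar>K\<bar>)" by (intro slow_mult slow_norm slow_const)
  then show ?thesis
  proof (rule slow_mono)
    show "norm (f x) \<le> norm (norm x * \<bar>K\<bar>)" for x
      using order_trans[OF K[of x] mult_left_mono[OF abs_ge_self norm_ge_zero]] by (simp add: abs_mult)
  qed
qed

lemma slow_real_polynomial: "real_polynomial_function p \<Longrightarrow> slow p"
  by (induction rule: real_polynomial_function.induct)
     (auto intro: slow_bounded_linear slow_add slow_mult)

text \<open>Half of the Gaussian absorbs the slowly growing factor.\<close>

lemma slow_gaussian_bound:
  assumes "slow f" "0 < a"
  obtains C where "0 \<le> C" "\<And>x. norm (f x) * exp (- a * (norm x)\<^sup>2) \<le> C * exp (- (a / 2) * (norm x)\<^sup>2)"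
proof -
  have "0 < a / 2" using assms by simp
  then obtain C where C: "0 \<le> C" "\<And>x. norm (f x) \<le> C * exp (a / 2 * (norm x)\<^sup>2)"
    using slowD[OF assms(1)] by blast
  have "norm (f x) * exp (- a * (norm x)\<^sup>2) \<le> C * exp (- (a / 2) * (norm x)\<^sup>2)" for x
  proof -
    have "norm (f x) * exp (- a * (norm x)\<^sup>2) \<le> C * exp (a / 2 * (norm x)\<^sup>2) * exp (- a * (norm x)\<^sup>2)"
      by (intro mult_right_mono C) auto
    also have "\<dots> = C * exp (- (a / 2) * (norm x)\<^sup>2)" unfolding mult.assoc mult_exp_exp by simp
    finally show ?thesis .
  qed
  then show ?thesis using C that by blast
qed

lemma integrable_slow_gaussian:
  fixes f :: "'a::euclidean_space \<Rightarrow> 'c::real_normed_vector"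
    and g :: "'a \<Rightarrow> 'b::{banach, second_countable_topology}"
  assumes f: "slow f" and a: "0 < a" and m: "g \<in> borel_measurable borel"
    and le: "\<And>x. norm (g x) \<le> norm (f x) * exp (- a * (norm x)\<^sup>2)"
  shows "integrable lborel g"
proof -
  obtain C where C: "\<And>x. norm (f x) * exp (- a * (norm x)\<^sup>2) \<le> C * exp (- (a / 2) * (norm x)\<^sup>2)"
    using slow_gaussian_bound[OF f a] by blast
  have "integrable lborel (\<lambda>x::'a. C * exp (- (a / 2) * (norm x)\<^sup>2))"
    using a by (intro integrable_mult_right integral_gaussian) auto
  then show ?thesis
  proof (rule Bochner_Integration.integrable_bound)
    show "AE x in lborel. norm (g x) \<le> norm (C * exp (- (a / 2) * (norm x)\<^sup>2))"
      using order_trans[OF le C] by (auto intro!: AE_I2 order_trans[OF _ abs_ge_self])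
  qed (use m in simp)
qed

section \<open>Integration by parts\<close>

text \<open>Translation invariance of Lebesgue measure makes
  \<open>\<integral> (f (x + v) - f x) dx\<close> vanish; by the fundamental theorem of calculus and Fubini it equals
  the integral of the derivative along \<open>v\<close>.\<close>

lemma integral_directional_derivative_zero:
  fixes f f' :: "'a::euclidean_space \<Rightarrow> complex"
  assumes D: "\<And>x. ((\<lambda>t. f (x + t *\<^sub>R v)) has_vector_derivative f' x) (at 0)"
    and cont: "continuous_on UNIV f'"
    and int: "integrable lborel f" and int': "integrable lborel f'"
  shows "(LINT x|lborel. f' x) = 0"
proof -
  have [measurable]: "f \<in> borel_measurable borel" "f' \<in> borel_measurable borel"
    using borel_measurable_integrable[OF int] borel_measurable_integrable[OF int'] by auto
  have transl: "integrable lborel (\<lambda>x. h (x + c))" "(LINT x|lborel. h (x + c)) = (LINT x|lborel. h x)"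
    if "integrable lborel h" for h :: "'a \<Rightarrow> 'c::{banach, second_countable_topology}" and c
    using lborel_integral_affine[of h 1 c] borel_measurable_integrable[OF that] that by (auto simp: add.commute)
  let ?I = "indicator {0..1} :: real \<Rightarrow> real"
  have ftc: "(LINT t|lborel. ?I t *\<^sub>R f' (x + t *\<^sub>R v)) = f (x + v) - f x" for x
  proof -
    have "(LINT t|lborel. ?I t *\<^sub>R f' (x + t *\<^sub>R v)) = f (x + 1 *\<^sub>R v) - f (x + 0 *\<^sub>R v)"
    proof (rule integral_FTC_atLeastAtMost)
      fix s :: real
      have "((\<lambda>t. f ((x + s *\<^sub>R v) + t *\<^sub>R v)) has_vector_derivative f' (x + s *\<^sub>R v)) (at (s - s))"
        using D[of "x + s *\<^sub>R v"] by simp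
      moreover have "((\<lambda>t. t - s) has_vector_derivative 1) (at s)"
        by (auto intro!: derivative_eq_intros)
      ultimately have "((\<lambda>t. f ((x + s *\<^sub>R v) + t *\<^sub>R v)) \<circ> (\<lambda>t. t - s) has_vector_derivative 1 *\<^sub>R f' (x + s *\<^sub>R v)) (at s)"
        by (intro vector_diff_chain_at) auto
      moreover have "(\<lambda>t. f ((x + s *\<^sub>R v) + t *\<^sub>R v)) \<circ> (\<lambda>t. t - s) = (\<lambda>t. f (x + t *\<^sub>R v))"
        by (auto simp: scaleR_left_diff_distrib)
      ultimately have "((\<lambda>t. f (x + t *\<^sub>R v)) has_vector_derivative f' (x + s *\<^sub>R v)) (at s)"
        by (simp only: scaleR_one)
      then show "((\<lambda>t. f (x + t *\<^sub>R v)) has_vector_derivative f' (x + s *\<^sub>R v)) (at s within {0..1})"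
        by (rule has_vector_derivative_at_within)
    next
      show "continuous_on {0..1} (\<lambda>t. f' (x + t *\<^sub>R v))"
        by (intro continuous_on_compose2[OF cont] continuous_intros) auto
    qed simp
    then show ?thesis by simp
  qed
  have m: "(\<lambda>(t::real, x). ?I t *\<^sub>R f' (x + t *\<^sub>R v)) \<in> borel_measurable (lborel \<Otimes>\<^sub>M lborel)"
    by measurable
  have fub: "integrable (lborel \<Otimes>\<^sub>M lborel) (\<lambda>(t::real, x). ?I t *\<^sub>R f' (x + t *\<^sub>R v))"
  proof (rule lborel_pair.Fubini_integrable[OF m])
    have "(LINT y|lborel. norm (?I t *\<^sub>R f' (y + t *\<^sub>R v))) = ?I t *\<^sub>R (LINT y|lborel. norm (f' y))" for t
      using transl(2)[OF integrable_norm[OF int'], of "t *\<^sub>R v"] by simp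
    then show "integrable lborel (\<lambda>x. LINT y|lborel. norm (case (x, y) of (t, x) \<Rightarrow> ?I t *\<^sub>R f' (x + t *\<^sub>R v)))"
      unfolding case_prod_conv by (simp only:) (intro integrable_scaleR_left integrable_real_indicator, auto)
    show "AE x in lborel. integrable lborel (\<lambda>y. case (x, y) of (t, x) \<Rightarrow> ?I t *\<^sub>R f' (x + t *\<^sub>R v))"
      using transl(1)[OF int'] by (auto intro!: AE_I2)
  qed
  have "(LINT x|lborel. (LINT t|lborel. ?I t *\<^sub>R f' (x + t *\<^sub>R v)))
      = (LINT t|lborel. (LINT x|lborel. ?I t *\<^sub>R f' (x + t *\<^sub>R v)))"
    by (rule lborel_pair.Fubini_integral) (use fub in simp)
  also have "\<dots> = (LINT t|lborel. ?I t *\<^sub>R (LINT x|lborel. f' x))"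
    using transl(2)[OF int'] by simp
  also have "\<dots> = (LINT x|lborel. f' x)" by (subst integral_scaleR_left) (auto intro: integrable_real_indicator)
  finally have "(LINT x|lborel. f' x) = (LINT x|lborel. f (x + v) - f x)" unfolding ftc ..
  also have "\<dots> = 0" using transl[OF int, of v] int by simp
  finally show ?thesis .
qed

section \<open>Gaussian averages determine an integrable function\<close>

lemma lebesgue_ex_borel:
  fixes v :: "'a::euclidean_space \<Rightarrow> complex"
  assumes "v \<in> borel_measurable lebesgue"
  shows "\<exists>w\<in>borel_measurable borel. AE x in lborel. v x = w x"
proof -
  have m: "(\<lambda>x. Re (v x)) \<in> borel_measurable lebesgue" "(\<lambda>x. Im (v x)) \<in> borel_measurable lebesgue"
    using assms by measurable
  obtain p where [measurable]: "p \<in> borel_measurable lborel" and p: "AE x in lborel. Re (v x) = p x"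
    using completion_ex_borel_measurable_real[OF m(1)] by blast
  obtain q where [measurable]: "q \<in> borel_measurable lborel" and q: "AE x in lborel. Im (v x) = q x"
    using completion_ex_borel_measurable_real[OF m(2)] by blast
  from p q have "AE x in lborel. v x = Complex (p x) (q x)"
    by eventually_elim (simp add: complex_eq_iff)
  moreover have "(\<lambda>x. Complex (p x) (q x)) \<in> borel_measurable borel"
    unfolding Complex_eq by measurable
  ultimately show ?thesis by (intro bexI[of _ "\<lambda>x. Complex (p x) (q x)"])
qed

text \<open>The substitution \<open>y = x + s / \<surd>(N + 1)\<close> turns the averages of \<open>g\<close> at scale \<open>1 / \<surd>(N + 1)\<close> into integrals against a
  fixed Gaussian.\<close>

lemma gaussian_averages_tendsto:
  fixes g :: "'a::euclidean_space \<Rightarrow> real"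
  assumes g: "continuous_on UNIV g" "\<And>x. \<bar>g x\<bar> \<le> 1"
  shows "(\<lambda>N. sqrt (Suc N) ^ DIM('a) * (LINT y|lborel. g y * exp (- real (Suc N) * (norm (x - y))\<^sup>2)))
           \<longlonglongrightarrow> sqrt pi ^ DIM('a) * g x"
    and "\<bar>sqrt (Suc N) ^ DIM('a) * (LINT y|lborel. g y * exp (- real (Suc N) * (norm (x - y))\<^sup>2))\<bar>
           \<le> sqrt pi ^ DIM('a)"
proof -
  have [measurable]: "g \<in> borel_measurable borel" using g(1) by (rule borel_measurable_continuous_onI)
  have eq: "sqrt (Suc N) ^ DIM('a) * (LINT y|lborel. g y * exp (- real (Suc N) * (norm (x - y))\<^sup>2))
      = (LINT s|lborel. g (x + (1 / sqrt (Suc N)) *\<^sub>R s) * exp (- 1 * (norm s)\<^sup>2))" for N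
  proof -
    have "exp (- real (Suc N) * (norm (x - (x + (1 / sqrt (Suc N)) *\<^sub>R s)))\<^sup>2) = exp (- 1 * (norm s)\<^sup>2)" for s
      by (simp add: power_divide field_simps del: of_nat_Suc)
    then have "(LINT y|lborel. g y * exp (- real (Suc N) * (norm (x - y))\<^sup>2))
       = (1 / sqrt (Suc N)) ^ DIM('a) * (LINT s|lborel. g (x + (1 / sqrt (Suc N)) *\<^sub>R s) * exp (- 1 * (norm s)\<^sup>2))"
      by (subst lborel_integral_affine(1)[of _ "1 / sqrt (Suc N)" x]) (auto simp del: of_nat_Suc)
    then show ?thesis by (simp add: power_divide del: of_nat_Suc)
  qed
  have i: "integrable lborel (\<lambda>s::'a. exp (- 1 * (norm s)\<^sup>2))" by (rule integral_gaussian) simp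
  have I: "(LINT s|lborel. exp (- 1 * (norm (s::'a))\<^sup>2)) = sqrt pi ^ DIM('a)"
    using integral_gaussian(2)[of 1] by simp
  have b: "norm (g y * exp (- 1 * (norm s)\<^sup>2)) \<le> exp (- 1 * (norm s)\<^sup>2)" for y s
    using mult_right_mono[OF g(2)[of y], of "exp (- 1 * (norm s)\<^sup>2)"] by (simp add: abs_mult)
  have "(\<lambda>N. LINT s|lborel. g (x + (1 / sqrt (Suc N)) *\<^sub>R s) * exp (- 1 * (norm s)\<^sup>2))
      \<longlonglongrightarrow> (LINT s|lborel. g x * exp (- 1 * (norm (s::'a))\<^sup>2))"
  proof (rule Bochner_Integration.integral_dominated_convergence[OF _ _ i])
    show "AE s in lborel. (\<lambda>N. g (x + (1 / sqrt (Suc N)) *\<^sub>R s) * exp (- 1 * (norm s)\<^sup>2))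
        \<longlonglongrightarrow> g x * exp (- 1 * (norm s)\<^sup>2)"
    proof (rule AE_I2)
      fix s :: 'a
      have z: "(\<lambda>N. 1 / sqrt (real (Suc N))) \<longlonglongrightarrow> 0"
        by real_asymp
      have "(\<lambda>N. x + (1 / sqrt (Suc N)) *\<^sub>R s) \<longlonglongrightarrow> x + 0 *\<^sub>R s"
        by (intro tendsto_intros z)
      then have "(\<lambda>N. g (x + (1 / sqrt (Suc N)) *\<^sub>R s)) \<longlonglongrightarrow> g x"
        using g(1) by (intro continuous_on_tendsto_compose[OF g(1)]) auto
      then show "(\<lambda>N. g (x + (1 / sqrt (Suc N)) *\<^sub>R s) * exp (- 1 * (norm s)\<^sup>2))
        \<longlonglongrightarrow> g x * exp (- 1 * (norm s)\<^sup>2)" by (intro tendsto_intros)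
    qed
  qed (use b in auto)
  then show "(\<lambda>N. sqrt (Suc N) ^ DIM('a) * (LINT y|lborel. g y * exp (- real (Suc N) * (norm (x - y))\<^sup>2)))
           \<longlonglongrightarrow> sqrt pi ^ DIM('a) * g x"
    unfolding eq by (simp only: integral_mult_right_zero I mult.commute)
  have "norm (LINT s|lborel. g (x + (1 / sqrt (Suc N)) *\<^sub>R s) * exp (- 1 * (norm s)\<^sup>2))
      \<le> (LINT s|lborel. exp (- 1 * (norm (s::'a))\<^sup>2))"
  proof (rule Bochner_Integration.integral_norm_bound_integral)
    show "integrable lborel (\<lambda>s. g (x + (1 / sqrt (Suc N)) *\<^sub>R s) * exp (- 1 * (norm s)\<^sup>2))"
      by (rule Bochner_Integration.integrable_bound[OF i]) (use b in auto)
  qed (use i b in auto)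
  then show "\<bar>sqrt (Suc N) ^ DIM('a) * (LINT y|lborel. g y * exp (- real (Suc N) * (norm (x - y))\<^sup>2))\<bar>
           \<le> sqrt pi ^ DIM('a)"
    unfolding eq I by simp
qed

text \<open>Integrating the vanishing averages against a continuous \<open>g\<close> and letting the width tend to
  \<open>0\<close> yields \<open>\<integral> v g = 0\<close>; bounded limits of such \<open>g\<close> include indicators of open sets, and
  these generate the Borel sets.\<close>

lemma AE_zero_of_gaussian_averages:
  fixes v :: "'a::euclidean_space \<Rightarrow> complex"
  assumes v: "integrable lebesgue v"
    and avg: "\<And>N y. (LINT x|lebesgue. v x * of_real (exp (- real (Suc N) * (norm (x - y))\<^sup>2))) = 0"
  shows "AE x in lebesgue. v x = 0"
proof -
  obtain w where w [measurable]: "w \<in> borel_measurable borel" and vw: "AE x in lborel. v x = w x"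
    using lebesgue_ex_borel[of v] borel_measurable_integrable[OF v] by blast
  have vw': "AE x in lebesgue. v x = w x" using vw by (rule AE_completion)
  have v_m: "v \<in> borel_measurable lebesgue" using v by auto
  have iw: "integrable lborel w"
  proof -
    have "integrable lebesgue w"
      by (rule integrable_cong_AE_imp[OF v _ vw']) (rule measurable_completion, simp)
    then show ?thesis using integrable_completion[of w lborel] by simp
  qed
  have avg': "(LINT x|lborel. w x * of_real (exp (- real (Suc N) * (norm (x - y))\<^sup>2))) = 0" for N y
  proof -
    have "(LINT x|lborel. w x * of_real (exp (- real (Suc N) * (norm (x - y))\<^sup>2)))
       = (LINT x|lebesgue. w x * of_real (exp (- real (Suc N) * (norm (x - y))\<^sup>2)))"
      by (rule integral_completion[symmetric]) measurable
    also have "\<dots> = (LINT x|lebesgue. v x * of_real (exp (- real (Suc N) * (norm (x - y))\<^sup>2)))"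
    proof (rule integral_cong_AE)
      show "(\<lambda>x. w x * of_real (exp (- real (Suc N) * (norm (x - y))\<^sup>2))) \<in> borel_measurable lebesgue"
        by (rule measurable_completion) measurable
      have "(\<lambda>x. complex_of_real (exp (- real (Suc N) * (norm (x - y))\<^sup>2))) \<in> borel_measurable lebesgue"
        by (rule measurable_completion) measurable
      then show "(\<lambda>x. v x * of_real (exp (- real (Suc N) * (norm (x - y))\<^sup>2))) \<in> borel_measurable lebesgue"
        using v_m by (rule borel_measurable_times[rotated])
    qed (use vw' in auto)
    finally show ?thesis using avg by simp
  qed
  have cont: "(LINT x|lborel. w x * of_real (g x)) = 0"
    if g: "continuous_on UNIV g" "\<And>x. \<bar>g x\<bar> \<le> 1" "integrable lborel g" for g :: "'a \<Rightarrow> real"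
  proof -
    have [measurable]: "g \<in> borel_measurable borel" using g(1) by (rule borel_measurable_continuous_onI)
    define A where "A N x = sqrt (Suc N) ^ DIM('a) * (LINT y|lborel. g y * exp (- real (Suc N) * (norm (x - y))\<^sup>2))"
      for N x
    have zero: "(LINT x|lborel. w x * of_real (A N x)) = 0" for N
    proof -
      let ?k = "\<lambda>x y. w x * of_real (g y * exp (- real (Suc N) * (norm (x - y))\<^sup>2))"
      have e1: "exp (- real (Suc N) * t\<^sup>2) \<le> 1" for t :: real
        by (simp del: of_nat_Suc)
      have ix: "integrable lborel (\<lambda>y. g y * exp (- real (Suc N) * (norm (x - y))\<^sup>2))" for x
        by (rule Bochner_Integration.integrable_bound[OF g(3)])
           (use e1 in \<open>auto simp: abs_mult intro!: AE_I2 mult_left_le simp del: of_nat_Suc\<close>)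
      have bd: "norm (?k x y) \<le> norm (w x) * norm (g y)" for x y
        using mult_left_mono[OF mult_left_le[OF e1[of "norm (x - y)"] abs_ge_zero[of "g y"]] norm_ge_zero[of "w x"]]
        by (simp add: norm_mult abs_mult del: of_nat_Suc)
      have prod: "integrable (lborel \<Otimes>\<^sub>M lborel) (\<lambda>(x, y). w x * of_real (g y))"
      proof (rule lborel_pair.Fubini_integrable)
        show "integrable lborel (\<lambda>x. LINT y|lborel. norm (case (x, y) of (x, y) \<Rightarrow> w x * of_real (g y)))"
          using integrable_norm[OF iw] by (simp add: norm_mult)
        show "AE x in lborel. integrable lborel (\<lambda>y. case (x, y) of (x, y) \<Rightarrow> w x * of_real (g y))"
          using g(3) by (auto intro!: AE_I2 integrable_mult_right integrable_of_real)
      qed measurable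
      have kint: "integrable (lborel \<Otimes>\<^sub>M lborel) (\<lambda>(x, y). ?k x y)"
        by (rule Bochner_Integration.integrable_bound[OF prod])
           (use bd in \<open>auto intro!: AE_I2 simp: norm_mult\<close>)
      have inner: "(LINT x|lborel. ?k x y) = 0" for y
      proof -
        have "(LINT x|lborel. ?k x y)
            = (LINT x|lborel. of_real (g y) * (w x * of_real (exp (- real (Suc N) * (norm (x - y))\<^sup>2))))"
          by (simp add: mult_ac)
        then show ?thesis using avg'[of N y] by simp
      qed
      have "(LINT x|lborel. (LINT y|lborel. ?k x y)) = (LINT y|lborel. (LINT x|lborel. ?k x y))"
        by (rule lborel_pair.Fubini_integral[symmetric]) (use kint in simp)
      then have "(LINT x|lborel. (LINT y|lborel. ?k x y)) = 0" unfolding inner by simp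
      then have "of_real (sqrt (Suc N) ^ DIM('a)) * (LINT x|lborel. (LINT y|lborel. ?k x y)) = 0" by simp
      then show ?thesis
        unfolding A_def by (simp add: mult_ac flip: integral_complex_of_real integral_mult_right_zero)
    qed
    have "(\<lambda>N. LINT x|lborel. w x * of_real (A N x)) \<longlonglongrightarrow> (LINT x|lborel. w x * of_real (sqrt pi ^ DIM('a) * g x))"
    proof (rule Bochner_Integration.integral_dominated_convergence)
      show "integrable lborel (\<lambda>x. sqrt pi ^ DIM('a) * norm (w x))"
        using iw by auto
      show "AE x in lborel. (\<lambda>N. w x * of_real (A N x)) \<longlonglongrightarrow> w x * of_real (sqrt pi ^ DIM('a) * g x)"
        unfolding A_def
        by (intro AE_I2 tendsto_mult[OF tendsto_const] tendsto_of_real gaussian_averages_tendsto(1)[OF g(1,2)])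
      show "AE x in lborel. norm (w x * of_real (A N x)) \<le> sqrt pi ^ DIM('a) * norm (w x)" for N
      proof (rule AE_I2)
        fix x
        have "norm (w x) * \<bar>A N x\<bar> \<le> norm (w x) * sqrt pi ^ DIM('a)"
          unfolding A_def by (intro mult_left_mono gaussian_averages_tendsto(2)[OF g(1,2)]) auto
        then show "norm (w x * of_real (A N x)) \<le> sqrt pi ^ DIM('a) * norm (w x)"
          by (simp add: norm_mult mult_ac)
      qed
      show "(\<lambda>x. w x * of_real (A N x)) \<in> borel_measurable lborel" for N
        unfolding A_def by measurable
    qed measurable
    then have "(LINT x|lborel. of_real (sqrt pi ^ DIM('a)) * (w x * of_real (g x))) = 0"
      unfolding zero LIMSEQ_const_iff by (simp add: mult_ac)
    then show ?thesis by (simp only: integral_mult_right_zero) auto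
  qed
  have op: "(LINT x|lborel. w x * of_real (indicator U x)) = 0" if U: "open U" for U
  proof -
    \<comment> \<open>the distance to the complement, which needs a default value when the complement is empty\<close>
    define d where "d x = (if U = UNIV then 1 else infdist x (- U))" for x
    have d: "continuous_on UNIV d" "\<And>x. 0 \<le> d x"
      unfolding d_def by (cases "U = UNIV"; auto intro!: continuous_on_infdist continuous_intros infdist_nonneg)+
    have dU: "0 < d x \<longleftrightarrow> x \<in> U" for x
    proof (cases "U = UNIV")
      case False
      then have ne: "- U \<noteq> {}" by auto
      have "closed (- U)" using U by auto
      from in_closed_iff_infdist_zero[OF this ne, of x] show ?thesis
        using False infdist_nonneg[of x "- U"] by (auto simp: d_def less_le)
    qed (simp add: d_def)
    define g where "g N x = exp (- (1 / real (Suc N)) * (norm x)\<^sup>2) * min 1 (real N * d x)" for N x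
    have g1: "0 \<le> g N x" "g N x \<le> exp (- (1 / real (Suc N)) * (norm x)\<^sup>2)" "g N x \<le> 1" for N x
    proof -
      show 0: "0 \<le> g N x" using d(2)[of x] by (simp add: g_def)
      show 1: "g N x \<le> exp (- (1 / real (Suc N)) * (norm x)\<^sup>2)"
        unfolding g_def by (rule mult_left_le) auto
      show "g N x \<le> 1" by (rule order_trans[OF 1]) simp
    qed
    have gc: "continuous_on UNIV (g N)" for N
      unfolding g_def using d(1) by (intro continuous_intros) auto
    have gi: "integrable lborel (g N)" for N
    proof (rule Bochner_Integration.integrable_bound[OF integral_gaussian(1)])
      show "0 < 1 / real (Suc N)" by simp
      show "g N \<in> borel_measurable lborel" using borel_measurable_continuous_onI[OF gc] by simp
    qed (use g1 in auto)
    have [measurable]: "g N \<in> borel_measurable borel" for N by (rule borel_measurable_continuous_onI[OF gc])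
    have [measurable]: "U \<in> sets borel" using U by simp
    have z: "(LINT x|lborel. w x * of_real (g N x)) = 0" for N
      by (rule cont[OF gc _ gi]) (use g1[of N] in \<open>auto simp: abs_le_iff intro: order_trans[of _ 0]\<close>)
    have "(\<lambda>N. LINT x|lborel. w x * of_real (g N x)) \<longlonglongrightarrow> (LINT x|lborel. w x * of_real (indicator U x))"
    proof (rule Bochner_Integration.integral_dominated_convergence[OF _ _ integrable_norm[OF iw]])
      show "AE x in lborel. (\<lambda>N. w x * of_real (g N x)) \<longlonglongrightarrow> w x * of_real (indicator U x)"
      proof (intro AE_I2 tendsto_intros)
        fix x :: 'a
        have e: "(\<lambda>N. exp (- (1 / real (Suc N)) * (norm x)\<^sup>2)) \<longlonglongrightarrow> 1" by real_asymp
        have m: "(\<lambda>N. min 1 (real N * d x)) \<longlonglongrightarrow> indicator U x"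
        proof (cases "x \<in> U")
          case True
          then have "0 < d x" using dU by simp
          then have "eventually (\<lambda>N. 1 \<le> real N * d x) sequentially" by real_asymp
          then have "eventually (\<lambda>N. min 1 (real N * d x) = indicator U x) sequentially"
            by eventually_elim (use True in simp)
          then show ?thesis by (rule tendsto_eventually)
        next
          case False
          then have "d x = 0" using dU[of x] d(2)[of x] by linarith
          then show ?thesis using False by simp
        qed
        show "(\<lambda>N. g N x) \<longlonglongrightarrow> indicator U x"
          using tendsto_mult[OF e m] by (simp add: g_def)
      qed
      show "AE x in lborel. norm (w x * of_real (g N x)) \<le> norm (w x)" for N
        using g1[of N] by (auto intro!: AE_I2 mult_left_le simp: norm_mult)
    qed measurable
    then show ?thesis unfolding z LIMSEQ_const_iff by simp
  qed
  have all: "(LINT x|lborel. w x * of_real (indicator A x)) = 0" if "A \<in> sets borel" for A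
  proof -
    have "Int_stable {S::'a set. open S}" by (auto intro!: Int_stableI)
    moreover have "{S::'a set. open S} \<subseteq> Pow UNIV" by auto
    moreover have "A \<in> sigma_sets UNIV {S. open S}" using that by (simp add: sets_borel)
    ultimately show ?thesis
    proof (induction rule: sigma_sets_induct_disjoint)
      case (basic A) then show ?case using op by simp
    next
      case (compl A)
      have [measurable]: "A \<in> sets borel" using compl(1) by (simp add: sets_borel)
      have 1: "integrable lborel (\<lambda>x. w x * of_real (indicator A x))"
        by (rule Bochner_Integration.integrable_bound[OF iw]) (auto intro!: AE_I2 simp: norm_mult indicator_def)
      have "w x * of_real (indicator (UNIV - A) x) = w x * of_real (indicator UNIV x) - w x * of_real (indicator A x)" for x
        by (simp add: indicator_def)
      then have "(LINT x|lborel. w x * of_real (indicator (UNIV - A) x))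
         = (LINT x|lborel. w x * of_real (indicator UNIV x)) - (LINT x|lborel. w x * of_real (indicator A x))"
        using 1 iw by simp
      then show ?case using compl(2) op[of UNIV] by simp
    next
      case (union A)
      have [measurable]: "A i \<in> sets borel" for i using union(2) by (auto simp: sets_borel)
      have "(\<lambda>n. LINT x|lborel. (\<Sum>i<n. w x * of_real (indicator (A i) x)))
          \<longlonglongrightarrow> (LINT x|lborel. w x * of_real (indicator (\<Union> (range A)) x))"
      proof (rule Bochner_Integration.integral_dominated_convergence[OF _ _ integrable_norm[OF iw]])
        have s: "(\<Sum>i<n. w x * complex_of_real (indicator (A i) x)) = w x * of_real (\<Sum>i<n. indicator (A i) x)" for n x
          by (simp add: sum_distrib_left)
        show "AE x in lborel. (\<lambda>n. \<Sum>i<n. w x * of_real (indicator (A i) x)) \<longlonglongrightarrow> w x * of_real (indicator (\<Union> (range A)) x)"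
          unfolding s using indicator_sums[of A] union(1)
          by (intro AE_I2 tendsto_mult[OF tendsto_const] tendsto_of_real) (auto simp: sums_def disjoint_family_on_def)
        show "AE x in lborel. norm (\<Sum>i<n. w x * of_real (indicator (A i) x)) \<le> norm (w x)" for n
        proof (rule AE_I2)
          fix x :: 'a
          have "(\<Sum>i<n. indicator (A i) x) = (indicator (\<Union>i<n. A i) x :: real)"
            using union(1) by (intro indicator_UN_disjoint[symmetric]) (auto simp: disjoint_family_on_def)
          then show "norm (\<Sum>i<n. w x * of_real (indicator (A i) x)) \<le> norm (w x)"
            unfolding s by (auto simp: norm_mult indicator_def)
        qed
      qed measurable
      moreover have "(LINT x|lborel. (\<Sum>i<n. w x * complex_of_real (indicator (A i) x))) = 0" for n
      proof (subst Bochner_Integration.integral_sum)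
        show "integrable lborel (\<lambda>x. w x * complex_of_real (indicator (A i) x))" for i
          by (rule Bochner_Integration.integrable_bound[OF iw]) (auto intro!: AE_I2 simp: norm_mult indicator_def)
      qed (use union(3) in simp)
      ultimately show ?case by (simp add: LIMSEQ_const_iff)
    qed auto
  qed
  have iA: "integrable lborel (\<lambda>x. w x * of_real (indicator A x))" if [measurable]: "A \<in> sets borel" for A
    by (rule Bochner_Integration.integrable_bound[OF iw]) (auto intro!: AE_I2 simp: norm_mult indicator_def)
  have "AE x in lborel. Re (w x) = (0::real)"
  proof (rule density_unique_real)
    fix A :: "'a set" assume "A \<in> sets lborel"
    then have "A \<in> sets borel" by simp
    then show "(LINT x:A|lborel. Re (w x)) = (LINT x:A|lborel. 0)"
      using all[of A] integral_Re[OF iA[of A]] by (simp add: set_lebesgue_integral_def mult.commute)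
  qed (use iw in auto)
  moreover have "AE x in lborel. Im (w x) = (0::real)"
  proof (rule density_unique_real)
    fix A :: "'a set" assume "A \<in> sets lborel"
    then have "A \<in> sets borel" by simp
    then show "(LINT x:A|lborel. Im (w x)) = (LINT x:A|lborel. 0)"
      using all[of A] integral_Im[OF iA[of A]] by (simp add: set_lebesgue_integral_def mult.commute)
  qed (use iw in auto)
  ultimately have "AE x in lborel. v x = 0" using vw
    by eventually_elim (simp add: complex_eq_iff)
  then show ?thesis by (rule AE_completion)
qed

section \<open>A class of smooth functions containing cut-offs\<close>

text \<open>For \<open>q = 1\<close> this is the standard flat function; polynomial factors \<open>q(1/t)\<close> close the family
  under differentiation.\<close>

definition flat :: "real poly \<Rightarrow> real \<Rightarrow> real" where
  "flat q t = (if 0 < t then poly q (1 / t) * exp (- (1 / t)) else 0)"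

lemma tendsto_poly_exp_0: "((\<lambda>s. poly q s * exp (- s)) \<longlongrightarrow> (0::real)) at_top"
proof -
  have "((\<lambda>s. \<Sum>i\<le>degree q. coeff q i * (s ^ i / exp s)) \<longlongrightarrow> (\<Sum>i\<le>degree q. coeff q i * 0)) at_top"
    by (intro tendsto_sum tendsto_mult tendsto_const tendsto_power_div_exp_0)
  then show ?thesis
    by (simp add: poly_altdef sum_distrib_right exp_minus divide_inverse mult.assoc)
qed

lemma DERIV_flat:
  "(flat q has_real_derivative flat ([:0, 0, 1:] * (q - pderiv q)) t) (at t)"
proof -
  consider "0 < t" | "t < 0" | "t = 0" by linarith
  then show ?thesis
  proof cases
    case 1
    have "((\<lambda>t. poly q (1 / t) * exp (- (1 / t))) has_real_derivative flat ([:0, 0, 1:] * (q - pderiv q)) t) (at t)"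
      using 1 unfolding flat_def
      by (auto intro!: derivative_eq_intros DERIV_chain'[OF _ poly_DERIV] simp: field_simps power2_eq_square)
    then show ?thesis
      by (rule has_field_derivative_transform_within_open[where S="{0<..}"]) (use 1 in \<open>auto simp: flat_def\<close>)
  next
    case 2
    have "((\<lambda>t. 0) has_real_derivative flat ([:0, 0, 1:] * (q - pderiv q)) t) (at t)"
      using 2 by (simp add: flat_def)
    then show ?thesis
      by (rule has_field_derivative_transform_within_open[where S="{..<0}"]) (use 2 in \<open>auto simp: flat_def\<close>)
  next
    case 3
    have r: "((\<lambda>h. poly ([:0, 1:] * q) (inverse h) * exp (- inverse h)) \<longlongrightarrow> 0) (at_right 0)"
      by (rule filterlim_compose[OF tendsto_poly_exp_0 filterlim_inverse_at_top_right])
    have "((\<lambda>h. (flat q (0 + h) - flat q 0) / h) \<longlongrightarrow> 0) (at 0)"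
      unfolding filterlim_at_split
    proof
      show "((\<lambda>h. (flat q (0 + h) - flat q 0) / h) \<longlongrightarrow> 0) (at_left 0)"
        by (rule tendsto_eventually) (auto simp: flat_def eventually_at_filter)
      show "((\<lambda>h. (flat q (0 + h) - flat q 0) / h) \<longlongrightarrow> 0) (at_right 0)"
      proof (rule Lim_transform_eventually[OF r])
        show "\<forall>\<^sub>F h in at_right 0. poly ([:0, 1:] * q) (inverse h) * exp (- inverse h) = (flat q (0 + h) - flat q 0) / h"
          by (auto simp: flat_def eventually_at_filter field_simps)
      qed
    qed
    then show ?thesis unfolding 3 DERIV_def by (simp add: flat_def)
  qed
qed

text \<open>Smoothness in the sense of iterated partial derivatives is established by closure: each generator and
  each operation below has partial derivatives that lie again in the class.\<close>

inductive sm :: "(real^'n::finite \<Rightarrow> real) \<Rightarrow> bool" where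
  sm_const: "sm (\<lambda>x. c)"
| sm_coord: "sm (\<lambda>x. x $ j)"
| sm_add: "sm f \<Longrightarrow> sm g \<Longrightarrow> sm (\<lambda>x. f x + g x)"
| sm_mult: "sm f \<Longrightarrow> sm g \<Longrightarrow> sm (\<lambda>x. f x * g x)"
| sm_exp: "sm f \<Longrightarrow> sm (\<lambda>x. exp (f x))"
| sm_flat: "sm f \<Longrightarrow> sm (\<lambda>x. flat q (f x))"

lemma sm_sum: "(\<And>i. i \<in> A \<Longrightarrow> sm (f i)) \<Longrightarrow> sm (\<lambda>x. \<Sum>i\<in>A. f i x)"
  by (induction A rule: infinite_finite_induct) (auto intro: sm.intros)

lemma sm_prod: "(\<And>i. i \<in> A \<Longrightarrow> sm (f i)) \<Longrightarrow> sm (\<lambda>x. \<Prod>i\<in>A. f i x)"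
  by (induction A rule: infinite_finite_induct) (auto intro: sm.intros)

lemma sm_scale: "sm f \<Longrightarrow> sm (\<lambda>x. c * f x)"
  by (intro sm_mult sm_const)

lemma sm_diff: "sm f \<Longrightarrow> sm g \<Longrightarrow> sm (\<lambda>x. f x - g x)"
  using sm_add[OF _ sm_scale[of g "-1"]] by simp

lemma sm_power: "sm f \<Longrightarrow> sm (\<lambda>x. f x ^ k)"
  by (induction k) (auto intro: sm.intros)

lemma sm_has_derivative:
  fixes f :: "real^'n::finite \<Rightarrow> real"
  shows "sm f \<Longrightarrow> \<exists>D. (\<forall>j. sm (D j)) \<and> (\<forall>x. (f has_derivative (\<lambda>h. \<Sum>j\<in>UNIV. D j x * h $ j)) (at x))"
proof (induction rule: sm.induct)
  case (sm_const c)
  show ?case by (rule exI[of _ "\<lambda>j x. 0"]) (auto intro: sm.intros)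
next
  case (sm_coord i)
  have "(\<Sum>j\<in>UNIV. (if j = i then 1 else 0) * h $ j) = h $ i" for h :: "real^'n"
    by (simp add: if_distrib[of "\<lambda>a. a * _"] cong: if_cong)
  moreover have "((\<lambda>x::real^'n. x $ i) has_derivative (\<lambda>h. h $ i)) (at x)" for x
    by (rule bounded_linear_imp_has_derivative[OF bounded_linear_vec_nth])
  ultimately show ?case
    by (intro exI[of _ "\<lambda>j x. if j = i then 1 else 0"]) (auto intro: sm.intros)
next
  case (sm_add f g)
  then obtain D E where
    D: "\<And>j. sm (D j)" "\<And>x. (f has_derivative (\<lambda>h. \<Sum>j\<in>UNIV. D j x * h $ j)) (at x)" and
    E: "\<And>j. sm (E j)" "\<And>x. (g has_derivative (\<lambda>h. \<Sum>j\<in>UNIV. E j x * h $ j)) (at x)"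
    by blast
  have "((\<lambda>x. f x + g x) has_derivative (\<lambda>h. \<Sum>j\<in>UNIV. (D j x + E j x) * h $ j)) (at x)" for x
    by (rule has_derivative_eq_rhs[OF has_derivative_add[OF D(2) E(2)]])
       (auto simp: distrib_right sum.distrib)
  then show ?case using D(1) E(1) by (intro exI[of _ "\<lambda>j x. D j x + E j x"]) (auto intro: sm.intros)
next
  case (sm_mult f g)
  then obtain D E where
    D: "\<And>j. sm (D j)" "\<And>x. (f has_derivative (\<lambda>h. \<Sum>j\<in>UNIV. D j x * h $ j)) (at x)" and
    E: "\<And>j. sm (E j)" "\<And>x. (g has_derivative (\<lambda>h. \<Sum>j\<in>UNIV. E j x * h $ j)) (at x)"
    by blast
  have "((\<lambda>x. f x * g x) has_derivative (\<lambda>h. \<Sum>j\<in>UNIV. (f x * E j x + D j x * g x) * h $ j)) (at x)" for x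
    by (rule has_derivative_eq_rhs[OF has_derivative_mult[OF D(2) E(2)]])
       (auto simp: sum.distrib sum_distrib_left sum_distrib_right algebra_simps)
  then show ?case using D(1) E(1) sm_mult.hyps
    by (intro exI[of _ "\<lambda>j x. f x * E j x + D j x * g x"]) (auto intro!: sm.sm_add sm.sm_mult)
next
  case (sm_exp f)
  then obtain D where
    D: "\<And>j. sm (D j)" "\<And>x. (f has_derivative (\<lambda>h. \<Sum>j\<in>UNIV. D j x * h $ j)) (at x)"
    by blast
  have "((\<lambda>x. exp (f x)) has_derivative (\<lambda>h. \<Sum>j\<in>UNIV. (exp (f x) * D j x) * h $ j)) (at x)" for x
    by (rule has_derivative_eq_rhs[OF has_derivative_exp[OF D(2)]])
       (auto simp: sum_distrib_left sum_distrib_right mult_ac)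
  then show ?case using D(1) sm_exp.hyps
    by (intro exI[of _ "\<lambda>j x. exp (f x) * D j x"]) (auto intro: sm.intros)
next
  case (sm_flat f q)
  then obtain D where
    D: "\<And>j. sm (D j)" "\<And>x. (f has_derivative (\<lambda>h. \<Sum>j\<in>UNIV. D j x * h $ j)) (at x)"
    by blast
  let ?q = "[:0, 0, 1:] * (q - pderiv q)"
  have "((\<lambda>x. flat q (f x)) has_derivative (\<lambda>h. \<Sum>j\<in>UNIV. (flat ?q (f x) * D j x) * h $ j)) (at x)" for x
  proof (rule has_derivative_eq_rhs)
    show "((\<lambda>x. flat q (f x)) has_derivative (\<lambda>h. flat ?q (f x) * (\<Sum>j\<in>UNIV. D j x * h $ j))) (at x)"
      by (rule has_derivative_compose[OF D(2), of "flat q"])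
         (use DERIV_flat[of q "f x"] in \<open>simp only: has_field_derivative_def\<close>)
  qed (auto simp: sum_distrib_left sum_distrib_right mult_ac)
  then show ?case using D(1) sm_flat.hyps
    by (intro exI[of _ "\<lambda>j x. flat ?q (f x) * D j x"]) (auto intro: sm.intros)
qed

text \<open>The real-valued counterpart of \<open>partial_deriv\<close>.\<close>

definition rpd :: "'n \<Rightarrow> (real^'n::finite \<Rightarrow> real) \<Rightarrow> real^'n \<Rightarrow> real" where
  "rpd j f x = deriv (\<lambda>t. f (x + t *\<^sub>R axis j 1)) 0"

lemma rpd_eqI:
  "(\<And>x. ((\<lambda>t. f (x + t *\<^sub>R axis j 1)) has_real_derivative g x) (at 0)) \<Longrightarrow> rpd j f = g"
  unfolding rpd_def by (rule ext) (auto intro: DERIV_imp_deriv)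

lemma has_real_derivative_along_axis:
  fixes x :: "real^'n::finite"
  assumes "(f has_derivative (\<lambda>h. \<Sum>j\<in>UNIV. D j * h $ j)) (at x)"
  shows "((\<lambda>t. f (x + t *\<^sub>R axis j 1)) has_real_derivative D j) (at 0)"
proof -
  have "((\<lambda>t::real. x + t *\<^sub>R axis j 1) has_derivative (\<lambda>t. t *\<^sub>R axis j 1)) (at 0)"
    by (auto intro!: derivative_eq_intros)
  then have "((\<lambda>t. f (x + t *\<^sub>R axis j 1)) has_derivative (\<lambda>t. \<Sum>i\<in>UNIV. D i * (t *\<^sub>R axis j 1) $ i)) (at 0)"
    by (rule has_derivative_compose) (use assms in simp)
  moreover have "(\<lambda>t. \<Sum>i\<in>UNIV. D i * (t *\<^sub>R axis j 1) $ i) = (\<lambda>t. D j * t)"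
    by (auto simp: axis_def if_distrib[of "\<lambda>a. _ * a"] cong: if_cong)
  ultimately show ?thesis by (simp add: has_field_derivative_def)
qed

lemma
  assumes "sm f"
  shows sm_rpd: "sm (rpd j f)"
    and DERIV_rpd: "((\<lambda>t. f (x + t *\<^sub>R axis j 1)) has_real_derivative rpd j f x) (at 0)"
    and sm_differentiable: "f differentiable (at x)"
proof -
  obtain D where D: "\<And>j. sm (D j)" "\<And>x. (f has_derivative (\<lambda>h. \<Sum>j\<in>UNIV. D j x * h $ j)) (at x)"
    using sm_has_derivative[OF assms] by blast
  have "\<And>x. ((\<lambda>t. f (x + t *\<^sub>R axis j 1)) has_real_derivative D j x) (at 0)"
    by (rule has_real_derivative_along_axis[OF D(2)])
  moreover from this have "rpd j f = D j" by (rule rpd_eqI)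
  ultimately show "sm (rpd j f)" "((\<lambda>t. f (x + t *\<^sub>R axis j 1)) has_real_derivative rpd j f x) (at 0)"
    using D(1) by auto
  show "f differentiable (at x)" using D(2) unfolding differentiable_def by blast
qed

lemma sm_continuous: "sm f \<Longrightarrow> continuous_on UNIV f"
  by (intro differentiable_imp_continuous_on)
     (auto simp: differentiable_on_def intro: sm_differentiable differentiable_at_withinI)

lemma sm_measurable: "sm f \<Longrightarrow> f \<in> borel_measurable borel"
  by (intro borel_measurable_continuous_onI sm_continuous)

lemma rpd_mult:
  assumes "sm f" "sm g"
  shows "rpd j (\<lambda>x. f x * g x) = (\<lambda>x. f x * rpd j g x + rpd j f x * g x)"
  by (rule rpd_eqI) (use DERIV_mult[OF DERIV_rpd[OF assms(1)] DERIV_rpd[OF assms(2)]] in \<open>simp add: algebra_simps\<close>)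

lemma partial_deriv_of_real:
  assumes "sm f"
  shows "partial_deriv j (\<lambda>x. complex_of_real (f x)) = (\<lambda>x. of_real (rpd j f x))"
proof
  fix x
  have "((\<lambda>t. complex_of_real (f (x + t *\<^sub>R axis j 1))) has_vector_derivative of_real (rpd j f x)) (at 0)"
    by (rule has_vector_derivative_of_real[OF DERIV_rpd[OF assms]])
  then show "partial_deriv j (\<lambda>x. complex_of_real (f x)) x = of_real (rpd j f x)"
    unfolding partial_deriv_def by (rule vector_derivative_at)
qed

lemma smooth_of_real:
  assumes "sm f" shows "smooth (\<lambda>x. complex_of_real (f x))"
proof -
  have "\<exists>g. sm g \<and> iter_partial js (\<lambda>x. complex_of_real (f x)) = (\<lambda>x. of_real (g x))" for js
  proof (induction js)
    case Nil then show ?case using assms by auto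
  next
    case (Cons j js)
    then obtain g where "sm g" "iter_partial js (\<lambda>x. complex_of_real (f x)) = (\<lambda>x. of_real (g x))" by blast
    then show ?case using sm_rpd[of g j] partial_deriv_of_real[of g j] by auto
  qed
  moreover have "(\<lambda>x. complex_of_real (g x)) differentiable (at x)" if "sm g" for g x
    by (rule differentiable_compose[of of_real])
       (use sm_differentiable[OF that] in \<open>auto intro: bounded_linear_imp_differentiable bounded_linear_of_real\<close>)
  ultimately show ?thesis unfolding smooth_def by metis
qed

lemma test_functionI:
  assumes "sm f" "compact K" "\<And>x. x \<notin> K \<Longrightarrow> f x = 0"
  shows "(\<lambda>x. complex_of_real (f x)) \<in> test_functions"
  using smooth_of_real[OF assms(1)] assms(2,3) unfolding test_functions_def by auto

section \<open>Cut-off functions\<close>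

text \<open>As \<open>R \<rightarrow> \<infinity>\<close> the cut-off tends to \<open>1\<close> boundedly and its gradient is of size
  \<open>|x| / R\<^sup>2\<close>; this is what dominated convergence uses. The factor \<open>exp 1\<close> normalises the value at the
  origin.\<close>

definition cutoff :: "real \<Rightarrow> real^'n::finite \<Rightarrow> real" where
  "cutoff R x = exp 1 * flat 1 (1 - (\<Sum>j\<in>UNIV. (x $ j)\<^sup>2) / R\<^sup>2)"

lemma norm_power2_vec: "(norm (x::real^'n::finite))\<^sup>2 = (\<Sum>j\<in>UNIV. (x $ j)\<^sup>2)"
  by (simp add: norm_vec_def L2_set_def sum_nonneg)

lemma sm_norm_diff_power2: "sm (\<lambda>x. (norm (x - y))\<^sup>2)"
  unfolding norm_power2_vec vector_minus_component by (intro sm_sum sm_power sm_diff sm_coord sm_const)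

lemma sm_norm_power2: "sm (\<lambda>x. (norm x)\<^sup>2)"
  using sm_norm_diff_power2[of 0] by simp

lemma cutoff_altdef: "cutoff R x = exp 1 * flat 1 (1 - (norm x)\<^sup>2 / R\<^sup>2)"
  by (simp add: cutoff_def norm_power2_vec)

lemma sm_cutoff: "sm (cutoff R)"
proof -
  have "sm (\<lambda>x. exp 1 * flat 1 (1 - (1 / R\<^sup>2) * (\<Sum>j\<in>UNIV. (x $ j)\<^sup>2)))"
    by (intro sm_scale sm_flat sm_diff sm_const sm_sum sm_power sm_coord)
  then show ?thesis by (simp add: cutoff_def[abs_def])
qed

lemma cutoff_bounds: "0 \<le> cutoff R x" "cutoff R x \<le> 1"
proof -
  show "0 \<le> cutoff R x" by (simp add: cutoff_def flat_def)
  show "cutoff R x \<le> 1"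
  proof (cases "0 < 1 - (norm x)\<^sup>2 / R\<^sup>2")
    case True
    have "1 - (norm x)\<^sup>2 / R\<^sup>2 \<le> 1" by simp
    then have "1 \<le> 1 / (1 - (norm x)\<^sup>2 / R\<^sup>2)" using True by simp
    then have "exp (1 + - (1 / (1 - (norm x)\<^sup>2 / R\<^sup>2))) \<le> 1" by simp
    then show ?thesis using True by (simp add: cutoff_altdef flat_def exp_diff divide_inverse exp_minus)
  qed (simp add: cutoff_altdef flat_def)
qed

lemma cutoff_pos_iff:
  assumes "0 < R" shows "0 < cutoff R x \<longleftrightarrow> norm x < R"
proof -
  have "0 < cutoff R x \<longleftrightarrow> (norm x)\<^sup>2 / R\<^sup>2 < 1"
    by (auto simp: cutoff_altdef flat_def)
  also have "\<dots> \<longleftrightarrow> (norm x)\<^sup>2 < R\<^sup>2" using assms by simp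
  also have "\<dots> \<longleftrightarrow> norm x < R" using assms by (metis norm_ge_zero less_imp_le power2_less_imp_less power_strict_mono zero_less_numeral)
  finally show ?thesis .
qed

lemma cutoff_support: "0 < R \<Longrightarrow> x \<notin> cball 0 R \<Longrightarrow> cutoff R x = 0"
  using cutoff_pos_iff[of R x] cutoff_bounds(1)[of R x] by auto

lemma cutoff_tendsto: "(\<lambda>N. cutoff (real (Suc N)) x) \<longlonglongrightarrow> 1"
proof -
  have "(\<lambda>N. 1 - (norm x)\<^sup>2 / (real (Suc N))\<^sup>2) \<longlonglongrightarrow> 1" by real_asymp
  moreover have "isCont (flat 1) 1" by (rule DERIV_isCont[OF DERIV_flat])
  ultimately have "(\<lambda>N. flat 1 (1 - (norm x)\<^sup>2 / (real (Suc N))\<^sup>2)) \<longlonglongrightarrow> flat 1 1"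
    by (rule isCont_tendsto_compose[rotated])
  then have "(\<lambda>N. exp 1 * flat 1 (1 - (norm x)\<^sup>2 / (real (Suc N))\<^sup>2)) \<longlonglongrightarrow> exp 1 * flat 1 1"
    by (intro tendsto_intros)
  moreover have "exp 1 * flat 1 1 = (1::real)" by (simp add: flat_def flip: exp_add)
  ultimately show ?thesis by (simp add: cutoff_altdef)
qed

lemma rpd_cutoff_bound:
  assumes "0 < R" shows "\<bar>rpd j (cutoff R) x\<bar> \<le> 4 * exp 1 * norm x / R\<^sup>2"
proof -
  let ?q = "[:0, 0, 1:] * (1 - pderiv 1) :: real poly"
  have e: "((\<lambda>t. cutoff R (x + t *\<^sub>R axis j 1)) has_real_derivative
      exp 1 * (flat ?q (1 - (norm x)\<^sup>2 / R\<^sup>2) * (- (2 * x $ j / R\<^sup>2)))) (at 0)" for x :: "real^'a"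
  proof -
    have s: "(\<Sum>i\<in>UNIV. ((x + t *\<^sub>R axis j 1) $ i)\<^sup>2) = (x $ j + t)\<^sup>2 + (\<Sum>i\<in>UNIV - {j}. (x $ i)\<^sup>2)" for t
      by (subst sum.remove[of UNIV j]) (auto simp: axis_def intro!: sum.cong)
    have s0: "(norm x)\<^sup>2 = (x $ j)\<^sup>2 + (\<Sum>i\<in>UNIV - {j}. (x $ i)\<^sup>2)"
      using s[of 0] by (simp add: norm_power2_vec)
    have d: "((\<lambda>t. 1 - ((x $ j + t)\<^sup>2 + (\<Sum>i\<in>UNIV - {j}. (x $ i)\<^sup>2)) / R\<^sup>2) has_real_derivative - (2 * x $ j / R\<^sup>2)) (at 0)"
      using assms by (auto intro!: derivative_eq_intros simp: field_simps eval_nat_numeral)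
    have "((\<lambda>t. flat 1 (1 - ((x $ j + t)\<^sup>2 + (\<Sum>i\<in>UNIV - {j}. (x $ i)\<^sup>2)) / R\<^sup>2)) has_real_derivative
      flat ?q (1 - ((x $ j + 0)\<^sup>2 + (\<Sum>i\<in>UNIV - {j}. (x $ i)\<^sup>2)) / R\<^sup>2) * (- (2 * x $ j / R\<^sup>2))) (at 0)"
      by (rule DERIV_chain2[OF DERIV_flat d])
    then show ?thesis unfolding cutoff_def s s0 by (intro DERIV_cmult) simp
  qed
  have f2: "0 \<le> flat ?q t \<and> flat ?q t \<le> 2" for t
  proof (cases "0 < t")
    case True
    have "(1/t)\<^sup>2 / 2 \<le> exp (1/t)" using exp_lower_Taylor_quadratic[of "1/t"] True
      by (smt (verit) divide_nonneg_nonneg zero_le_one)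
    then have "(1/t)\<^sup>2 * exp (- (1/t)) \<le> (2 * exp (1/t)) * exp (- (1/t))"
      by (intro mult_right_mono) auto
    also have "\<dots> = 2" by (simp flip: exp_add)
    finally have "(1/t)\<^sup>2 * exp (- (1/t)) \<le> 2" .
    then show ?thesis using True by (simp add: flat_def power2_eq_square)
  qed (simp add: flat_def)
  have "\<bar>rpd j (cutoff R) x\<bar> = exp 1 * (flat ?q (1 - (norm x)\<^sup>2 / R\<^sup>2) * (2 * \<bar>x $ j\<bar> / R\<^sup>2))"
    using f2 unfolding rpd_eqI[OF e] by (simp add: abs_mult)
  also have "\<dots> \<le> exp 1 * (2 * (2 * norm x / R\<^sup>2))"
    using f2 component_le_norm_cart[of x j] by (intro mult_left_mono mult_mono divide_right_mono) auto
  finally show ?thesis by (simp add: mult_ac)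
qed

section \<open>Weak derivatives tested against rapidly decreasing functions\<close>

definition gdec :: "('a::real_normed_vector \<Rightarrow> 'b::real_normed_vector) \<Rightarrow> bool" where
  "gdec f \<longleftrightarrow> (\<exists>C a. 0 < a \<and> (\<forall>x. norm (f x) \<le> C * exp (- a * (norm x)\<^sup>2)))"

lemma gdec_slow:
  assumes "slow s" "gdec f" "\<And>x. norm (g x) \<le> norm (s x) * norm (f x)"
  shows "gdec g"
proof -
  obtain C a where a: "0 < a" and C: "\<And>x. norm (f x) \<le> C * exp (- a * (norm x)\<^sup>2)"
    using assms(2) unfolding gdec_def by blast
  obtain D where D: "\<And>x. norm (s x) * exp (- a * (norm x)\<^sup>2) \<le> D * exp (- (a / 2) * (norm x)\<^sup>2)"
    using slow_gaussian_bound[OF assms(1) a] by blast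
  have C0: "0 \<le> C" using order_trans[OF norm_ge_zero C[of 0]] by simp
  have "norm (g x) \<le> (C * D) * exp (- (a / 2) * (norm x)\<^sup>2)" for x
  proof -
    have "norm (g x) \<le> norm (s x) * (C * exp (- a * (norm x)\<^sup>2))"
      by (rule order_trans[OF assms(3)]) (intro mult_left_mono C, simp)
    also have "\<dots> = C * (norm (s x) * exp (- a * (norm x)\<^sup>2))" by simp
    also have "\<dots> \<le> C * (D * exp (- (a / 2) * (norm x)\<^sup>2))" by (intro mult_left_mono D C0)
    finally show ?thesis by simp
  qed
  then show ?thesis unfolding gdec_def using a by (intro exI[of _ "C * D"] exI[of _ "a/2"]) auto
qed

lemma gdec_gaussian: "0 < a \<Longrightarrow> gdec (\<lambda>x. exp (- a * (norm x)\<^sup>2))"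
  unfolding gdec_def by (intro exI[of _ 1] exI[of _ a]) auto

lemma integrable_gdec:
  fixes f :: "'a::euclidean_space \<Rightarrow> 'b::{banach, second_countable_topology}"
  assumes "gdec f" "f \<in> borel_measurable borel" shows "integrable lborel f"
proof -
  obtain C a where a: "0 < a" and C: "\<And>x. norm (f x) \<le> C * exp (- a * (norm x)\<^sup>2)"
    using assms(1) unfolding gdec_def by blast
  show ?thesis
    by (rule integrable_slow_gaussian[OF slow_const[of C] a assms(2)])
       (use order_trans[OF C mult_right_mono[OF abs_ge_self]] in auto)
qed

definition growth :: "nat \<Rightarrow> (real^'n::finite \<Rightarrow> complex) \<Rightarrow> bool" where
  "growth r G \<longleftrightarrow> G \<in> borel_measurable lebesgue \<and> (\<exists>C. AE x in lebesgue. cmod (G x) \<le> C * (1 + norm x) ^ r)"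

lemma slow_growth: "slow (\<lambda>x. C * (1 + norm x) ^ r :: real)"
  by (intro slow_mult slow_power slow_add slow_const slow_norm)

lemma integrable_growth_gdec:
  fixes f :: "real^'n::finite \<Rightarrow> complex"
  assumes G: "growth r G" and f: "gdec f" "f \<in> borel_measurable borel"
  shows "integrable lebesgue (\<lambda>x. G x * f x)"
proof -
  obtain C where C: "AE x in lebesgue. cmod (G x) \<le> C * (1 + norm x) ^ r" and m: "G \<in> borel_measurable lebesgue"
    using G unfolding growth_def by blast
  let ?g = "\<lambda>x. C * (1 + norm x) ^ r * norm (f x)"
  have "gdec ?g"
    by (rule gdec_slow[OF slow_growth[of C r] f(1)]) (simp add: abs_mult)
  then have "integrable lborel ?g"
    by (rule integrable_gdec) (use f(2) in measurable)
  then have "integrable lebesgue ?g" using f(2) by (subst integrable_completion) auto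
  then show ?thesis
  proof (rule Bochner_Integration.integrable_bound)
    show "(\<lambda>x. G x * f x) \<in> borel_measurable lebesgue"
      using m measurable_completion[of f lborel borel] f(2) by (intro borel_measurable_times) auto
    show "AE x in lebesgue. norm (G x * f x) \<le> norm (?g x)"
      using C
    proof eventually_elim
      case (elim x)
      have "norm (G x) * norm (f x) \<le> (C * (1 + norm x) ^ r) * norm (f x)"
        by (intro mult_right_mono elim) auto
      then show ?case by (simp add: norm_mult)
    qed
  qed
qed

definition wpair :: "'n \<Rightarrow> (real^'n::finite \<Rightarrow> complex) \<Rightarrow> (real^'n \<Rightarrow> complex) \<Rightarrow> bool" where
  "wpair j G G' \<longleftrightarrow> (\<forall>\<psi>\<in>test_functions.
     (LINT x|lebesgue. G x * partial_deriv j \<psi> x) = - (LINT x|lebesgue. G' x * \<psi> x))"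

text \<open>Insert a cut-off and let its radius grow: the term in which the derivative falls on the cut-off is at
  most a constant times \<open>|x| |\<psi>|\<close> and tends to \<open>0\<close> pointwise.\<close>

lemma wpair_gdec:
  fixes G :: "real^'n::finite \<Rightarrow> complex"
  assumes w: "wpair j G G'" and G: "growth r G" "growth r' G'"
    and \<psi>: "sm \<psi>" "gdec \<psi>" "gdec (rpd j \<psi>)"
  shows "(LINT x|lebesgue. G x * of_real (rpd j \<psi> x)) = - (LINT x|lebesgue. G' x * of_real (\<psi> x))"
proof -
  have Gm: "G \<in> borel_measurable lebesgue" "G' \<in> borel_measurable lebesgue"
    using G by (auto simp: growth_def)
  have lm: "(\<lambda>x. complex_of_real (f x)) \<in> borel_measurable lebesgue" if "sm f" for f :: "real^'n \<Rightarrow> real"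
    by (rule measurable_completion) (use sm_measurable[OF that] in measurable)
  define c where "c N = (cutoff (real (Suc N)) :: real^'n \<Rightarrow> real)" for N
  have c: "sm (c N)" "0 \<le> c N x" "c N x \<le> 1" for N x
    unfolding c_def by (rule sm_cutoff cutoff_bounds)+
  have cl: "(\<lambda>N. c N x) \<longlonglongrightarrow> 1" for x unfolding c_def by (rule cutoff_tendsto)
  have dc: "\<bar>rpd j (c N) x\<bar> \<le> 4 * exp 1 * norm x / (real (Suc N))\<^sup>2" for N x
    unfolding c_def by (rule rpd_cutoff_bound) simp
  have dc': "\<bar>rpd j (c N) x\<bar> \<le> 4 * exp 1 * norm x" for N x
  proof -
    have "4 * exp 1 * norm x / (real (Suc N))\<^sup>2 \<le> 4 * exp 1 * norm x / 1"
      by (intro divide_left_mono) auto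
    then show ?thesis using dc[of N x] by simp
  qed
  have dcl: "(\<lambda>N. rpd j (c N) x) \<longlonglongrightarrow> 0" for x
  proof (rule Lim_null_comparison)
    show "(\<lambda>N. 4 * exp 1 * norm x / (real (Suc N))\<^sup>2) \<longlonglongrightarrow> 0" by real_asymp
  qed (use dc in auto)
  have d: "rpd j (\<lambda>x. c N x * \<psi> x) = (\<lambda>x. c N x * rpd j \<psi> x + rpd j (c N) x * \<psi> x)" for N
    by (rule rpd_mult[OF c(1) \<psi>(1)])
  have eq: "(LINT x|lebesgue. G x * of_real (c N x * rpd j \<psi> x + rpd j (c N) x * \<psi> x))
      = - (LINT x|lebesgue. G' x * of_real (c N x * \<psi> x))" for N
  proof -
    have "(\<lambda>x. complex_of_real (c N x * \<psi> x)) \<in> test_functions"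
      by (rule test_functionI[of _ "cball 0 (real (Suc N))"])
         (use sm_mult[OF c(1) \<psi>(1)] in \<open>auto simp: c_def cutoff_support simp del: of_nat_Suc\<close>)
    from w[unfolded wpair_def, rule_format, OF this] show ?thesis
      unfolding partial_deriv_of_real[OF sm_mult[OF c(1) \<psi>(1)]] d .
  qed
  have L1: "(\<lambda>N. LINT x|lebesgue. G x * of_real (c N x * rpd j \<psi> x + rpd j (c N) x * \<psi> x))
      \<longlonglongrightarrow> (LINT x|lebesgue. G x * of_real (1 * rpd j \<psi> x + 0 * \<psi> x))"
  proof (rule Bochner_Integration.integral_dominated_convergence)
    have "integrable lebesgue (\<lambda>x. G x * of_real (norm (rpd j \<psi> x)))"
      by (rule integrable_growth_gdec[OF G(1)])
         (use \<psi> sm_measurable[OF sm_rpd[OF \<psi>(1)]] in \<open>auto simp: gdec_def\<close>)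
    moreover have "integrable lebesgue (\<lambda>x. G x * of_real (4 * exp 1 * norm x * norm (\<psi> x)))"
    proof (rule integrable_growth_gdec[OF G(1)])
      have "slow (\<lambda>x::real^'n. 4 * exp 1 * norm x :: real)" by (intro slow_mult slow_const slow_norm)
      then show "gdec (\<lambda>x. complex_of_real (4 * exp 1 * norm x * norm (\<psi> x)))"
        by (rule gdec_slow[OF _ \<psi>(2)]) (simp add: norm_mult)
    qed (use sm_measurable[OF \<psi>(1)] in measurable)
    ultimately show "integrable lebesgue (\<lambda>x. norm (G x * of_real (norm (rpd j \<psi> x))) + norm (G x * of_real (4 * exp 1 * norm x * norm (\<psi> x))))"
      by (intro Bochner_Integration.integrable_add integrable_norm)
    show "AE x in lebesgue. (\<lambda>N. G x * of_real (c N x * rpd j \<psi> x + rpd j (c N) x * \<psi> x))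
        \<longlonglongrightarrow> G x * of_real (1 * rpd j \<psi> x + 0 * \<psi> x)"
      by (intro AE_I2 tendsto_intros cl dcl)
    show "AE x in lebesgue. norm (G x * of_real (c N x * rpd j \<psi> x + rpd j (c N) x * \<psi> x))
        \<le> norm (G x * of_real (norm (rpd j \<psi> x))) + norm (G x * of_real (4 * exp 1 * norm x * norm (\<psi> x)))" for N
    proof (rule AE_I2)
      fix x
      have "\<bar>c N x * rpd j \<psi> x + rpd j (c N) x * \<psi> x\<bar> \<le> 1 * \<bar>rpd j \<psi> x\<bar> + (4 * exp 1 * norm x) * \<bar>\<psi> x\<bar>"
        using c(2,3)[of N x] dc'[of N x]
        by (intro order_trans[OF abs_triangle_ineq] add_mono) (auto simp: abs_mult intro!: mult_right_mono mult_left_le_one_le)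
      then have "norm (G x) * \<bar>c N x * rpd j \<psi> x + rpd j (c N) x * \<psi> x\<bar>
          \<le> norm (G x) * (\<bar>rpd j \<psi> x\<bar> + (4 * exp 1 * norm x) * \<bar>\<psi> x\<bar>)"
        by (intro mult_left_mono) auto
      then show "norm (G x * of_real (c N x * rpd j \<psi> x + rpd j (c N) x * \<psi> x))
        \<le> norm (G x * of_real (norm (rpd j \<psi> x))) + norm (G x * of_real (4 * exp 1 * norm x * norm (\<psi> x)))"
        unfolding norm_mult norm_of_real by (simp add: distrib_left abs_mult)
    qed
  qed (intro borel_measurable_times Gm lm sm_add sm_mult c \<psi> sm_rpd sm_const)+
  have L2: "(\<lambda>N. LINT x|lebesgue. G' x * of_real (c N x * \<psi> x))
      \<longlonglongrightarrow> (LINT x|lebesgue. G' x * of_real (1 * \<psi> x))"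
  proof (rule Bochner_Integration.integral_dominated_convergence)
    have "integrable lebesgue (\<lambda>x. G' x * of_real (\<psi> x))"
      by (rule integrable_growth_gdec[OF G(2)])
         (use \<psi> sm_measurable[OF \<psi>(1)] in \<open>auto simp: gdec_def\<close>)
    then show "integrable lebesgue (\<lambda>x. norm (G' x * of_real (\<psi> x)))" by (rule integrable_norm)
    show "AE x in lebesgue. (\<lambda>N. G' x * of_real (c N x * \<psi> x)) \<longlonglongrightarrow> G' x * of_real (1 * \<psi> x)"
      by (intro AE_I2 tendsto_intros cl)
    show "AE x in lebesgue. norm (G' x * of_real (c N x * \<psi> x)) \<le> norm (G' x * of_real (\<psi> x))" for N
      using c(2,3)[of N] by (intro AE_I2) (auto simp: norm_mult abs_mult intro!: mult_left_mono mult_left_le_one_le)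
  qed (intro borel_measurable_times Gm lm sm_mult c \<psi> sm_const)+
  have "(LINT x|lebesgue. G x * of_real (1 * rpd j \<psi> x + 0 * \<psi> x)) = - (LINT x|lebesgue. G' x * of_real (1 * \<psi> x))"
    using L1 tendsto_minus[OF L2] unfolding eq by (rule LIMSEQ_unique)
  then show ?thesis by simp
qed

text \<open>The fundamental lemma of the calculus of variations: Gaussians multiplied by a cut-off are test
  functions, so a locally integrable function orthogonal to all test functions has vanishing
  Gaussian averages after multiplication by each cut-off.\<close>

lemma AE_eq_of_weak_deriv_Nil:
  fixes m :: "real^'n::finite \<Rightarrow> complex"
  assumes "weak_deriv [] m g"
  shows "AE x in lebesgue. m x = g x"
proof -
  have li: "locally_integrable m" "locally_integrable g"
    and eq: "\<And>\<psi>. \<psi> \<in> test_functions \<Longrightarrow> (LINT x|lebesgue. m x * \<psi> x) = (LINT x|lebesgue. g x * \<psi> x)"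
    using assms by (auto simp: weak_deriv_def)
  have lm: "(\<lambda>x. complex_of_real (f x)) \<in> borel_measurable lebesgue" if "sm f" for f :: "real^'n \<Rightarrow> real"
    by (rule measurable_completion) (use sm_measurable[OF that] in measurable)
  have int: "integrable lebesgue (\<lambda>x. h x * of_real (cutoff R x * f x))"
    if h: "locally_integrable h" and R: "0 < R" and f: "sm f" "\<And>x. \<bar>f x\<bar> \<le> 1" for h R and f :: "real^'n \<Rightarrow> real"
  proof -
    have "set_integrable lebesgue (cball 0 R) h" using h by (auto simp: locally_integrable_def)
    then have "integrable lebesgue (\<lambda>x. indicator (cball 0 R) x *\<^sub>R h x)" by (simp add: set_integrable_def)
    then show ?thesis
    proof (rule Bochner_Integration.integrable_bound)
      show "(\<lambda>x. h x * of_real (cutoff R x * f x)) \<in> borel_measurable lebesgue"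
        using h by (intro borel_measurable_times lm sm_mult sm_cutoff f) (auto simp: locally_integrable_def)
      show "AE x in lebesgue. norm (h x * of_real (cutoff R x * f x)) \<le> norm (indicator (cball 0 R) x *\<^sub>R h x)"
      proof (rule AE_I2)
        fix x :: "real^'n"
        have "cutoff R x * \<bar>f x\<bar> \<le> 1" by (rule mult_le_one) (use f cutoff_bounds[of R x] in auto)
        then have "norm (h x) * (cutoff R x * \<bar>f x\<bar>) \<le> norm (h x)" by (rule mult_left_le) simp
        then show "norm (h x * of_real (cutoff R x * f x)) \<le> norm (indicator (cball 0 R) x *\<^sub>R h x)"
          using cutoff_support[OF R, of x] cutoff_bounds(1)[of R x]
          by (cases "x \<in> cball 0 R") (auto simp: norm_mult abs_mult)
      qed
    qed
  qed
  have z: "AE x in lebesgue. (m x - g x) * of_real (cutoff (real (Suc R)) x) = 0" for R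
  proof (rule AE_zero_of_gaussian_averages)
    have "integrable lebesgue (\<lambda>x. m x * of_real (cutoff (real (Suc R)) x * 1) - g x * of_real (cutoff (real (Suc R)) x * 1))"
      by (intro Bochner_Integration.integrable_diff int li sm_const) auto
    then show "integrable lebesgue (\<lambda>x. (m x - g x) * of_real (cutoff (real (Suc R)) x))"
      by (simp add: left_diff_distrib)
    fix N :: nat and y :: "real^'n"
    let ?e = "\<lambda>x. exp (- real (Suc N) * (norm (x - y))\<^sup>2)"
    have e: "sm ?e" "\<And>x. \<bar>?e x\<bar> \<le> 1"
      by (intro sm_exp sm_scale sm_norm_diff_power2) (simp del: of_nat_Suc)
    have t: "(\<lambda>x. complex_of_real (cutoff (real (Suc R)) x * ?e x)) \<in> test_functions"
      by (rule test_functionI[of _ "cball 0 (real (Suc R))"])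
         (use sm_mult[OF sm_cutoff e(1)] in \<open>auto simp: cutoff_support simp del: of_nat_Suc\<close>)
    have "(LINT x|lebesgue. (m x - g x) * of_real (cutoff (real (Suc R)) x) * of_real (?e x))
       = (LINT x|lebesgue. m x * of_real (cutoff (real (Suc R)) x * ?e x) - g x * of_real (cutoff (real (Suc R)) x * ?e x))"
      by (simp add: algebra_simps)
    also have "\<dots> = (LINT x|lebesgue. m x * of_real (cutoff (real (Suc R)) x * ?e x))
       - (LINT x|lebesgue. g x * of_real (cutoff (real (Suc R)) x * ?e x))"
      by (intro Bochner_Integration.integral_diff int li e) auto
    also have "\<dots> = 0" using eq[OF t] by simp
    finally show "(LINT x|lebesgue. (m x - g x) * of_real (cutoff (real (Suc R)) x) * of_real (?e x)) = 0" .
  qed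
  then have "AE x in lebesgue. \<forall>R. (m x - g x) * of_real (cutoff (real (Suc R)) x) = 0"
    unfolding AE_all_countable by blast
  then show ?thesis
  proof eventually_elim
    case (elim x)
    obtain R where "norm x < real R" using reals_Archimedean2 by blast
    then have "0 < cutoff (real (Suc R)) x" by (subst cutoff_pos_iff) auto
    then show ?case using elim by (metis eq_iff_diff_eq_0 less_irrefl mult_eq_0_iff of_real_eq_0_iff)
  qed
qed

section \<open>Hermite functions\<close>

text \<open>The Hermite functions as real-valued functions, to which the calculus of the class \<open>sm\<close> applies.\<close>

definition hr :: "('n::finite \<Rightarrow> nat) \<Rightarrow> real^'n \<Rightarrow> real" where
  "hr \<alpha> x = (\<Prod>j\<in>UNIV. hermite_fun1 (\<alpha> j) (x $ j))"

definition inc :: "'n \<Rightarrow> ('n \<Rightarrow> nat) \<Rightarrow> 'n \<Rightarrow> nat" where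
  "inc j \<alpha> = \<alpha>(j := Suc (\<alpha> j))"

definition dec :: "'n \<Rightarrow> ('n \<Rightarrow> nat) \<Rightarrow> 'n \<Rightarrow> nat" where
  "dec j \<alpha> = \<alpha>(j := \<alpha> j - 1)"

lemma inc_simps [simp]: "inc j \<alpha> j = Suc (\<alpha> j)" "i \<noteq> j \<Longrightarrow> inc j \<alpha> i = \<alpha> i" "dec j (inc j \<alpha>) = \<alpha>"
  by (auto simp: inc_def dec_def)

lemma dec_simps [simp]: "dec j \<alpha> j = \<alpha> j - 1" "i \<noteq> j \<Longrightarrow> dec j \<alpha> i = \<alpha> i" "0 < \<alpha> j \<Longrightarrow> inc j (dec j \<alpha>) = \<alpha>"
  by (auto simp: inc_def dec_def)

lemma inj_inc: "inj (inc j)"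
  by (rule inj_on_inverseI[of _ "dec j"]) simp

lemma multiindex_induct [case_names zero inc]:
  fixes P :: "('n::finite \<Rightarrow> nat) \<Rightarrow> bool"
  assumes z: "P (\<lambda>_. 0)" and s: "\<And>\<alpha> j. P \<alpha> \<Longrightarrow> P (inc j \<alpha>)"
  shows "P \<alpha>"
proof (induction "\<Sum>j\<in>UNIV. \<alpha> j" arbitrary: \<alpha>)
  case 0
  then have "\<alpha> = (\<lambda>_. 0)" by auto
  then show ?case using z by simp
next
  case (Suc s')
  have "\<exists>j. 0 < \<alpha> j"
  proof (rule ccontr)
    assume "\<nexists>j. 0 < \<alpha> j"
    then show False using Suc.hyps(2) by simp
  qed
  then obtain j where j: "0 < \<alpha> j" ..
  have "(\<Sum>i\<in>UNIV. inc j (dec j \<alpha>) i) = Suc (\<Sum>i\<in>UNIV. dec j \<alpha> i)"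
    by (simp add: sum.remove[of UNIV j])
  then have "s' = (\<Sum>i\<in>UNIV. dec j \<alpha> i)" using j Suc.hyps(2) by simp
  from s[OF Suc.hyps(1)[OF this], of j] show ?case using j by simp
qed

lemma hermite_fun_eq_hr: "hermite_fun \<alpha> x = of_real (hr \<alpha> x)"
  by (simp add: hermite_fun_def hr_def)

lemma hermite_norm_const_Suc:
  "sqrt (2 ^ Suc k * fact (Suc k) * sqrt pi) = sqrt (2 * real (Suc k)) * sqrt (2 ^ k * fact k * sqrt pi)"
  by (simp add: algebra_simps flip: real_sqrt_mult)

text \<open>The annihilation operator \<open>d/dx + x\<close> and, in the next lemma, the creation operator \<open>x - d/dx\<close>. They move along
  the normalised Hermite functions with factors \<open>\<surd>(2k)\<close> and \<open>\<surd>(2(k + 1))\<close>.\<close>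

lemma hermite_fun1_lower:
  "hermite_fun1' k x + x * hermite_fun1 k x = sqrt (2 * real k) * hermite_fun1 (k - 1) x"
proof (cases k)
  case (Suc i)
  have p: "0 < sqrt (2 ^ i * fact i * sqrt pi)" "0 < sqrt (2 * real (Suc i))" by auto
  have q: "2 * real (Suc i) = sqrt (2 * real (Suc i)) * sqrt (2 * real (Suc i))" by simp
  have "hermite_fun1' k x + x * hermite_fun1 k x
      = 2 * real (Suc i) * (hermite_poly i x * exp (- x\<^sup>2 / 2)) / sqrt (2 ^ Suc i * fact (Suc i) * sqrt pi)"
    unfolding hermite_fun1_def hermite_fun1'_def Suc by (simp add: add_divide_distrib[symmetric] algebra_simps)
  also have "\<dots> = sqrt (2 * real (Suc i)) * ((hermite_poly i x * exp (- x\<^sup>2 / 2)) / sqrt (2 ^ i * fact i * sqrt pi))"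
    unfolding hermite_norm_const_Suc by (subst q) (use p in \<open>simp add: field_simps del: of_nat_Suc real_sqrt_mult_self\<close>)
  finally show ?thesis by (simp add: hermite_fun1_def Suc)
qed (simp add: hermite_fun1_def hermite_fun1'_def)

lemma hermite_fun1_raise:
  "x * hermite_fun1 k x - hermite_fun1' k x = sqrt (2 * real (Suc k)) * hermite_fun1 (Suc k) x"
proof -
  have p: "0 < sqrt (2 ^ k * fact k * sqrt pi)" "0 < sqrt (2 * real (Suc k))" by auto
  have r: "hermite_poly (Suc k) x = 2 * x * hermite_poly k x - 2 * real k * hermite_poly (k - 1) x"
    by (cases k) auto
  have "x * hermite_fun1 k x - hermite_fun1' k x
     = hermite_poly (Suc k) x * exp (- x\<^sup>2 / 2) / sqrt (2 ^ k * fact k * sqrt pi)"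
    unfolding r hermite_fun1_def hermite_fun1'_def by (simp add: diff_divide_distrib[symmetric] algebra_simps)
  also have "\<dots> = sqrt (2 * real (Suc k)) * hermite_fun1 (Suc k) x"
    unfolding hermite_fun1_def hermite_norm_const_Suc using p by (simp add: field_simps del: of_nat_Suc)
  finally show ?thesis .
qed

lemma sm_hermite_poly: "sm (\<lambda>x. hermite_poly k (x $ j))"
proof (induction k rule: induct_nat_012)
  case (ge2 k)
  have "sm (\<lambda>x. 2 * (x $ j) * hermite_poly (Suc k) (x $ j) - 2 * real (Suc k) * hermite_poly k (x $ j))"
    by (intro sm_diff sm_mult sm_const sm_coord ge2)
  then show ?case by simp
qed (auto intro: sm_const sm_mult sm_coord)

lemma slow_coord: "slow (\<lambda>x::real^'n::finite. x $ j)"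
  by (rule slow_bounded_linear[OF bounded_linear_vec_nth])

lemma slow_hermite_poly: "slow (\<lambda>x::real^'n::finite. hermite_poly k (x $ j))"
proof (induction k rule: induct_nat_012)
  case (ge2 k)
  have "slow (\<lambda>x::real^'n. 2 * (x $ j) * hermite_poly (Suc k) (x $ j) + (- 2 * real (Suc k)) * hermite_poly k (x $ j))"
    by (intro slow_add slow_mult slow_const slow_coord ge2)
  then show ?case by (simp add: algebra_simps)
qed (auto intro: slow_const slow_mult slow_coord)

lemma hr_eq_poly_gaussian:
  "hr \<alpha> x = (\<Prod>j\<in>UNIV. hermite_poly (\<alpha> j) (x $ j) * (1 / sqrt (2 ^ \<alpha> j * fact (\<alpha> j) * sqrt pi))) * exp (- (1/2) * (norm x)\<^sup>2)"
proof -
  have "exp (- (1/2) * (norm x)\<^sup>2) = (\<Prod>j\<in>UNIV. exp (- (x $ j)\<^sup>2 / 2))"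
    by (simp add: norm_power2_vec sum_distrib_left sum_negf flip: exp_sum)
  then show ?thesis
    by (simp add: hr_def hermite_fun1_def flip: prod.distrib)
qed

lemma sm_hr: "sm (hr \<alpha>)"
proof -
  have "sm (\<lambda>x. (\<Prod>j\<in>UNIV. hermite_poly (\<alpha> j) (x $ j) * (1 / sqrt (2 ^ \<alpha> j * fact (\<alpha> j) * sqrt pi))) * exp (- (1/2) * (norm x)\<^sup>2))"
    by (intro sm_mult sm_prod sm_hermite_poly sm_const sm_exp sm_norm_power2)
  then show ?thesis by (simp add: hr_eq_poly_gaussian[abs_def])
qed

lemma hr_measurable [measurable]: "hr \<alpha> \<in> borel_measurable borel"
  by (rule sm_measurable[OF sm_hr])

lemma gdec_hr: "gdec (hr \<alpha>)"
proof (rule gdec_slow[OF _ gdec_gaussian[of "1/2"]])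
  show "slow (\<lambda>x::real^'a. \<Prod>j\<in>UNIV. hermite_poly (\<alpha> j) (x $ j) * (1 / sqrt (2 ^ \<alpha> j * fact (\<alpha> j) * sqrt pi)))"
    by (intro slow_prod slow_mult slow_hermite_poly slow_const)
qed (auto simp: hr_eq_poly_gaussian abs_mult)

lemma hr_remove:
  "hr \<alpha> x = hermite_fun1 (\<alpha> j) (x $ j) * (\<Prod>i\<in>UNIV - {j}. hermite_fun1 (\<alpha> i) (x $ i))"
  unfolding hr_def by (subst prod.remove[of UNIV j]) auto

lemma hr_change:
  assumes "\<And>i. i \<noteq> j \<Longrightarrow> \<beta> i = \<alpha> i"
  shows "hr \<beta> x = hermite_fun1 (\<beta> j) (x $ j) * (\<Prod>i\<in>UNIV - {j}. hermite_fun1 (\<alpha> i) (x $ i))"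
  unfolding hr_remove[of \<beta> x j] using assms by (intro arg_cong2[where f="(*)"] prod.cong) auto

lemma rpd_hr:
  "rpd j (hr \<alpha>) = (\<lambda>x. hermite_fun1' (\<alpha> j) (x $ j) * (\<Prod>i\<in>UNIV - {j}. hermite_fun1 (\<alpha> i) (x $ i)))"
proof (rule rpd_eqI)
  fix x :: "real^'a"
  have e: "hr \<alpha> (x + t *\<^sub>R axis j 1) = hermite_fun1 (\<alpha> j) (x $ j + t) * (\<Prod>i\<in>UNIV - {j}. hermite_fun1 (\<alpha> i) (x $ i))" for t
    unfolding hr_remove[of \<alpha> _ j] by (intro arg_cong2[where f="(*)"] prod.cong) (auto simp: axis_def)
  have "((\<lambda>t. hermite_fun1 (\<alpha> j) (x $ j + t)) has_real_derivative hermite_fun1' (\<alpha> j) (x $ j + 0) * 1) (at 0)"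
    by (rule DERIV_chain2[OF DERIV_hermite_fun1]) (auto intro!: derivative_eq_intros)
  then have "((\<lambda>t. hermite_fun1 (\<alpha> j) (x $ j + t)) has_real_derivative hermite_fun1' (\<alpha> j) (x $ j)) (at 0)"
    by simp
  then show "((\<lambda>t. hr \<alpha> (x + t *\<^sub>R axis j 1)) has_real_derivative
      hermite_fun1' (\<alpha> j) (x $ j) * (\<Prod>i\<in>UNIV - {j}. hermite_fun1 (\<alpha> i) (x $ i))) (at 0)"
    unfolding e by (rule DERIV_cmult_right)
qed

lemma hr_lower: "rpd j (hr \<alpha>) x + x $ j * hr \<alpha> x = sqrt (2 * real (\<alpha> j)) * hr (dec j \<alpha>) x"
proof -
  have "hr (dec j \<alpha>) x = hermite_fun1 (\<alpha> j - 1) (x $ j) * (\<Prod>i\<in>UNIV - {j}. hermite_fun1 (\<alpha> i) (x $ i))"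
    by (subst hr_change[of j _ \<alpha>]) auto
  then show ?thesis
    unfolding rpd_hr hr_remove[of \<alpha> x j]
    by (simp only: mult.assoc[symmetric] hermite_fun1_lower[symmetric] distrib_right left_diff_distrib)
qed

lemma hr_raise: "x $ j * hr \<alpha> x - rpd j (hr \<alpha>) x = sqrt (2 * real (Suc (\<alpha> j))) * hr (inc j \<alpha>) x"
proof -
  have "hr (inc j \<alpha>) x = hermite_fun1 (Suc (\<alpha> j)) (x $ j) * (\<Prod>i\<in>UNIV - {j}. hermite_fun1 (\<alpha> i) (x $ i))"
    by (subst hr_change[of j _ \<alpha>]) auto
  then show ?thesis
    unfolding rpd_hr hr_remove[of \<alpha> x j]
    by (simp only: mult.assoc[symmetric] hermite_fun1_raise[symmetric] distrib_right left_diff_distrib)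
qed

lemma coord_mult_hr:
  "x $ j * hr \<alpha> x = (1/2) * (sqrt (2 * real (\<alpha> j)) * hr (dec j \<alpha>) x + sqrt (2 * real (Suc (\<alpha> j))) * hr (inc j \<alpha>) x)"
  unfolding hr_lower[symmetric] hr_raise[symmetric] by simp

text \<open>The terms with the factor \<open>x $ j\<close> from the two ladder relations cancel.\<close>

lemma rpd_hr_mult_hr:
  "rpd j (\<lambda>x. hr \<alpha> x * hr \<beta> x) = (\<lambda>x. sqrt (2 * real (\<alpha> j)) * (hr (dec j \<alpha>) x * hr \<beta> x)
     - sqrt (2 * real (Suc (\<beta> j))) * (hr \<alpha> x * hr (inc j \<beta>) x))"
proof
  fix x
  have "rpd j (\<lambda>x. hr \<alpha> x * hr \<beta> x) x = hr \<alpha> x * rpd j (hr \<beta>) x + rpd j (hr \<alpha>) x * hr \<beta> x"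
    by (simp add: rpd_mult[OF sm_hr sm_hr])
  also have "rpd j (hr \<beta>) x = x $ j * hr \<beta> x - sqrt (2 * real (Suc (\<beta> j))) * hr (inc j \<beta>) x"
    using hr_raise[of x j \<beta>] by simp
  also have "rpd j (hr \<alpha>) x = sqrt (2 * real (\<alpha> j)) * hr (dec j \<alpha>) x - x $ j * hr \<alpha> x"
    using hr_lower[of j \<alpha> x] by simp
  finally show "rpd j (\<lambda>x. hr \<alpha> x * hr \<beta> x) x = sqrt (2 * real (\<alpha> j)) * (hr (dec j \<alpha>) x * hr \<beta> x)
     - sqrt (2 * real (Suc (\<beta> j))) * (hr \<alpha> x * hr (inc j \<beta>) x)"
    by (simp add: algebra_simps)
qed

lemma gdec_imp_slow: "gdec f \<Longrightarrow> slow f"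
  unfolding gdec_def
proof (elim exE conjE)
  fix C a assume a: "0 < a" and C: "\<forall>x. norm (f x) \<le> C * exp (- a * (norm x)\<^sup>2)"
  have "0 \<le> C" using order_trans[OF norm_ge_zero C[rule_format, of 0]] by simp
  then have "C * exp (- a * (norm x)\<^sup>2) \<le> C * 1" for x :: 'a
    using a by (intro mult_left_mono) auto
  then have "norm (f x) \<le> norm C" for x using C \<open>0 \<le> C\<close> by (metis abs_of_nonneg mult.right_neutral order_trans real_norm_def)
  then show "slow f" by (rule slow_mono[OF slow_const])
qed

lemma gdec_mult:
  fixes f g :: "'a::real_normed_vector \<Rightarrow> 'b::real_normed_algebra"
  shows "gdec f \<Longrightarrow> gdec g \<Longrightarrow> gdec (\<lambda>x. f x * g x)"
  by (rule gdec_slow[of f g]) (auto intro: gdec_imp_slow norm_mult_ineq)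

lemma gdec_add:
  assumes "gdec f" "gdec g" shows "gdec (\<lambda>x. f x + g x)"
proof -
  obtain C a where a: "0 < a" and C: "\<And>x. norm (f x) \<le> C * exp (- a * (norm x)\<^sup>2)"
    using assms(1) unfolding gdec_def by blast
  obtain D b where b: "0 < b" and D: "\<And>x. norm (g x) \<le> D * exp (- b * (norm x)\<^sup>2)"
    using assms(2) unfolding gdec_def by blast
  have C0: "0 \<le> C" "0 \<le> D" using order_trans[OF norm_ge_zero C[of 0]] order_trans[OF norm_ge_zero D[of 0]] by auto
  have e: "exp (- c * (norm x)\<^sup>2) \<le> exp (- min a b * (norm x)\<^sup>2)" if "min a b \<le> c" for c and x :: 'a
    using that by (simp add: mult_right_mono)
  have "norm (f x + g x) \<le> (C + D) * exp (- min a b * (norm x)\<^sup>2)" for x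
    using norm_triangle_ineq[of "f x" "g x"] order_trans[OF C mult_left_mono[OF e C0(1)], of x]
      order_trans[OF D mult_left_mono[OF e C0(2)], of x] by (simp add: distrib_right)
  then show ?thesis unfolding gdec_def using a b by (intro exI[of _ "C + D"] exI[of _ "min a b"]) auto
qed

lemma gdec_scale: "gdec f \<Longrightarrow> gdec (\<lambda>x. c * f x)" for c :: "'b::real_normed_algebra"
  by (rule gdec_slow[OF slow_const[of c]]) (auto intro: norm_mult_ineq)

lemma gdec_of_real_iff: "gdec (\<lambda>x. of_real (f x) :: 'b::real_normed_algebra_1) \<longleftrightarrow> gdec f"
  by (simp add: gdec_def)

lemma gdec_hr_mult: "gdec (\<lambda>x. hr \<alpha> x * hr \<beta> x)"
  by (rule gdec_mult[OF gdec_hr gdec_hr])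

lemma gdec_rpd_hr_mult: "gdec (rpd j (\<lambda>x. hr \<alpha> x * hr \<beta> x))"
proof -
  have "gdec (\<lambda>x. sqrt (2 * real (\<alpha> j)) * (hr (dec j \<alpha>) x * hr \<beta> x)
     + (- sqrt (2 * real (Suc (\<beta> j)))) * (hr \<alpha> x * hr (inc j \<beta>) x))"
    by (intro gdec_add gdec_scale gdec_hr_mult)
  then show ?thesis by (simp add: rpd_hr_mult_hr)
qed

section \<open>Matrix elements of multiplication operators in the Hermite basis\<close>

definition mel :: "(real^'n::finite \<Rightarrow> complex) \<Rightarrow> ('n \<Rightarrow> nat) \<Rightarrow> ('n \<Rightarrow> nat) \<Rightarrow> complex" where
  "mel G \<alpha> \<beta> = (LINT x|lebesgue. G x * of_real (hr \<alpha> x * hr \<beta> x))"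

lemma integrable_mel: "growth r G \<Longrightarrow> integrable lebesgue (\<lambda>x. G x * of_real (hr \<alpha> x * hr \<beta> x))"
  by (rule integrable_growth_gdec) (auto simp: gdec_of_real_iff gdec_hr_mult simp del: of_real_mult)

lemma mel_rpd:
  assumes "growth r G"
  shows "(LINT x|lebesgue. G x * of_real (rpd j (\<lambda>x. hr \<alpha> x * hr \<beta> x) x))
     = of_real (sqrt (2 * real (\<alpha> j))) * mel G (dec j \<alpha>) \<beta> - of_real (sqrt (2 * real (Suc (\<beta> j)))) * mel G \<alpha> (inc j \<beta>)"
proof -
  have "(LINT x|lebesgue. G x * of_real (rpd j (\<lambda>x. hr \<alpha> x * hr \<beta> x) x))
     = (LINT x|lebesgue. of_real (sqrt (2 * real (\<alpha> j))) * (G x * of_real (hr (dec j \<alpha>) x * hr \<beta> x))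
         - of_real (sqrt (2 * real (Suc (\<beta> j)))) * (G x * of_real (hr \<alpha> x * hr (inc j \<beta>) x)))"
    by (intro Bochner_Integration.integral_cong refl) (simp add: rpd_hr_mult_hr algebra_simps)
  also have "\<dots> = (LINT x|lebesgue. of_real (sqrt (2 * real (\<alpha> j))) * (G x * of_real (hr (dec j \<alpha>) x * hr \<beta> x)))
         - (LINT x|lebesgue. of_real (sqrt (2 * real (Suc (\<beta> j)))) * (G x * of_real (hr \<alpha> x * hr (inc j \<beta>) x)))"
    by (intro Bochner_Integration.integral_diff integrable_mult_right integrable_mel[OF assms])
  finally show ?thesis by (simp only: mel_def integral_mult_right_zero)
qed

text \<open>The product rule \<open>\<partial>\<^sub>j (G f) = G' f + G \<partial>\<^sub>j f\<close> in the Hermite basis.\<close>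

lemma mel_inc:
  assumes "wpair j G G'" "growth r G" "growth r' G'"
  shows "of_real (sqrt (2 * real (Suc (\<beta> j)))) * mel G \<alpha> (inc j \<beta>)
     = of_real (sqrt (2 * real (\<alpha> j))) * mel G (dec j \<alpha>) \<beta> + mel G' \<alpha> \<beta>"
  using wpair_gdec[OF assms sm_mult[OF sm_hr sm_hr] gdec_hr_mult gdec_rpd_hr_mult, of \<alpha> \<beta>]
  unfolding mel_rpd[OF assms(2)] by (simp add: mel_def[of G'] algebra_simps)

text \<open>The same identity for \<open>G = 1\<close>, where \<open>G' = 0\<close>; it determines all inner products of Hermite functions
  from the one at the origin.\<close>

lemma mel_1_inc:
  "of_real (sqrt (2 * real (Suc (\<beta> j)))) * mel (\<lambda>_. 1) \<alpha> (inc j \<beta>)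
     = of_real (sqrt (2 * real (\<alpha> j))) * mel (\<lambda>_. 1) (dec j \<alpha>) \<beta>"
proof -
  let ?\<psi> = "\<lambda>x. hr \<alpha> x * hr \<beta> x"
  have s: "sm ?\<psi>" by (rule sm_mult[OF sm_hr sm_hr])
  have g: "growth 0 (\<lambda>_::real^'a. 1)" by (auto simp: growth_def)
  have m: "(\<lambda>x. complex_of_real (rpd j ?\<psi> x)) \<in> borel_measurable borel"
    using sm_measurable[OF sm_rpd[OF s]] by measurable
  have "(LINT x|lborel. complex_of_real (rpd j ?\<psi> x)) = 0"
  proof (rule integral_directional_derivative_zero)
    show "((\<lambda>t. complex_of_real (?\<psi> (x + t *\<^sub>R axis j 1))) has_vector_derivative complex_of_real (rpd j ?\<psi> x)) (at 0)" for x
      by (rule has_vector_derivative_of_real[OF DERIV_rpd[OF s]])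
    show "continuous_on UNIV (\<lambda>x. complex_of_real (rpd j ?\<psi> x))"
      by (intro continuous_on_of_real sm_continuous sm_rpd s)
    show "integrable lborel (\<lambda>x. complex_of_real (?\<psi> x))"
      by (rule integrable_gdec) (auto simp: gdec_of_real_iff gdec_hr_mult simp del: of_real_mult)
    show "integrable lborel (\<lambda>x. complex_of_real (rpd j ?\<psi> x))"
      by (rule integrable_gdec[OF _ m]) (simp add: gdec_of_real_iff gdec_rpd_hr_mult)
  qed
  then have "(LINT x|lebesgue. 1 * complex_of_real (rpd j ?\<psi> x)) = 0"
    unfolding mult_1 by (subst integral_completion[OF measurable_compose[OF _ m, of id, simplified]]) auto
  then show ?thesis unfolding mel_rpd[OF g] by simp
qed

lemma mel_commute: "mel G \<alpha> \<beta> = mel G \<beta> \<alpha>"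
  by (simp add: mel_def mult_ac)

lemma hr_0: "hr (\<lambda>_. 0) x = (1 / sqrt (sqrt pi)) ^ CARD('n) * exp (- (1/2) * (norm x)\<^sup>2)" for x :: "real^'n::finite"
  by (simp add: hr_eq_poly_gaussian)

lemma mel_1_0: "mel (\<lambda>_. 1) (\<lambda>_::'a::finite. 0) (\<lambda>_. 0) = 1"
proof -
  let ?n = "CARD('a)"
  have e: "hr (\<lambda>_. 0) x * hr (\<lambda>_. 0) x = (1 / sqrt pi) ^ ?n * exp (- 1 * (norm (x :: real^'a))\<^sup>2)" for x
  proof -
    have "hr (\<lambda>_. 0) x * hr (\<lambda>_. 0) x = ((1 / sqrt (sqrt pi)) ^ ?n * (1 / sqrt (sqrt pi)) ^ ?n) * (exp (- (1/2) * (norm x)\<^sup>2) * exp (- (1/2) * (norm x)\<^sup>2))"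
      unfolding hr_0 by simp
    also have "(1 / sqrt (sqrt pi)) ^ ?n * (1 / sqrt (sqrt pi)) ^ ?n = (1 / sqrt pi) ^ ?n"
      by (simp flip: power_mult_distrib)
    also have "exp (- (1/2) * (norm x)\<^sup>2) * exp (- (1/2) * (norm x)\<^sup>2) = exp (- 1 * (norm x)\<^sup>2)"
      by (simp flip: exp_add)
    finally show ?thesis .
  qed
  have "mel (\<lambda>_. 1) (\<lambda>_::'a. 0) (\<lambda>_. 0) = (LINT x|lebesgue. complex_of_real ((1 / sqrt pi) ^ ?n * exp (- 1 * (norm (x :: real^'a))\<^sup>2)))"
    by (simp only: mel_def mult_1 e)
  also have "\<dots> = (LINT x|lborel. complex_of_real ((1 / sqrt pi) ^ ?n * exp (- 1 * (norm (x :: real^'a))\<^sup>2)))"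
    by (rule integral_completion) measurable
  also have "\<dots> = of_real ((1 / sqrt pi) ^ ?n * sqrt (pi / 1) ^ DIM(real^'a))"
    by (simp only: integral_complex_of_real integral_mult_right_zero integral_gaussian(2)[OF zero_less_one])
  also have "\<dots> = 1" by (simp flip: power_mult_distrib)
  finally show ?thesis .
qed

lemma mel_1: "mel (\<lambda>_. 1) \<alpha> \<beta> = (if \<alpha> = \<beta> then 1 else 0)"
proof (induction \<beta> arbitrary: \<alpha> rule: multiindex_induct)
  case zero
  show ?case
  proof (cases "\<alpha> = (\<lambda>_. 0)")
    case False
    then obtain j where j: "0 < \<alpha> j" by auto
    have "mel (\<lambda>_. 1) (\<lambda>_. 0) (inc j (dec j \<alpha>)) = 0"
      using mel_1_inc[of "dec j \<alpha>" j "\<lambda>_. 0"] by simp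
    then show ?thesis using j False by (simp add: mel_commute[of _ \<alpha>])
  qed (simp add: mel_1_0)
next
  case (inc \<beta> j)
  have p: "complex_of_real (sqrt (2 * real (Suc (\<beta> j)))) \<noteq> 0" by (simp del: of_nat_Suc)
  show ?case
  proof (cases "\<alpha> j = 0")
    case True
    then have "\<alpha> \<noteq> inc j \<beta>" by auto
    then show ?thesis using mel_1_inc[of \<beta> j \<alpha>] True by simp
  next
    case False
    then have "inc j (dec j \<alpha>) = \<alpha>" by simp
    then have iff: "dec j \<alpha> = \<beta> \<longleftrightarrow> \<alpha> = inc j \<beta>" by auto
    have "of_real (sqrt (2 * real (Suc (\<beta> j)))) * mel (\<lambda>_. 1) \<alpha> (inc j \<beta>)
        = of_real (sqrt (2 * real (\<alpha> j))) * (if \<alpha> = inc j \<beta> then 1 else 0)"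
      using mel_1_inc[of \<beta> j \<alpha>] unfolding inc iff .
    then show ?thesis using p by (cases "\<alpha> = inc j \<beta>") auto
  qed
qed

lemma sqint_gdec:
  assumes "gdec f" "f \<in> borel_measurable borel" shows "sqint lebesgue f"
proof -
  have "gdec (\<lambda>x. (cmod (f x))\<^sup>2)"
    by (rule gdec_slow[OF gdec_imp_slow[OF assms(1)] assms(1)]) (simp add: power2_eq_square)
  then have "integrable lborel (\<lambda>x. (cmod (f x))\<^sup>2)"
    by (rule integrable_gdec) (use assms(2) in measurable)
  then have "integrable lebesgue (\<lambda>x. (cmod (f x))\<^sup>2)"
    using assms(2) by (subst integrable_completion) auto
  moreover have "f \<in> borel_measurable lebesgue" by (rule measurable_completion) (use assms(2) in simp)
  ultimately show ?thesis by (simp add: sqint_def)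
qed

lemma hermite_fun_measurable [measurable]: "hermite_fun \<alpha> \<in> borel_measurable borel"
  by (simp add: hermite_fun_eq_hr[abs_def])

lemma gdec_hermite_fun: "gdec (hermite_fun \<alpha>)"
  by (simp add: hermite_fun_eq_hr[abs_def] gdec_of_real_iff gdec_hr)

lemma sqint_hermite_fun: "sqint lebesgue (hermite_fun \<alpha>)"
  by (rule sqint_gdec[OF gdec_hermite_fun hermite_fun_measurable])

lemma orthonormal_hermite_fun: "orthonormal lebesgue (hermite_fun :: _ \<Rightarrow> real^'n::finite \<Rightarrow> _)"
proof -
  have "ip lebesgue (hermite_fun \<alpha>) (hermite_fun \<beta>) = mel (\<lambda>_. 1) \<alpha> \<beta>" for \<alpha> \<beta> :: "'n \<Rightarrow> nat"
    by (simp add: ip_def mel_def hermite_fun_eq_hr)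
  then show ?thesis by (simp add: orthonormal_def sqint_hermite_fun mel_1)
qed

section \<open>Completeness of the Hermite functions\<close>

lemmas poly_linear = real_polynomial_function.intros(1)
lemmas poly_const = real_polynomial_function.intros(2)
lemmas poly_mult = real_polynomial_function.intros(4)

text \<open>The linear span of the Hermite functions is stable under multiplication by coordinates, hence by all
  polynomials; in particular it contains \<open>p e\<^bsup>-|x|\<^sup>2/2\<^esup>\<close> for every polynomial \<open>p\<close>.\<close>

inductive hspan :: "(real^'n::finite \<Rightarrow> real) \<Rightarrow> bool" where
  hspan_base: "hspan (hr \<alpha>)"
| hspan_add: "hspan f \<Longrightarrow> hspan g \<Longrightarrow> hspan (\<lambda>x. f x + g x)"
| hspan_scale: "hspan f \<Longrightarrow> hspan (\<lambda>x. c * f x)"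

lemma hspan_sum: "(\<And>i. i \<in> A \<Longrightarrow> hspan (f i)) \<Longrightarrow> hspan (\<lambda>x. \<Sum>i\<in>A. f i x)"
  using hspan_scale[OF hspan_base, of 0] by (induction A rule: infinite_finite_induct) (auto intro: hspan_add)

lemma hspan_coord: "hspan f \<Longrightarrow> hspan (\<lambda>x. x $ j * f x)"
proof (induction rule: hspan.induct)
  case (hspan_base \<alpha>)
  show ?case unfolding coord_mult_hr by (intro hspan.intros)
next
  case (hspan_add f g)
  then show ?case unfolding distrib_left by (intro hspan.intros)
next
  case (hspan_scale f c)
  then show ?case using hspan.hspan_scale[of "\<lambda>x. x $ j * f x" c] by (simp add: mult.left_commute)
qed

lemma hspan_polynomial: "real_polynomial_function p \<Longrightarrow> hspan f \<Longrightarrow> hspan (\<lambda>x. p x * f x)"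
proof (induction arbitrary: f rule: real_polynomial_function.induct)
  case (linear l)
  interpret bounded_linear l by fact
  have lx: "l x = (\<Sum>j\<in>UNIV. l (axis j 1) * x $ j)" for x
  proof -
    have "x = (\<Sum>j\<in>UNIV. x $ j *\<^sub>R axis j 1)"
      by (simp add: vec_eq_iff axis_def if_distrib[of "\<lambda>a. _ * a"] cong: if_cong)
    then have "l x = l (\<Sum>j\<in>UNIV. x $ j *\<^sub>R axis j 1)" by simp
    also have "\<dots> = (\<Sum>j\<in>UNIV. l (axis j 1) * x $ j)" by (simp add: sum scaleR mult.commute)
    finally show ?thesis .
  qed
  have "(\<lambda>x. l x * f x) = (\<lambda>x. \<Sum>j\<in>UNIV. l (axis j 1) * (x $ j * f x))"
    by (rule ext, subst lx) (simp add: sum_distrib_right mult.assoc)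
  then show ?case using linear.prems by (auto intro!: hspan_sum hspan_scale hspan_coord)
next
  case (const c) then show ?case by (rule hspan_scale)
next
  case (add p q)
  show ?case unfolding distrib_right by (intro hspan_add add)
next
  case (mult p q)
  show ?case unfolding mult.assoc by (intro mult)
qed

lemma integrable_sqint_gdec:
  fixes g :: "'a::euclidean_space \<Rightarrow> complex"
  assumes "sqint lebesgue f" "gdec g" "g \<in> borel_measurable borel"
  shows "integrable lebesgue (\<lambda>x. f x * g x)"
proof -
  have "sqint lebesgue g" using assms(2,3) by (rule sqint_gdec)
  from ip_integrable[OF assms(1) sqint_cnj[OF this]] show ?thesis by simp
qed

lemma integral_hspan_zero:
  assumes f: "sqint lebesgue f" and z: "\<And>\<alpha>. ip lebesgue f (hermite_fun \<alpha>) = 0" and u: "hspan u"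
  shows "(LINT x|lebesgue. f x * of_real (u x)) = 0"
proof -
  from u have "gdec u \<and> u \<in> borel_measurable borel \<and> (LINT x|lebesgue. f x * of_real (u x)) = 0"
  proof (induction rule: hspan.induct)
    case (hspan_base \<alpha>)
    then show ?case using z[of \<alpha>] by (auto simp: gdec_hr ip_def hermite_fun_eq_hr)
  next
    case (hspan_add u v)
    then have "integrable lebesgue (\<lambda>x. f x * of_real (u x))" "integrable lebesgue (\<lambda>x. f x * of_real (v x))"
      by (auto intro!: integrable_sqint_gdec[OF f] simp: gdec_of_real_iff)
    then show ?case using hspan_add by (auto simp: distrib_left intro: gdec_add)
  next
    case (hspan_scale u c)
    then show ?case using integral_mult_right_zero[of lebesgue "of_real c" "\<lambda>x. f x * of_real (u x)"]
      by (auto intro: gdec_scale simp: mult.left_commute)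
  qed
  then show ?thesis by blast
qed

text \<open>Vanishing moments are preserved under multiplication by \<open>e\<^sup>q\<close>: expand the exponential and use
  dominated convergence with the majorant \<open>|w p| e\<^bsup>|q|\<^esup>\<close>.\<close>

lemma moments_exp:
  fixes w :: "'a::euclidean_space \<Rightarrow> complex" and q :: "'a \<Rightarrow> real"
  assumes q: "real_polynomial_function q"
    and int: "\<And>p. real_polynomial_function p \<Longrightarrow> integrable lebesgue (\<lambda>x. w x * of_real (p x * exp \<bar>q x\<bar>))"
    and zero: "\<And>p. real_polynomial_function p \<Longrightarrow> (LINT x|lebesgue. w x * of_real (p x)) = 0"
    and p: "real_polynomial_function p" and w: "w \<in> borel_measurable lebesgue"
  shows "(LINT x|lebesgue. w x * of_real (p x * exp (q x))) = 0"
proof -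
  let ?S = "\<lambda>n x. \<Sum>k<n. q x ^ k /\<^sub>R fact k"
  have pol: "real_polynomial_function (\<lambda>x. p x * ?S n x)" for n
    by (intro poly_mult p real_polynomial_function_sum) 
       (auto intro!: poly_mult real_polynomial_function_power q simp: divideR_right[symmetric])
  have pm: "(\<lambda>x. complex_of_real (r x)) \<in> borel_measurable lebesgue"
    if "continuous_on UNIV r" for r :: "'a \<Rightarrow> real"
    by (rule measurable_completion) (use borel_measurable_continuous_onI[OF that] in measurable)
  have pc: "continuous_on UNIV r" if "real_polynomial_function r" for r :: "'a \<Rightarrow> real"
    using continuous_real_polymonial_function[OF that] continuous_at_imp_continuous_on by blast
  have "(\<lambda>n. LINT x|lebesgue. w x * of_real (p x * ?S n x)) \<longlonglongrightarrow> (LINT x|lebesgue. w x * of_real (p x * exp (q x)))"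
  proof (rule Bochner_Integration.integral_dominated_convergence)
    show "integrable lebesgue (\<lambda>x. norm (w x * of_real (p x * exp \<bar>q x\<bar>)))"
      by (rule integrable_norm[OF int[OF p]])
    show "AE x in lebesgue. (\<lambda>n. w x * of_real (p x * ?S n x)) \<longlonglongrightarrow> w x * of_real (p x * exp (q x))"
    proof (intro AE_I2 tendsto_mult[OF tendsto_const] tendsto_of_real)
      show "(\<lambda>n. ?S n x) \<longlonglongrightarrow> exp (q x)" for x
        using exp_converges[of "q x"] by (simp add: sums_def)
    qed
    show "AE x in lebesgue. norm (w x * of_real (p x * ?S n x)) \<le> norm (w x * of_real (p x * exp \<bar>q x\<bar>))" for n
    proof (rule AE_I2)
      fix x
      have "\<bar>?S n x\<bar> \<le> (\<Sum>k<n. \<bar>q x\<bar> ^ k /\<^sub>R fact k)"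
        by (rule order_trans[OF sum_abs]) (simp add: power_abs abs_mult)
      also have "\<dots> \<le> exp \<bar>q x\<bar>"
        unfolding exp_def by (rule sum_le_suminf[OF summable_exp_generic]) auto
      finally have "norm (w x) * (\<bar>p x\<bar> * \<bar>?S n x\<bar>) \<le> norm (w x) * (\<bar>p x\<bar> * exp \<bar>q x\<bar>)"
        by (intro mult_left_mono) auto
      then show "norm (w x * of_real (p x * ?S n x)) \<le> norm (w x * of_real (p x * exp \<bar>q x\<bar>))"
        unfolding norm_mult norm_of_real abs_mult by simp
    qed
    show "(\<lambda>x. w x * of_real (p x * exp (q x))) \<in> borel_measurable lebesgue"
      by (intro borel_measurable_times w pm continuous_intros pc p q)
    show "(\<lambda>x. w x * of_real (p x * ?S n x)) \<in> borel_measurable lebesgue" for n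
      by (intro borel_measurable_times w pm pc pol)
  qed
  then show ?thesis unfolding zero[OF pol] LIMSEQ_const_iff by simp
qed

text \<open>If \<open>f\<close> is orthogonal to all Hermite functions, all moments of \<open>f e\<^bsup>-|x|\<^sup>2/2\<^esup>\<close> vanish.
  Multiplying repeatedly by \<open>e\<^bsup>-|x|\<^sup>2/4\<^esup>\<close>, a step that the decay already present can dominate,
  and finally by \<open>e\<^bsup>2N x \<cdot> y\<^esup>\<close>, produces the Gaussian averages \<open>\<integral> f(x) e\<^bsup>-|x|\<^sup>2/2\<^esup> e\<^bsup>-N|x - y|\<^sup>2\<^esup> dx\<close> for all \<open>N \<ge> 1\<close>.\<close>

lemma hermite_complete:
  fixes f :: "real^'n::finite \<Rightarrow> complex"
  assumes f: "sqint lebesgue f" and z: "\<And>\<alpha>. ip lebesgue f (hermite_fun \<alpha>) = 0"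
  shows "AE x in lebesgue. f x = 0"
proof -
  define w where "w a x = f x * of_real (exp (- a * (norm x)\<^sup>2))" for a :: real and x
  have fm: "f \<in> borel_measurable lebesgue" using f by (simp add: sqint_def)
  have pc: "continuous_on UNIV r" if "real_polynomial_function r" for r :: "real^'n \<Rightarrow> real"
    using continuous_real_polymonial_function[OF that] continuous_at_imp_continuous_on by blast
  have wm: "w a \<in> borel_measurable lebesgue" for a
    unfolding w_def by (intro borel_measurable_times fm) (rule measurable_completion, measurable)
  have n2: "real_polynomial_function (\<lambda>x::real^'n. c * (norm x)\<^sup>2)" for c
    unfolding norm_power2_vec
    by (intro poly_mult poly_const real_polynomial_function_sum
        real_polynomial_function_power poly_linear bounded_linear_vec_nth) auto
  have int: "integrable lebesgue (\<lambda>x. f x * of_real (s x * exp (- a * (norm x)\<^sup>2)))"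
    if "slow s" "continuous_on UNIV s" "0 < a" for s :: "real^'n \<Rightarrow> real" and a
  proof (rule integrable_sqint_gdec[OF f])
    show "gdec (\<lambda>x. complex_of_real (s x * exp (- a * (norm x)\<^sup>2)))"
      by (rule gdec_slow[OF that(1) gdec_gaussian[OF that(3)]]) (simp add: norm_mult)
    show "(\<lambda>x. complex_of_real (s x * exp (- a * (norm x)\<^sup>2))) \<in> borel_measurable borel"
      using borel_measurable_continuous_onI[OF that(2)] by measurable
  qed
  have M: "(LINT x|lebesgue. w (1/2 + real i / 4) x * of_real (p x)) = 0"
    if "real_polynomial_function p" for i and p :: "real^'n \<Rightarrow> real"
    using that
  proof (induction i arbitrary: p)
    case 0
    \<comment> \<open>\<open>?c\<close> times the ground state is the plain Gaussian\<close>
    let ?c = "(sqrt (sqrt pi)) ^ CARD('n)"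
    have "hspan (\<lambda>x. ?c * (p x * hr (\<lambda>_. 0) x))"
      by (intro hspan_scale hspan_polynomial 0 hspan_base)
    moreover have "?c * (p x * hr (\<lambda>_. 0) x) = p x * exp (- (1/2) * (norm x)\<^sup>2)" for x
      by (simp add: hr_0 power_divide)
    ultimately have "hspan (\<lambda>x. p x * exp (- (1/2) * (norm x)\<^sup>2))" by (simp only:)
    then have "(LINT x|lebesgue. f x * of_real (p x * exp (- (1/2) * (norm x)\<^sup>2))) = 0"
      by (rule integral_hspan_zero[OF f z])
    then show ?case by (simp add: w_def mult_ac)
  next
    case (Suc i)
    have "(LINT x|lebesgue. w (1/2 + real i / 4) x * of_real (p x * exp (- (1/4) * (norm x)\<^sup>2))) = 0"
    proof (rule moments_exp[OF n2 _ Suc.IH Suc.prems wm])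
      fix p :: "real^'n \<Rightarrow> real" assume p: "real_polynomial_function p"
      have "integrable lebesgue (\<lambda>x. f x * of_real (p x * exp (- (1/4 + real i / 4) * (norm x)\<^sup>2)))"
        by (rule int[OF slow_real_polynomial[OF p] pc[OF p]]) simp
      moreover have "exp (- (1/4 + real i / 4) * (norm x)\<^sup>2) = exp (- (1/2 + real i / 4) * (norm x)\<^sup>2) * exp \<bar>- (1/4) * (norm x)\<^sup>2\<bar>" for x :: "real^'n"
        unfolding mult_exp_exp by (simp add: algebra_simps)
      ultimately show "integrable lebesgue (\<lambda>x. w (1/2 + real i / 4) x * of_real (p x * exp \<bar>- (1/4) * (norm x)\<^sup>2\<bar>))"
        by (simp add: w_def mult_ac)
    qed
    moreover have "exp (- (1/2 + real (Suc i) / 4) * (norm x)\<^sup>2) = exp (- (1/2 + real i / 4) * (norm x)\<^sup>2) * exp (- (1/4) * (norm x)\<^sup>2)" for x :: "real^'n"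
      unfolding mult_exp_exp by (simp add: algebra_simps)
    ultimately show ?case by (simp add: w_def mult_ac)
  qed
  have "AE x in lebesgue. w (1/2) x = 0"
  proof (rule AE_zero_of_gaussian_averages)
    show "integrable lebesgue (w (1/2))"
      using int[of "\<lambda>_. 1" "1/2"] by (simp add: w_def[abs_def])
    fix N :: nat and y :: "real^'n"
    let ?N = "real (Suc N)"
    let ?q = "\<lambda>x::real^'n. (2 * ?N) * (x \<bullet> y)"
    have q: "real_polynomial_function ?q"
      by (intro poly_mult poly_const poly_linear bounded_linear_inner_left)
    \<comment> \<open>\<open>4 (N + 1)\<close> steps of size \<open>1/4\<close> reach the exponent \<open>1/2 + (N + 1)\<close>\<close>
    have w4: "w (1/2 + real (4 * Suc N) / 4) = w (1/2 + ?N)"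
      by (rule arg_cong[where f=w]) (simp add: field_simps)
    have "(LINT x|lebesgue. w (1/2 + ?N) x * of_real (1 * exp (?q x))) = 0"
    proof (rule moments_exp[OF q _ _ poly_const wm])
      fix p :: "real^'n \<Rightarrow> real" assume p: "real_polynomial_function p"
      show "(LINT x|lebesgue. w (1/2 + ?N) x * of_real (p x)) = 0"
        using M[OF p, of "4 * Suc N"] unfolding w4 .
      have "slow (\<lambda>x. exp \<bar>?q x\<bar>)"
      proof (rule slow_mono[OF slow_exp_norm[of "2 * ?N * norm y"]])
        fix x
        have "\<bar>?q x\<bar> \<le> 2 * ?N * (norm x * norm y)"
          using Cauchy_Schwarz_ineq2[of x y] by (simp add: abs_mult del: of_nat_Suc)
        then show "norm (exp \<bar>?q x\<bar>) \<le> norm (exp (2 * ?N * norm y * norm x))" by (simp add: mult_ac del: of_nat_Suc)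
      qed
      then have "slow (\<lambda>x. p x * exp \<bar>?q x\<bar>)" by (intro slow_mult slow_real_polynomial[OF p])
      moreover have "continuous_on UNIV (\<lambda>x. p x * exp \<bar>?q x\<bar>)"
        by (intro continuous_intros pc p)
      ultimately have "integrable lebesgue (\<lambda>x. f x * of_real ((p x * exp \<bar>?q x\<bar>) * exp (- (1/2 + ?N) * (norm x)\<^sup>2)))"
        by (rule int) simp
      then show "integrable lebesgue (\<lambda>x. w (1/2 + ?N) x * of_real (p x * exp \<bar>?q x\<bar>))"
        by (simp add: w_def mult_ac del: of_nat_Suc)
    qed
    then have "of_real (exp (- ?N * (norm y)\<^sup>2)) * (LINT x|lebesgue. w (1/2 + ?N) x * of_real (1 * exp (?q x))) = 0"
      by simp
    then have "(LINT x|lebesgue. of_real (exp (- ?N * (norm y)\<^sup>2)) * (w (1/2 + ?N) x * of_real (1 * exp (?q x)))) = 0"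
      by (simp only: integral_mult_right_zero)
    moreover have "of_real (exp (- ?N * (norm y)\<^sup>2)) * (w (1/2 + ?N) x * of_real (1 * exp (?q x)))
        = w (1/2) x * of_real (exp (- ?N * (norm (x - y))\<^sup>2))" for x
    proof -
      have "exp (- ?N * (norm y)\<^sup>2) * (exp (- (1/2 + ?N) * (norm x)\<^sup>2) * exp (?q x))
          = exp (- (1/2) * (norm x)\<^sup>2) * exp (- ?N * (norm (x - y))\<^sup>2)"
        unfolding mult_exp_exp power2_norm_eq_inner
        by (rule arg_cong[where f=exp]) (simp add: inner_diff_left inner_diff_right inner_commute algebra_simps)
      then show ?thesis unfolding w_def by (simp add: mult_ac flip: of_real_mult del: of_nat_Suc)
    qed
    ultimately show "(LINT x|lebesgue. w (1/2) x * of_real (exp (- ?N * (norm (x - y))\<^sup>2))) = 0"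
      by (simp only:)
  qed
  then show ?thesis by (simp add: w_def)
qed

section \<open>Hermite expansions\<close>

definition hc :: "(real^'n::finite \<Rightarrow> complex) \<Rightarrow> ('n \<Rightarrow> nat) \<Rightarrow> complex" where
  "hc f \<alpha> = ip lebesgue f (hermite_fun \<alpha>)"

lemma hc_scale: "hc (\<lambda>x. c * f x) \<alpha> = c * hc f \<alpha>"
  unfolding hc_def by (rule ip_scale_left)

text \<open>Completeness makes the coefficients determine the function almost everywhere, and upgrades Bessel's inequality
  to Parseval's identity: a Riesz--Fischer function with the same coefficients coincides with \<open>f\<close>.\<close>

lemma hermite_unique:
  assumes "sqint lebesgue f" "sqint lebesgue g" "\<And>\<alpha>. hc f \<alpha> = hc g \<alpha>"
  shows "AE x in lebesgue. f x = g x"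
proof -
  have "AE x in lebesgue. f x - g x = 0"
    by (rule hermite_complete[OF sqint_diff[OF assms(1,2)]])
       (use assms in \<open>simp add: ip_diff_left[OF assms(1,2) sqint_hermite_fun] hc_def\<close>)
  then show ?thesis by eventually_elim simp
qed

lemma hermite_Riesz_Fischer:
  assumes "(\<lambda>\<alpha>. (cmod (a \<alpha>))\<^sup>2) summable_on UNIV"
  shows "\<exists>f. sqint lebesgue f \<and> (\<forall>\<alpha>. hc f \<alpha> = a \<alpha>)"
  using Riesz_Fischer[OF orthonormal_hermite_fun assms] unfolding hc_def by blast

lemma hermite_Parseval:
  assumes f: "sqint lebesgue f"
  shows "((\<lambda>\<alpha>. (cmod (hc f \<alpha>))\<^sup>2) has_sum nsq lebesgue f) UNIV"
proof -
  have s: "(\<lambda>\<alpha>. (cmod (hc f \<alpha>))\<^sup>2) summable_on UNIV"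
  proof (rule nonneg_bdd_above_summable_on)
    show "bdd_above (sum (\<lambda>\<alpha>. (cmod (hc f \<alpha>))\<^sup>2) ` {F. F \<subseteq> UNIV \<and> finite F})"
      using Bessel[OF orthonormal_hermite_fun _ f] by (auto simp: hc_def bdd_above_def)
  qed simp
  obtain g where g: "sqint lebesgue g" "\<And>\<alpha>. hc g \<alpha> = hc f \<alpha>" "nsq lebesgue g = (\<Sum>\<^sub>\<infinity>\<alpha>. (cmod (hc f \<alpha>))\<^sup>2)"
    using Riesz_Fischer[OF orthonormal_hermite_fun s] unfolding hc_def by blast
  have "AE x in lebesgue. g x = f x" by (rule hermite_unique[OF g(1) f g(2)])
  then have "nsq lebesgue g = nsq lebesgue f"
    unfolding nsq_def using f g(1)
    by (intro integral_cong_AE) (auto simp: sqint_def)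
  then show ?thesis using has_sum_infsum[OF s] g(3) by simp
qed

lemma hermite_expansion_tendsto:
  assumes f: "sqint lebesgue f"
  shows "((\<lambda>F. nsq lebesgue (\<lambda>x. f x - (\<Sum>\<alpha>\<in>F. hc f \<alpha> * hermite_fun \<alpha> x))) \<longlongrightarrow> 0) (finite_subsets_at_top UNIV)"
proof (rule Lim_transform_eventually)
  show "((\<lambda>F. nsq lebesgue f - (\<Sum>\<alpha>\<in>F. (cmod (hc f \<alpha>))\<^sup>2)) \<longlongrightarrow> 0) (finite_subsets_at_top UNIV)"
    using tendsto_diff[OF tendsto_const hermite_Parseval[OF f, unfolded has_sum_def], of "nsq lebesgue f"] by simp
  show "\<forall>\<^sub>F F in finite_subsets_at_top UNIV. nsq lebesgue f - (\<Sum>\<alpha>\<in>F. (cmod (hc f \<alpha>))\<^sup>2)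
      = nsq lebesgue (\<lambda>x. f x - (\<Sum>\<alpha>\<in>F. hc f \<alpha> * hermite_fun \<alpha> x))"
    by (rule eventually_finite_subsets_at_top_weakI)
       (simp add: hc_def nsq_minus_projection[OF orthonormal_hermite_fun _ f])
qed

section \<open>Sobolev bounds for multiplication operators\<close>

abbreviation lam :: "('n::finite \<Rightarrow> nat) \<Rightarrow> real" where
  "lam \<equiv> hermite_eigenvalue"

lemma lam_ge_1: "1 \<le> lam \<alpha>" for \<alpha> :: "'n::finite \<Rightarrow> nat"
proof -
  have "1 \<le> real CARD('n)" by (simp add: Suc_le_eq)
  then show ?thesis unfolding hermite_eigenvalue_def
    by (metis add_increasing mult_nonneg_nonneg of_nat_0_le_iff zero_le_numeral)
qed

lemma lam_pos: "0 < lam \<alpha>" "0 \<le> lam \<alpha>"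
  using lam_ge_1[of \<alpha>] by auto

lemma lam_inc: "lam (inc j \<alpha>) = lam \<alpha> + 2"
proof -
  have "(\<Sum>i\<in>UNIV. inc j \<alpha> i) = Suc (\<Sum>i\<in>UNIV. \<alpha> i)"
    by (simp add: sum.remove[of UNIV j])
  then show ?thesis by (simp add: hermite_eigenvalue_def)
qed

lemma lam_inc_le: "lam (inc j \<alpha>) \<le> 3 * lam \<alpha>"
  using lam_ge_1[of \<alpha>] by (simp add: lam_inc)

lemma lam_coord_le:
  fixes \<alpha> :: "'n::finite \<Rightarrow> nat"
  shows "2 * real (\<alpha> j) \<le> lam \<alpha>" "2 * real (Suc (\<alpha> j)) \<le> 2 * lam \<alpha>"
proof -
  have "\<alpha> j \<le> (\<Sum>i\<in>UNIV. \<alpha> i)" by (rule member_le_sum) auto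
  then have "real (\<alpha> j) \<le> real (\<Sum>i\<in>UNIV. \<alpha> i)" by (rule of_nat_mono)
  moreover have "1 \<le> real CARD('n)" by (simp add: Suc_le_eq)
  moreover have "0 \<le> real (\<alpha> j)" by simp
  moreover have "2 * a \<le> 2 * S + n" "2 * (1 + a) \<le> 2 * (2 * S + n)" if "a \<le> S" "1 \<le> n" "0 \<le> a" for a S n :: real
    using that by auto
  ultimately show "2 * real (\<alpha> j) \<le> lam \<alpha>" "2 * real (Suc (\<alpha> j)) \<le> 2 * lam \<alpha>"
    unfolding hermite_eigenvalue_def of_nat_Suc by blast+
qed

text \<open>Away from the ground state the eigenvalue \<open>2|\<alpha>| + n\<close> is controlled by the part \<open>2|\<alpha>|\<close> that the
  raising operators produce.\<close>

lemma lam_le_sum_coords: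
  fixes \<alpha> :: "'n::finite \<Rightarrow> nat"
  assumes "\<alpha> \<noteq> (\<lambda>_. 0)"
  shows "lam \<alpha> \<le> (real CARD('n) + 1) * (\<Sum>j\<in>UNIV. 2 * real (\<alpha> j))"
proof -
  obtain j where "0 < \<alpha> j" using assms by auto
  moreover have "\<alpha> j \<le> (\<Sum>i\<in>UNIV. \<alpha> i)" by (rule member_le_sum) auto
  ultimately have s: "1 \<le> (\<Sum>j\<in>UNIV. real (\<alpha> j))" by (simp flip: of_nat_sum)
  define S where "S = (\<Sum>j\<in>UNIV. 2 * real (\<alpha> j))"
  have S: "2 * real (\<Sum>j\<in>UNIV. \<alpha> j) = S" "1 \<le> S"
    using s by (simp_all add: S_def flip: sum_distrib_left)
  have "real CARD('n) * 1 \<le> real CARD('n) * S"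
    using S(2) by (intro mult_left_mono) auto
  then show ?thesis
    unfolding hermite_eigenvalue_def S(1) S_def[symmetric] by (simp add: distrib_right)
qed

text \<open>The squared Sobolev norm of order \<open>s\<close> of a finite Hermite expansion.\<close>

definition wn :: "nat \<Rightarrow> ('n::finite \<Rightarrow> nat) set \<Rightarrow> (('n \<Rightarrow> nat) \<Rightarrow> complex) \<Rightarrow> real" where
  "wn s A c = (\<Sum>\<alpha>\<in>A. lam \<alpha> ^ s * (cmod (c \<alpha>))\<^sup>2)"

lemma wn_nonneg: "0 \<le> wn s A c"
  unfolding wn_def by (intro sum_nonneg mult_nonneg_nonneg zero_le_power lam_pos) auto

lemma wn_mono: "s \<le> t \<Longrightarrow> wn s A c \<le> wn t A c"
  unfolding wn_def by (intro sum_mono mult_right_mono power_increasing lam_ge_1) auto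

text \<open>The lowering operator maps a linear combination of Hermite functions to another one and costs
  one power of the eigenvalue; likewise the raising operator.\<close>

lemma lowering_reindex:
  fixes A :: "('n::finite \<Rightarrow> nat) set"
  assumes "finite A"
  obtains A' c' where "finite A'" "wn s A' c' \<le> wn (Suc s) A c"
    "\<And>\<phi>. (\<Sum>\<alpha>\<in>A. c \<alpha> * (of_real (sqrt (2 * real (\<alpha> j))) * \<phi> (dec j \<alpha>))) = (\<Sum>\<alpha>\<in>A'. c' \<alpha> * (\<phi> \<alpha> :: complex))"
proof -
  let ?P = "{\<alpha>\<in>A. 0 < \<alpha> j}"
  define A' where "A' = dec j ` ?P"
  define c' where "c' \<alpha> = c (inc j \<alpha>) * of_real (sqrt (2 * real (Suc (\<alpha> j))))" for \<alpha>
  have inj: "inj_on (dec j) ?P" by (rule inj_on_inverseI[of _ "inc j"]) auto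
  have c': "c' (dec j \<alpha>) = c \<alpha> * of_real (sqrt (2 * real (\<alpha> j)))" if "\<alpha> \<in> ?P" for \<alpha>
    using that by (simp add: c'_def)
  show ?thesis
  proof (rule that[of A' c'])
    show "finite A'" using assms by (simp add: A'_def)
    have "wn s A' c' = (\<Sum>\<alpha>\<in>?P. lam (dec j \<alpha>) ^ s * (cmod (c' (dec j \<alpha>)))\<^sup>2)"
      unfolding wn_def A'_def by (subst sum.reindex[OF inj]) simp
    also have "\<dots> \<le> (\<Sum>\<alpha>\<in>?P. lam \<alpha> ^ Suc s * (cmod (c \<alpha>))\<^sup>2)"
    proof (rule sum_mono)
      fix \<alpha> assume a: "\<alpha> \<in> ?P"
      have "lam (dec j \<alpha>) \<le> lam \<alpha>" using lam_inc[of j "dec j \<alpha>"] a by simp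
      then have "lam (dec j \<alpha>) ^ s * (2 * real (\<alpha> j)) \<le> lam \<alpha> ^ s * lam \<alpha>"
        by (intro mult_mono power_mono lam_pos lam_coord_le zero_le_power) auto
      then have "(lam (dec j \<alpha>) ^ s * (2 * real (\<alpha> j))) * (cmod (c \<alpha>))\<^sup>2 \<le> (lam \<alpha> ^ s * lam \<alpha>) * (cmod (c \<alpha>))\<^sup>2"
        by (rule mult_right_mono) simp
      then show "lam (dec j \<alpha>) ^ s * (cmod (c' (dec j \<alpha>)))\<^sup>2 \<le> lam \<alpha> ^ Suc s * (cmod (c \<alpha>))\<^sup>2"
        unfolding c'[OF a] by (simp add: norm_mult power_mult_distrib mult_ac)
    qed
    also have "\<dots> \<le> wn (Suc s) A c"
      unfolding wn_def using assms
      by (intro sum_mono2 mult_nonneg_nonneg zero_le_power lam_pos(2)) auto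
    finally show "wn s A' c' \<le> wn (Suc s) A c" .
    fix \<phi> :: "('n \<Rightarrow> nat) \<Rightarrow> complex"
    have "(\<Sum>\<alpha>\<in>A. c \<alpha> * (of_real (sqrt (2 * real (\<alpha> j))) * \<phi> (dec j \<alpha>)))
        = (\<Sum>\<alpha>\<in>?P. c \<alpha> * (of_real (sqrt (2 * real (\<alpha> j))) * \<phi> (dec j \<alpha>)))"
      using assms by (intro sum.mono_neutral_right) auto
    also have "\<dots> = (\<Sum>\<alpha>\<in>?P. c' (dec j \<alpha>) * \<phi> (dec j \<alpha>))"
      by (intro sum.cong refl) (simp add: c' mult.assoc)
    also have "\<dots> = (\<Sum>\<alpha>\<in>A'. c' \<alpha> * \<phi> \<alpha>)"
      unfolding A'_def by (subst sum.reindex[OF inj]) simp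
    finally show "(\<Sum>\<alpha>\<in>A. c \<alpha> * (of_real (sqrt (2 * real (\<alpha> j))) * \<phi> (dec j \<alpha>))) = (\<Sum>\<alpha>\<in>A'. c' \<alpha> * \<phi> \<alpha>)" .
  qed
qed

lemma raising_reindex:
  fixes A :: "('n::finite \<Rightarrow> nat) set"
  assumes "finite A"
  obtains A' c' where "finite A'" "wn s A' c' \<le> 2 * 3 ^ s * wn (Suc s) A c"
    "\<And>\<phi>. (\<Sum>\<alpha>\<in>A. c \<alpha> * (of_real (sqrt (2 * real (Suc (\<alpha> j)))) * \<phi> (inc j \<alpha>))) = (\<Sum>\<alpha>\<in>A'. c' \<alpha> * (\<phi> \<alpha> :: complex))"
proof -
  define A' where "A' = inc j ` A"
  define c' where "c' \<alpha> = c (dec j \<alpha>) * of_real (sqrt (2 * real (\<alpha> j)))" for \<alpha>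
  have inj: "inj_on (inc j) A" using inj_inc by (rule inj_on_subset) simp
  have c': "c' (inc j \<alpha>) = c \<alpha> * of_real (sqrt (2 * real (Suc (\<alpha> j))))" for \<alpha>
    by (simp add: c'_def)
  show ?thesis
  proof (rule that[of A' c'])
    show "finite A'" using assms by (simp add: A'_def)
    have "wn s A' c' = (\<Sum>\<alpha>\<in>A. lam (inc j \<alpha>) ^ s * (cmod (c' (inc j \<alpha>)))\<^sup>2)"
      unfolding wn_def A'_def by (subst sum.reindex[OF inj]) simp
    also have "\<dots> \<le> (\<Sum>\<alpha>\<in>A. 2 * 3 ^ s * (lam \<alpha> ^ Suc s * (cmod (c \<alpha>))\<^sup>2))"
    proof (rule sum_mono)
      fix \<alpha>
      have "lam (inc j \<alpha>) ^ s * (2 * real (Suc (\<alpha> j))) \<le> (3 * lam \<alpha>) ^ s * (2 * lam \<alpha>)"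
        using lam_pos by (intro mult_mono power_mono lam_coord_le lam_inc_le zero_le_power) auto
      then have "(lam (inc j \<alpha>) ^ s * (2 * real (Suc (\<alpha> j)))) * (cmod (c \<alpha>))\<^sup>2 \<le> ((3 * lam \<alpha>) ^ s * (2 * lam \<alpha>)) * (cmod (c \<alpha>))\<^sup>2"
        by (rule mult_right_mono) simp
      then show "lam (inc j \<alpha>) ^ s * (cmod (c' (inc j \<alpha>)))\<^sup>2 \<le> 2 * 3 ^ s * (lam \<alpha> ^ Suc s * (cmod (c \<alpha>))\<^sup>2)"
        unfolding c' by (simp add: norm_mult power_mult_distrib mult_ac del: of_nat_Suc)
    qed
    finally show "wn s A' c' \<le> 2 * 3 ^ s * wn (Suc s) A c" by (simp add: wn_def sum_distrib_left)
    fix \<phi> :: "('n \<Rightarrow> nat) \<Rightarrow> complex"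
    show "(\<Sum>\<alpha>\<in>A. c \<alpha> * (of_real (sqrt (2 * real (Suc (\<alpha> j)))) * \<phi> (inc j \<alpha>))) = (\<Sum>\<alpha>\<in>A'. c' \<alpha> * \<phi> \<alpha>)"
      unfolding A'_def by (subst sum.reindex[OF inj]) (simp add: c' mult.assoc)
  qed
qed

definition lc :: "('n::finite \<Rightarrow> nat) set \<Rightarrow> (('n \<Rightarrow> nat) \<Rightarrow> complex) \<Rightarrow> real^'n \<Rightarrow> complex" where
  "lc A c x = (\<Sum>\<alpha>\<in>A. c \<alpha> * hermite_fun \<alpha> x)"

lemma lc_measurable [measurable]: "lc A c \<in> borel_measurable borel"
  unfolding lc_def[abs_def] by measurable

lemma gdec_lc: "gdec (lc A c)"
proof (induction A rule: infinite_finite_induct)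
  case (insert \<alpha> A)
  have "gdec (\<lambda>x. c \<alpha> * hermite_fun \<alpha> x + lc A c x)"
    by (intro gdec_add gdec_scale gdec_hermite_fun insert)
  then show ?case using insert by (simp add: lc_def[abs_def])
qed (auto simp: lc_def[abs_def] gdec_def intro!: exI[of _ "0::real"] exI[of _ "1::real"])

lemma sqint_lc: "sqint lebesgue (lc A c)"
  by (rule sqint_gdec[OF gdec_lc lc_measurable])

lemma nsq_lc: "finite A \<Longrightarrow> nsq lebesgue (lc A c) = wn 0 A c"
  unfolding lc_def[abs_def] wn_def by (simp add: nsq_comb[OF orthonormal_hermite_fun])

lemma coord_mult_lc:
  "of_real (x $ j) * lc A c x
     = (1/2) * ((\<Sum>\<alpha>\<in>A. c \<alpha> * (of_real (sqrt (2 * real (\<alpha> j))) * hermite_fun (dec j \<alpha>) x))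
        + (\<Sum>\<alpha>\<in>A. c \<alpha> * (of_real (sqrt (2 * real (Suc (\<alpha> j)))) * hermite_fun (inc j \<alpha>) x)))"
proof -
  have "of_real (x $ j) * hermite_fun \<alpha> x = (1/2) * (of_real (sqrt (2 * real (\<alpha> j))) * hermite_fun (dec j \<alpha>) x
      + of_real (sqrt (2 * real (Suc (\<alpha> j)))) * hermite_fun (inc j \<alpha>) x)" for \<alpha>
  proof -
    have "complex_of_real (x $ j * hr \<alpha> x) = of_real ((1/2) * (sqrt (2 * real (\<alpha> j)) * hr (dec j \<alpha>) x + sqrt (2 * real (Suc (\<alpha> j))) * hr (inc j \<alpha>) x))"
      by (simp only: coord_mult_hr)
    then show ?thesis by (simp add: hermite_fun_eq_hr)
  qed
  then have "of_real (x $ j) * lc A c x = (\<Sum>\<alpha>\<in>A. c \<alpha> * ((1/2) * (of_real (sqrt (2 * real (\<alpha> j))) * hermite_fun (dec j \<alpha>) x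
      + of_real (sqrt (2 * real (Suc (\<alpha> j)))) * hermite_fun (inc j \<alpha>) x)))"
    unfolding lc_def sum_distrib_left by (intro sum.cong refl) (metis mult.left_commute)
  also have "\<dots> = (1/2) * ((\<Sum>\<alpha>\<in>A. c \<alpha> * (of_real (sqrt (2 * real (\<alpha> j))) * hermite_fun (dec j \<alpha>) x))
        + (\<Sum>\<alpha>\<in>A. c \<alpha> * (of_real (sqrt (2 * real (Suc (\<alpha> j)))) * hermite_fun (inc j \<alpha>) x)))"
    unfolding sum.distrib[symmetric] sum_distrib_left by (intro sum.cong refl) (simp add: algebra_simps del: of_nat_Suc)
  finally show ?thesis .
qed

lemma cmod_add_power2_le: "(cmod (a + b))\<^sup>2 \<le> 2 * (cmod a)\<^sup>2 + 2 * (cmod b)\<^sup>2"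
proof -
  have "(cmod (a + b))\<^sup>2 \<le> (cmod a + cmod b)\<^sup>2" by (intro power_mono norm_triangle_ineq) auto
  also have "\<dots> \<le> 2 * (cmod a)\<^sup>2 + 2 * (cmod b)\<^sup>2"
    using sum_squares_bound[of "cmod a" "cmod b"] by (simp add: power2_sum)
  finally show ?thesis .
qed

lemma integrable_weighted_lc: "integrable lebesgue (\<lambda>x. (1 + norm x) ^ r * (cmod (lc A c x))\<^sup>2)"
proof -
  have "gdec (\<lambda>x. (1 + norm x) ^ r * (cmod (lc A c x))\<^sup>2)"
  proof (rule gdec_slow[OF _ gdec_lc[of A c]])
    show "slow (\<lambda>x. (1 * (1 + norm x) ^ r) * cmod (lc A c x))"
      by (intro slow_mult slow_growth) (simp add: slow_norm_iff gdec_imp_slow[OF gdec_lc])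
  qed (simp add: power2_eq_square abs_mult mult.assoc)
  then have "integrable lborel (\<lambda>x. (1 + norm x) ^ r * (cmod (lc A c x))\<^sup>2)"
    by (rule integrable_gdec) measurable
  then show ?thesis by (subst integrable_completion) auto
qed

text \<open>Multiplication by \<open>(1 + |x|)\<^sup>r\<close> costs \<open>r\<close> orders in the Hermite--Sobolev scale.\<close>

lemma weighted_lc_bound:
  "\<exists>K\<ge>0. \<forall>(A :: ('n::finite \<Rightarrow> nat) set) c. finite A \<longrightarrow>
     (LINT x|lebesgue. (1 + norm x) ^ (2 * r) * (cmod (lc A c x))\<^sup>2) \<le> K * wn r A c"
proof (induction r)
  case 0
  have "(LINT x|lebesgue. (1 + norm x) ^ (2 * 0) * (cmod (lc A c x))\<^sup>2) \<le> 1 * wn 0 A c"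
    if "finite A" for A :: "('n \<Rightarrow> nat) set" and c
    using nsq_lc[OF that, of c] by (simp add: nsq_def)
  then show ?case by (intro exI[of _ 1]) auto
next
  case (Suc r)
  then obtain K where K: "0 \<le> K" "\<And>(A :: ('n \<Rightarrow> nat) set) c. finite A \<Longrightarrow>
     (LINT x|lebesgue. (1 + norm x) ^ (2 * r) * (cmod (lc A c x))\<^sup>2) \<le> K * wn r A c"
    by blast
  let ?n = "real CARD('n)"
  let ?K = "2 * K + ?n * (K + K * (2 * 3 ^ r))"
  have "(LINT x|lebesgue. (1 + norm x) ^ (2 * Suc r) * (cmod (lc A c x))\<^sup>2) \<le> ?K * wn (Suc r) A c"
    if A: "finite A" for A :: "('n \<Rightarrow> nat) set" and c
  proof -
    let ?w = "\<lambda>x::real^'n. (1 + norm x) ^ (2 * r)"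
    have "\<exists>A1 c1 A2 c2. finite A1 \<and> finite A2 \<and> wn r A1 c1 \<le> wn (Suc r) A c \<and> wn r A2 c2 \<le> 2 * 3 ^ r * wn (Suc r) A c
       \<and> (\<forall>x. of_real (x $ j) * lc A c x = (1/2) * (lc A1 c1 x + lc A2 c2 x))" for j
    proof -
      obtain A1 c1 where 1: "finite A1" "wn r A1 c1 \<le> wn (Suc r) A c"
        "\<And>\<phi>. (\<Sum>\<alpha>\<in>A. c \<alpha> * (of_real (sqrt (2 * real (\<alpha> j))) * \<phi> (dec j \<alpha>))) = (\<Sum>\<alpha>\<in>A1. c1 \<alpha> * (\<phi> \<alpha> :: complex))"
        by (rule lowering_reindex[OF A, where s=r and c=c and j=j]) blast
      obtain A2 c2 where 2: "finite A2" "wn r A2 c2 \<le> 2 * 3 ^ r * wn (Suc r) A c"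
        "\<And>\<phi>. (\<Sum>\<alpha>\<in>A. c \<alpha> * (of_real (sqrt (2 * real (Suc (\<alpha> j)))) * \<phi> (inc j \<alpha>))) = (\<Sum>\<alpha>\<in>A2. c2 \<alpha> * (\<phi> \<alpha> :: complex))"
        by (rule raising_reindex[OF A, where s=r and c=c and j=j]) blast
      have "of_real (x $ j) * lc A c x = (1/2) * (lc A1 c1 x + lc A2 c2 x)" for x
        using coord_mult_lc[of x j A c]
        unfolding 1(3)[where \<phi>="\<lambda>\<alpha>. hermite_fun \<alpha> x"] 2(3)[where \<phi>="\<lambda>\<alpha>. hermite_fun \<alpha> x"]
          lc_def[of A1, symmetric] lc_def[of A2, symmetric] .
      with 1(1,2) 2(1,2) show ?thesis by blast
    qed
    then obtain A1 c1 A2 c2 where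
      fin: "\<And>j. finite (A1 j)" "\<And>j. finite (A2 j)" and
      wn1: "\<And>j. wn r (A1 j) (c1 j) \<le> wn (Suc r) A c" and
      wn2: "\<And>j. wn r (A2 j) (c2 j) \<le> 2 * 3 ^ r * wn (Suc r) A c" and
      xj: "\<And>j x. of_real (x $ j) * lc A c x = (1/2) * (lc (A1 j) (c1 j) x + lc (A2 j) (c2 j) x)"
      by metis
    have pt: "(1 + norm x) ^ (2 * Suc r) * (cmod (lc A c x))\<^sup>2
       \<le> 2 * (?w x * (cmod (lc A c x))\<^sup>2) + (\<Sum>j\<in>UNIV. ?w x * (cmod (lc (A1 j) (c1 j) x))\<^sup>2 + ?w x * (cmod (lc (A2 j) (c2 j) x))\<^sup>2)" for x
    proof -
      let ?f = "(cmod (lc A c x))\<^sup>2"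
      have a: "(x $ j)\<^sup>2 * ?f \<le> (1/2) * ((cmod (lc (A1 j) (c1 j) x))\<^sup>2 + (cmod (lc (A2 j) (c2 j) x))\<^sup>2)" for j
      proof -
        have "(x $ j)\<^sup>2 * ?f = (cmod (of_real (x $ j) * lc A c x))\<^sup>2"
          by (simp add: norm_mult power_mult_distrib)
        also have "\<dots> = (1/4) * (cmod (lc (A1 j) (c1 j) x + lc (A2 j) (c2 j) x))\<^sup>2"
          unfolding xj norm_mult power_mult_distrib by (simp add: power2_eq_square)
        also have "\<dots> \<le> (1/4) * (2 * (cmod (lc (A1 j) (c1 j) x))\<^sup>2 + 2 * (cmod (lc (A2 j) (c2 j) x))\<^sup>2)"
          by (intro mult_left_mono cmod_add_power2_le) auto
        finally show ?thesis by simp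
      qed
      have "(1 + norm x)\<^sup>2 \<le> 2 + 2 * (\<Sum>j\<in>UNIV. (x $ j)\<^sup>2)"
        using sum_squares_bound[of 1 "norm x"] by (simp add: power2_sum flip: norm_power2_vec)
      then have "(1 + norm x)\<^sup>2 * ?f \<le> (2 + 2 * (\<Sum>j\<in>UNIV. (x $ j)\<^sup>2)) * ?f" by (rule mult_right_mono) simp
      also have "\<dots> = 2 * ?f + 2 * (\<Sum>j\<in>UNIV. (x $ j)\<^sup>2 * ?f)" by (simp add: algebra_simps sum_distrib_left sum_distrib_right)
      also have "\<dots> \<le> 2 * ?f + 2 * (\<Sum>j\<in>UNIV. (1/2) * ((cmod (lc (A1 j) (c1 j) x))\<^sup>2 + (cmod (lc (A2 j) (c2 j) x))\<^sup>2))"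
        by (intro add_left_mono mult_left_mono sum_mono a) auto
      also have "\<dots> = 2 * ?f + (\<Sum>j\<in>UNIV. (cmod (lc (A1 j) (c1 j) x))\<^sup>2 + (cmod (lc (A2 j) (c2 j) x))\<^sup>2)"
        by (simp only: sum_distrib_left[symmetric])
      finally have "?w x * ((1 + norm x)\<^sup>2 * ?f) \<le> ?w x * (2 * ?f + (\<Sum>j\<in>UNIV. (cmod (lc (A1 j) (c1 j) x))\<^sup>2 + (cmod (lc (A2 j) (c2 j) x))\<^sup>2))"
        by (rule mult_left_mono) simp
      moreover have "(1 + norm x) ^ (2 * Suc r) * ?f = ?w x * ((1 + norm x)\<^sup>2 * ?f)"
        by (simp add: power2_eq_square mult_ac)
      ultimately show ?thesis
        unfolding distrib_left sum_distrib_left mult.left_commute[of _ 2] by (simp only:)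
    qed
    have I: "(LINT x|lebesgue. (1 + norm x) ^ (2 * Suc r) * (cmod (lc A c x))\<^sup>2)
      \<le> (LINT x|lebesgue. 2 * (?w x * (cmod (lc A c x))\<^sup>2) + (\<Sum>j\<in>UNIV. ?w x * (cmod (lc (A1 j) (c1 j) x))\<^sup>2 + ?w x * (cmod (lc (A2 j) (c2 j) x))\<^sup>2))"
      by (rule Bochner_Integration.integral_mono[OF _ _ pt])
         (intro integrable_weighted_lc Bochner_Integration.integrable_add Bochner_Integration.integrable_sum integrable_mult_right)+
    also have "\<dots> = 2 * (LINT x|lebesgue. ?w x * (cmod (lc A c x))\<^sup>2)
       + (\<Sum>j\<in>UNIV. (LINT x|lebesgue. ?w x * (cmod (lc (A1 j) (c1 j) x))\<^sup>2) + (LINT x|lebesgue. ?w x * (cmod (lc (A2 j) (c2 j) x))\<^sup>2))"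
      by (simp add: integrable_weighted_lc)
    also have "\<dots> \<le> 2 * (K * wn (Suc r) A c) + (\<Sum>j\<in>(UNIV::'n set). K * wn (Suc r) A c + K * (2 * 3 ^ r * wn (Suc r) A c))"
    proof (intro add_mono mult_left_mono sum_mono)
      show "(LINT x|lebesgue. ?w x * (cmod (lc A c x))\<^sup>2) \<le> K * wn (Suc r) A c"
        using K(2)[OF A, of c] mult_left_mono[OF wn_mono[of r "Suc r" A c] K(1)] by simp
      show "(LINT x|lebesgue. ?w x * (cmod (lc (A1 j) (c1 j) x))\<^sup>2) \<le> K * wn (Suc r) A c" for j
        using K(2)[OF fin(1)[of j], of "c1 j"] mult_left_mono[OF wn1[of j] K(1)] by linarith
      show "(LINT x|lebesgue. ?w x * (cmod (lc (A2 j) (c2 j) x))\<^sup>2) \<le> K * (2 * 3 ^ r * wn (Suc r) A c)" for j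
        using K(2)[OF fin(2)[of j], of "c2 j"] mult_left_mono[OF wn2[of j] K(1)] by linarith
    qed simp
    also have "\<dots> = ?K * wn (Suc r) A c" by (simp add: algebra_simps)
    finally show ?thesis .
  qed
  moreover have "0 \<le> ?K" using K(1) by auto
  ultimately show ?case by blast
qed

text \<open>\<open>tame k r G\<close>: the weak derivatives of \<open>G\<close> of order \<open>l \<le> k\<close> exist and grow at most
  like \<open>(1 + |x|)\<^bsup>r + l\<^esup>\<close>.\<close>

primrec tame :: "nat \<Rightarrow> nat \<Rightarrow> (real^'n::finite \<Rightarrow> complex) \<Rightarrow> bool" where
  "tame 0 r G \<longleftrightarrow> growth r G"
| "tame (Suc k) r G \<longleftrightarrow> growth r G \<and> (\<forall>j. \<exists>G'. wpair j G G' \<and> tame k (Suc r) G')"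

lemma tame_growth: "tame k r G \<Longrightarrow> growth r G"
  by (cases k) auto

lemma tame_Suc_imp: "tame (Suc k) r G \<Longrightarrow> tame k r G"
proof (induction k arbitrary: r G)
  case (Suc k)
  then show ?case by (simp only: tame.simps(2)) blast
qed simp

lemma sqint_growth_lc:
  fixes G :: "real^'n::finite \<Rightarrow> complex"
  assumes "growth r G"
  obtains C where "0 \<le> C" "\<And>A c. sqint lebesgue (\<lambda>x. G x * lc A c x)"
    "\<And>A c. nsq lebesgue (\<lambda>x. G x * lc A c x) \<le> C * (LINT x|lebesgue. (1 + norm x) ^ (2 * r) * (cmod (lc A c x))\<^sup>2)"
proof -
  obtain C where C: "AE x in lebesgue. cmod (G x) \<le> C * (1 + norm x) ^ r" and m: "G \<in> borel_measurable lebesgue"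
    using assms unfolding growth_def by blast
  have lm: "lc A c \<in> borel_measurable lebesgue" for A :: "('n \<Rightarrow> nat) set" and c
    by (rule measurable_completion) simp
  have s: "sqint lebesgue (\<lambda>x. of_real ((1 + norm x) ^ r) * lc A c x)" for A :: "('n \<Rightarrow> nat) set" and c
  proof (rule sqint_gdec)
    have "slow (\<lambda>x::real^'n. complex_of_real (1 * (1 + norm x) ^ r))" by (intro slow_of_real slow_growth)
    then show "gdec (\<lambda>x. complex_of_real ((1 + norm x) ^ r) * lc A c x)"
      by (rule gdec_slow[OF _ gdec_lc[of A c]]) (simp add: norm_mult)
  qed measurable
  have b: "AE x in lebesgue. cmod (G x * lc A c x) \<le> C * cmod (of_real ((1 + norm x) ^ r) * lc A c x)" for A :: "('n \<Rightarrow> nat) set" and c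
    using C
  proof eventually_elim
    case (elim x)
    have n: "norm (1 + norm x) = 1 + norm x" by simp
    have "cmod (G x) * cmod (lc A c x) \<le> (C * (1 + norm x) ^ r) * cmod (lc A c x)"
      by (rule mult_right_mono[OF elim]) simp
    then show ?case by (simp add: norm_mult norm_power mult.assoc del: of_real_add of_real_power)
  qed
  have gm: "(\<lambda>x. G x * lc A c x) \<in> borel_measurable lebesgue" for A :: "('n \<Rightarrow> nat) set" and c
    by (intro borel_measurable_times m lm)
  show ?thesis
  proof (rule that[of "C\<^sup>2"])
    show "sqint lebesgue (\<lambda>x. G x * lc A c x)" for A :: "('n \<Rightarrow> nat) set" and c by (rule sqint_bound[OF s gm b])
    have e: "nsq lebesgue (\<lambda>x. of_real ((1 + norm x) ^ r) * lc A c x) = (LINT x|lebesgue. (1 + norm x) ^ (2 * r) * (cmod (lc A c x))\<^sup>2)" for A :: "('n \<Rightarrow> nat) set" and c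
      by (simp add: nsq_def norm_mult power_mult_distrib power_mult mult.commute[of 2] del: of_real_power of_real_add)
    show "nsq lebesgue (\<lambda>x. G x * lc A c x) \<le> C\<^sup>2 * (LINT x|lebesgue. (1 + norm x) ^ (2 * r) * (cmod (lc A c x))\<^sup>2)" for A :: "('n \<Rightarrow> nat) set" and c
      using sqint_bound(2)[OF s gm b] unfolding e .
  qed simp
qed

lemma hc_mult_lc:
  assumes "growth r G"
  shows "hc (\<lambda>x. G x * lc A c x) \<beta> = (\<Sum>\<alpha>\<in>A. c \<alpha> * mel G \<alpha> \<beta>)"
proof -
  have "hc (\<lambda>x. G x * lc A c x) \<beta> = (LINT x|lebesgue. (\<Sum>\<alpha>\<in>A. c \<alpha> * (G x * of_real (hr \<alpha> x * hr \<beta> x))))"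
    unfolding hc_def ip_def lc_def
    by (intro Bochner_Integration.integral_cong refl)
       (simp add: hermite_fun_eq_hr sum_distrib_left sum_distrib_right mult_ac)
  also have "\<dots> = (\<Sum>\<alpha>\<in>A. c \<alpha> * mel G \<alpha> \<beta>)"
    unfolding mel_def by (subst Bochner_Integration.integral_sum) (auto intro!: integrable_mult_right integrable_mel[OF assms] simp del: of_real_mult)
  finally show ?thesis .
qed

text \<open>Boundedness from order \<open>k + r\<close> to order \<open>k\<close>, by induction on \<open>k\<close>. One order of the target
  norm is a factor \<open>2 \<beta> j\<close>, that is, one raising operator on the output side; it moves by \<open>mel_inc\<close>
  to a lowering operator on the input side (costing one order of the source norm) plus
  multiplication by the derivative \<open>G'\<close> (whose growth exponent is \<open>r + 1\<close>).\<close>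

lemma multiplication_bound:
  fixes G :: "real^'n::finite \<Rightarrow> complex"
  assumes "tame k r G"
  shows "\<exists>K\<ge>0. \<forall>A B c. finite A \<longrightarrow> finite B \<longrightarrow>
     (\<Sum>\<beta>\<in>B. lam \<beta> ^ k * (cmod (\<Sum>\<alpha>\<in>A. c \<alpha> * mel G \<alpha> \<beta>))\<^sup>2) \<le> K * wn (k + r) A c"
  using assms
proof (induction k arbitrary: r G)
  case 0
  then have g: "growth r G" by simp
  obtain C where C: "0 \<le> C" "\<And>A c. sqint lebesgue (\<lambda>x. G x * lc A c x)"
    "\<And>A c. nsq lebesgue (\<lambda>x. G x * lc A c x) \<le> C * (LINT x|lebesgue. (1 + norm x) ^ (2 * r) * (cmod (lc A c x))\<^sup>2)"
    using sqint_growth_lc[OF g] by blast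
  obtain K where K: "0 \<le> K" "\<And>(A :: ('n \<Rightarrow> nat) set) c. finite A \<Longrightarrow>
     (LINT x|lebesgue. (1 + norm x) ^ (2 * r) * (cmod (lc A c x))\<^sup>2) \<le> K * wn r A c"
    using weighted_lc_bound[of r] by blast
  have "(\<Sum>\<beta>\<in>B. lam \<beta> ^ 0 * (cmod (\<Sum>\<alpha>\<in>A. c \<alpha> * mel G \<alpha> \<beta>))\<^sup>2) \<le> (C * K) * wn (0 + r) A c"
    if "finite A" "finite B" for A B c
  proof -
    have "(\<Sum>\<beta>\<in>B. (cmod (hc (\<lambda>x. G x * lc A c x) \<beta>))\<^sup>2) \<le> nsq lebesgue (\<lambda>x. G x * lc A c x)"
      unfolding hc_def by (rule Bessel[OF orthonormal_hermite_fun that(2) C(2)])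
    also have "\<dots> \<le> C * (K * wn r A c)"
      by (rule order_trans[OF C(3)]) (intro mult_left_mono K(2) C(1) that)
    finally show ?thesis unfolding hc_mult_lc[OF g] by simp
  qed
  then show ?case using C(1) K(1) by (intro exI[of _ "C * K"]) auto
next
  case (Suc k)
  let ?n = "real CARD('n)"
  have g: "growth r G" using Suc.prems by (rule tame_growth)
  obtain G' where G': "\<And>j. wpair j G (G' j)" "\<And>j. tame k (Suc r) (G' j)"
    using Suc.prems unfolding tame.simps by metis
  obtain K1 where K1: "0 \<le> K1" "\<And>A B c. finite A \<Longrightarrow> finite B \<Longrightarrow>
     (\<Sum>\<beta>\<in>B. lam \<beta> ^ k * (cmod (\<Sum>\<alpha>\<in>A. c \<alpha> * mel G \<alpha> \<beta>))\<^sup>2) \<le> K1 * wn (k + r) A c"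
    using Suc.IH[OF tame_Suc_imp[OF Suc.prems]] by blast
  define Q where "Q j K \<longleftrightarrow> (\<forall>A B c. finite A \<longrightarrow> finite B \<longrightarrow>
     (\<Sum>\<beta>\<in>B. lam \<beta> ^ k * (cmod (\<Sum>\<alpha>\<in>A. c \<alpha> * mel (G' j) \<alpha> \<beta>))\<^sup>2) \<le> K * wn (k + Suc r) A c)" for j K
  have "\<forall>j. \<exists>K. 0 \<le> K \<and> Q j K"
    using Suc.IH[OF G'(2)] unfolding Q_def by blast
  then obtain K2 where K2': "\<forall>j. 0 \<le> K2 j \<and> Q j (K2 j)" by metis
  have K2: "0 \<le> K2 j" "finite A \<Longrightarrow> finite B \<Longrightarrow>
     (\<Sum>\<beta>\<in>B. lam \<beta> ^ k * (cmod (\<Sum>\<alpha>\<in>A. c \<alpha> * mel (G' j) \<alpha> \<beta>))\<^sup>2) \<le> K2 j * wn (k + Suc r) A c" for j A B c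
    using K2'[rule_format, of j] unfolding Q_def by blast+
  let ?K = "?n ^ Suc k * K1 + (?n + 1) * (\<Sum>j\<in>UNIV. 3 ^ k * (2 * (K1 + K2 j)))"
  have "(\<Sum>\<beta>\<in>B. lam \<beta> ^ Suc k * (cmod (\<Sum>\<alpha>\<in>A. c \<alpha> * mel G \<alpha> \<beta>))\<^sup>2) \<le> ?K * wn (Suc k + r) A c"
    if A: "finite A" and B: "finite B" for A B c
  proof -
    define a where "a \<beta> = (\<Sum>\<alpha>\<in>A. c \<alpha> * mel G \<alpha> \<beta>)" for \<beta>
    define W where "W = wn (Suc k + r) A c"
    have W0: "0 \<le> W" unfolding W_def by (rule wn_nonneg)
    have dir: "(\<Sum>\<beta>\<in>B. lam \<beta> ^ k * (2 * real (\<beta> j)) * (cmod (a \<beta>))\<^sup>2) \<le> 3 ^ k * (2 * (K1 + K2 j)) * W" for j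
    proof -
      let ?P = "{\<beta>\<in>B. 0 < \<beta> j}"
      let ?B = "dec j ` ?P"
      have inj: "inj_on (dec j) ?P" by (rule inj_on_inverseI[of _ "inc j"]) auto
      obtain A' c' where A': "finite A'" "wn (k + r) A' c' \<le> wn (Suc (k + r)) A c"
        "\<And>\<phi>. (\<Sum>\<alpha>\<in>A. c \<alpha> * (of_real (sqrt (2 * real (\<alpha> j))) * \<phi> (dec j \<alpha>))) = (\<Sum>\<alpha>\<in>A'. c' \<alpha> * (\<phi> \<alpha> :: complex))"
        by (rule lowering_reindex[OF A, where s="k + r" and c=c and j=j]) blast
      define p where "p \<gamma> = (\<Sum>\<alpha>\<in>A'. c' \<alpha> * mel G \<alpha> \<gamma>)" for \<gamma>
      define b where "b \<gamma> = (\<Sum>\<alpha>\<in>A. c \<alpha> * mel (G' j) \<alpha> \<gamma>)" for \<gamma>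
      have key: "2 * real (Suc (\<gamma> j)) * (cmod (a (inc j \<gamma>)))\<^sup>2 \<le> 2 * (cmod (p \<gamma>))\<^sup>2 + 2 * (cmod (b \<gamma>))\<^sup>2" for \<gamma>
      proof -
        have "of_real (sqrt (2 * real (Suc (\<gamma> j)))) * a (inc j \<gamma>)
           = (\<Sum>\<alpha>\<in>A. c \<alpha> * (of_real (sqrt (2 * real (Suc (\<gamma> j)))) * mel G \<alpha> (inc j \<gamma>)))"
          unfolding a_def sum_distrib_left by (intro sum.cong refl) (simp add: mult_ac del: of_nat_Suc)
        also have "\<dots> = (\<Sum>\<alpha>\<in>A. c \<alpha> * (of_real (sqrt (2 * real (\<alpha> j))) * mel G (dec j \<alpha>) \<gamma>)) + b \<gamma>"
          unfolding mel_inc[OF G'(1) g tame_growth[OF G'(2)]] b_def distrib_left sum.distrib ..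
        also have "\<dots> = p \<gamma> + b \<gamma>"
          unfolding A'(3)[where \<phi>="\<lambda>\<alpha>. mel G \<alpha> \<gamma>"] p_def ..
        finally have "(cmod (of_real (sqrt (2 * real (Suc (\<gamma> j)))) * a (inc j \<gamma>)))\<^sup>2 \<le> 2 * (cmod (p \<gamma>))\<^sup>2 + 2 * (cmod (b \<gamma>))\<^sup>2"
          using cmod_add_power2_le by simp
        then show ?thesis by (simp add: norm_mult power_mult_distrib del: of_nat_Suc)
      qed
      have "(\<Sum>\<beta>\<in>B. lam \<beta> ^ k * (2 * real (\<beta> j)) * (cmod (a \<beta>))\<^sup>2)
         = (\<Sum>\<beta>\<in>?P. lam \<beta> ^ k * (2 * real (\<beta> j)) * (cmod (a \<beta>))\<^sup>2)"
        using B by (intro sum.mono_neutral_right) auto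
      also have "\<dots> = (\<Sum>\<gamma>\<in>?B. lam (inc j \<gamma>) ^ k * (2 * real (Suc (\<gamma> j))) * (cmod (a (inc j \<gamma>)))\<^sup>2)"
        by (subst sum.reindex[OF inj]) (auto intro!: sum.cong)
      also have "\<dots> \<le> (\<Sum>\<gamma>\<in>?B. 3 ^ k * (lam \<gamma> ^ k * (2 * (cmod (p \<gamma>))\<^sup>2 + 2 * (cmod (b \<gamma>))\<^sup>2)))"
      proof (rule sum_mono)
        fix \<gamma>
        have "lam (inc j \<gamma>) ^ k * (2 * real (Suc (\<gamma> j)) * (cmod (a (inc j \<gamma>)))\<^sup>2)
            \<le> (3 * lam \<gamma>) ^ k * (2 * (cmod (p \<gamma>))\<^sup>2 + 2 * (cmod (b \<gamma>))\<^sup>2)"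
          using lam_pos by (intro mult_mono power_mono lam_inc_le key zero_le_power) auto
        then show "lam (inc j \<gamma>) ^ k * (2 * real (Suc (\<gamma> j))) * (cmod (a (inc j \<gamma>)))\<^sup>2
            \<le> 3 ^ k * (lam \<gamma> ^ k * (2 * (cmod (p \<gamma>))\<^sup>2 + 2 * (cmod (b \<gamma>))\<^sup>2))"
          by (simp add: power_mult_distrib mult.assoc del: of_nat_Suc)
      qed
      also have "\<dots> = 3 ^ k * (2 * ((\<Sum>\<gamma>\<in>?B. lam \<gamma> ^ k * (cmod (p \<gamma>))\<^sup>2) + (\<Sum>\<gamma>\<in>?B. lam \<gamma> ^ k * (cmod (b \<gamma>))\<^sup>2)))"
        unfolding sum.distrib[symmetric] sum_distrib_left by (intro sum.cong refl) (simp add: algebra_simps)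
      also have "\<dots> \<le> 3 ^ k * (2 * (K1 * W + K2 j * W))"
      proof (intro mult_left_mono add_mono)
        have "(\<Sum>\<gamma>\<in>?B. lam \<gamma> ^ k * (cmod (p \<gamma>))\<^sup>2) \<le> K1 * wn (k + r) A' c'"
          unfolding p_def using B A' by (intro K1(2)) auto
        also have "\<dots> \<le> K1 * W" unfolding W_def using A'(2) K1(1) by (intro mult_left_mono) auto
        finally show "(\<Sum>\<gamma>\<in>?B. lam \<gamma> ^ k * (cmod (p \<gamma>))\<^sup>2) \<le> K1 * W" .
        show "(\<Sum>\<gamma>\<in>?B. lam \<gamma> ^ k * (cmod (b \<gamma>))\<^sup>2) \<le> K2 j * W"
          unfolding b_def W_def using B K2(2)[OF A, of ?B c j] by simp
      qed auto
      finally show ?thesis by (simp add: algebra_simps)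
    qed
    have origin: "(cmod (a (\<lambda>_. 0)))\<^sup>2 \<le> K1 * W"
    proof -
      have "1 * (cmod (a (\<lambda>_. 0)))\<^sup>2 \<le> lam (\<lambda>_::'n. 0) ^ k * (cmod (a (\<lambda>_. 0)))\<^sup>2"
        by (intro mult_right_mono one_le_power lam_ge_1) auto
      also have "\<dots> \<le> K1 * wn (k + r) A c"
        using K1(2)[OF A, of "{\<lambda>_. 0}" c] by (simp add: a_def)
      also have "\<dots> \<le> K1 * W"
        unfolding W_def by (intro mult_left_mono wn_mono K1(1)) auto
      finally show ?thesis by simp
    qed
    have term_le: "lam \<beta> ^ Suc k * (cmod (a \<beta>))\<^sup>2 \<le> (if \<beta> = (\<lambda>_. 0) then ?n ^ Suc k * (cmod (a (\<lambda>_. 0)))\<^sup>2 else 0)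
       + (?n + 1) * (\<Sum>j\<in>UNIV. lam \<beta> ^ k * (2 * real (\<beta> j)) * (cmod (a \<beta>))\<^sup>2)" for \<beta>
    proof (cases "\<beta> = (\<lambda>_. 0)")
      case True
      then show ?thesis by (simp add: hermite_eigenvalue_def)
    next
      case False
      have "lam \<beta> * (lam \<beta> ^ k * (cmod (a \<beta>))\<^sup>2) \<le> ((?n + 1) * (\<Sum>j\<in>UNIV. 2 * real (\<beta> j))) * (lam \<beta> ^ k * (cmod (a \<beta>))\<^sup>2)"
        by (intro mult_right_mono lam_le_sum_coords[OF False] mult_nonneg_nonneg zero_le_power lam_pos(2)) auto
      also have "\<dots> = (?n + 1) * (\<Sum>j\<in>UNIV. lam \<beta> ^ k * (2 * real (\<beta> j)) * (cmod (a \<beta>))\<^sup>2)"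
        by (simp add: sum_distrib_right sum_distrib_left algebra_simps)
      finally show ?thesis using False by (simp add: mult_ac)
    qed
    have "(\<Sum>\<beta>\<in>B. lam \<beta> ^ Suc k * (cmod (a \<beta>))\<^sup>2)
       \<le> (\<Sum>\<beta>\<in>B. if \<beta> = (\<lambda>_. 0) then ?n ^ Suc k * (cmod (a (\<lambda>_. 0)))\<^sup>2 else 0)
         + (?n + 1) * (\<Sum>j\<in>UNIV. \<Sum>\<beta>\<in>B. lam \<beta> ^ k * (2 * real (\<beta> j)) * (cmod (a \<beta>))\<^sup>2)"
      by (subst sum.swap, unfold sum_distrib_left[of "?n + 1"] sum.distrib[symmetric], rule sum_mono)
         (use term_le in \<open>simp only: sum_distrib_left\<close>)
    also have "\<dots> \<le> ?n ^ Suc k * (K1 * W) + (?n + 1) * (\<Sum>j\<in>UNIV. 3 ^ k * (2 * (K1 + K2 j)) * W)"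
    proof (intro add_mono mult_left_mono sum_mono dir)
      have "(\<Sum>\<beta>\<in>B. if \<beta> = (\<lambda>_. 0) then ?n ^ Suc k * (cmod (a (\<lambda>_. 0)))\<^sup>2 else 0) \<le> ?n ^ Suc k * (cmod (a (\<lambda>_. 0)))\<^sup>2"
        using B by (simp add: sum.delta)
      also have "\<dots> \<le> ?n ^ Suc k * (K1 * W)" by (intro mult_left_mono origin) auto
      finally show "(\<Sum>\<beta>\<in>B. if \<beta> = (\<lambda>_. 0) then ?n ^ Suc k * (cmod (a (\<lambda>_. 0)))\<^sup>2 else 0) \<le> ?n ^ Suc k * (K1 * W)" .
    qed auto
    also have "\<dots> = ?K * W" by (simp add: algebra_simps sum_distrib_left sum_distrib_right)
    finally show ?thesis unfolding a_def W_def .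
  qed
  moreover have "0 \<le> ?K" using K1(1) K2(1) by (intro add_nonneg_nonneg mult_nonneg_nonneg sum_nonneg) auto
  ultimately show ?case by blast
qed

text \<open>Passage to arbitrary elements of the Sobolev space: truncate the Hermite expansion; the
  coefficients of the product converge because \<open>m\<close> is bounded.\<close>

theorem multiplication_bounded_sobolev:
  fixes m :: "real^'n::finite \<Rightarrow> complex"
  assumes "tame k 0 m"
  obtains K where "0 \<le> K" "\<And>f. sqint lebesgue f \<Longrightarrow> sqint lebesgue (\<lambda>x. m x * f x)"
    "\<And>f B. sqint lebesgue f \<Longrightarrow> (\<lambda>\<alpha>. lam \<alpha> ^ k * (cmod (hc f \<alpha>))\<^sup>2) summable_on UNIV \<Longrightarrow> finite B \<Longrightarrow>
       (\<Sum>\<beta>\<in>B. lam \<beta> ^ k * (cmod (hc (\<lambda>x. m x * f x) \<beta>))\<^sup>2) \<le> K * (\<Sum>\<^sub>\<infinity>\<alpha>. lam \<alpha> ^ k * (cmod (hc f \<alpha>))\<^sup>2)"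
proof -
  have g: "growth 0 m" using assms by (rule tame_growth)
  obtain C where C: "AE x in lebesgue. cmod (m x) \<le> C" and mm: "m \<in> borel_measurable lebesgue"
    using g unfolding growth_def by auto
  have bd: "AE x in lebesgue. cmod (m x * f x) \<le> C * cmod (f x)" for f
    using C by eventually_elim (simp add: norm_mult mult_right_mono)
  have sq: "sqint lebesgue (\<lambda>x. m x * f x)" "nsq lebesgue (\<lambda>x. m x * f x) \<le> C\<^sup>2 * nsq lebesgue f" if "sqint lebesgue f" for f
    by (rule sqint_bound[OF that _ bd]; use mm that in \<open>auto intro: borel_measurable_times simp: sqint_def\<close>)+
  obtain K where K: "0 \<le> K" "\<And>A B c. finite A \<Longrightarrow> finite B \<Longrightarrow>
     (\<Sum>\<beta>\<in>B. lam \<beta> ^ k * (cmod (\<Sum>\<alpha>\<in>A. c \<alpha> * mel m \<alpha> \<beta>))\<^sup>2) \<le> K * wn (k + 0) A c"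
    using multiplication_bound[OF assms] by blast
  show ?thesis
  proof (rule that[OF K(1) sq(1)])
    fix f :: "real^'n \<Rightarrow> complex" and B :: "('n \<Rightarrow> nat) set"
    assume f: "sqint lebesgue f" and sm: "(\<lambda>\<alpha>. lam \<alpha> ^ k * (cmod (hc f \<alpha>))\<^sup>2) summable_on UNIV" and B: "finite B"
    let ?F = "finite_subsets_at_top (UNIV :: ('n \<Rightarrow> nat) set)"
    let ?S = "\<Sum>\<^sub>\<infinity>\<alpha>. lam \<alpha> ^ k * (cmod (hc f \<alpha>))\<^sup>2"
    have e: "lc A (hc f) = (\<lambda>x. \<Sum>\<alpha>\<in>A. hc f \<alpha> * hermite_fun \<alpha> x)" for A by (auto simp: lc_def)
    have lim: "((\<lambda>A. nsq lebesgue (\<lambda>x. m x * f x - m x * lc A (hc f) x)) \<longlongrightarrow> 0) ?F"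
    proof (rule tendsto_sandwich[where f="\<lambda>_. 0" and h="\<lambda>A. C\<^sup>2 * nsq lebesgue (\<lambda>x. f x - lc A (hc f) x)"])
      have "((\<lambda>A. C\<^sup>2 * nsq lebesgue (\<lambda>x. f x - lc A (hc f) x)) \<longlongrightarrow> C\<^sup>2 * 0) ?F"
        unfolding e by (intro tendsto_mult tendsto_const hermite_expansion_tendsto[OF f])
      then show "((\<lambda>A. C\<^sup>2 * nsq lebesgue (\<lambda>x. f x - lc A (hc f) x)) \<longlongrightarrow> 0) ?F" by simp
      show "\<forall>\<^sub>F A in ?F. nsq lebesgue (\<lambda>x. m x * f x - m x * lc A (hc f) x) \<le> C\<^sup>2 * nsq lebesgue (\<lambda>x. f x - lc A (hc f) x)"
        unfolding right_diff_distrib[symmetric] by (intro always_eventually allI sq(2) sqint_diff f sqint_lc)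
    qed auto
    have "((\<lambda>A. \<Sum>\<beta>\<in>B. lam \<beta> ^ k * (cmod (hc (\<lambda>x. m x * lc A (hc f) x) \<beta>))\<^sup>2)
        \<longlongrightarrow> (\<Sum>\<beta>\<in>B. lam \<beta> ^ k * (cmod (hc (\<lambda>x. m x * f x) \<beta>))\<^sup>2)) ?F"
      unfolding hc_def[of "\<lambda>x. m x * _ x"]
      by (intro tendsto_intros tendsto_ip[OF sq(1)[OF f] sq(1)[OF sqint_lc] sqint_hermite_fun lim])
    then show "(\<Sum>\<beta>\<in>B. lam \<beta> ^ k * (cmod (hc (\<lambda>x. m x * f x) \<beta>))\<^sup>2) \<le> K * ?S"
    proof (rule tendsto_upperbound)
      show "\<forall>\<^sub>F A in ?F. (\<Sum>\<beta>\<in>B. lam \<beta> ^ k * (cmod (hc (\<lambda>x. m x * lc A (hc f) x) \<beta>))\<^sup>2) \<le> K * ?S"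
      proof (rule eventually_finite_subsets_at_top_weakI)
        fix A :: "('n \<Rightarrow> nat) set" assume A: "finite A"
        have "(\<Sum>\<beta>\<in>B. lam \<beta> ^ k * (cmod (hc (\<lambda>x. m x * lc A (hc f) x) \<beta>))\<^sup>2) \<le> K * wn (k + 0) A (hc f)"
          unfolding hc_mult_lc[OF g] by (rule K(2)[OF A B])
        also have "\<dots> \<le> K * ?S"
          unfolding wn_def add_0_right
          by (intro mult_left_mono K(1) finite_sum_le_infsum[OF sm A] mult_nonneg_nonneg zero_le_power lam_pos(2)) auto
        finally show "(\<Sum>\<beta>\<in>B. lam \<beta> ^ k * (cmod (hc (\<lambda>x. m x * lc A (hc f) x) \<beta>))\<^sup>2) \<le> K * ?S" .
      qed
    qed simp
  qed
qed

text \<open>The weak derivatives of \<open>m\<close> of orders \<open>js\<close> and \<open>js @ [j]\<close> form a weak pair in direction \<open>j\<close>, because the partial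
  derivative of a test function is a test function. The function \<open>m\<close> itself is replaced by its bounded
  weak derivative of order zero.\<close>

lemma tame_of_L_infty:
  assumes "m \<in> L_infty k"
  obtains m' where "tame k 0 m'" "AE x in lebesgue. m x = m' x" "m \<in> borel_measurable lebesgue"
proof -
  obtain C where "\<forall>js. length js \<le> k \<longrightarrow> (\<exists>g. weak_deriv js m g \<and> (AE x in lebesgue. cmod (g x) \<le> C * (1 + norm x) ^ length js))"
    using assms unfolding L_infty_def by blast
  then obtain g where g: "\<And>js. length js \<le> k \<Longrightarrow> weak_deriv js m (g js)"
      "\<And>js. length js \<le> k \<Longrightarrow> AE x in lebesgue. cmod (g js x) \<le> C * (1 + norm x) ^ length js"
    by metis
  have gr: "growth (length js) (g js)" if "length js \<le> k" for js
    using g[OF that] unfolding growth_def weak_deriv_def locally_integrable_def by blast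
  have test: "partial_deriv j \<psi> \<in> test_functions" if \<psi>: "\<psi> \<in> test_functions" for j and \<psi> :: "real^'a \<Rightarrow> complex"
  proof -
    obtain K where s: "smooth \<psi>" and K: "compact K" "\<And>x. x \<notin> K \<Longrightarrow> \<psi> x = 0"
      using \<psi> unfolding test_functions_def by blast
    have "iter_partial js (partial_deriv j \<psi>) = iter_partial (js @ [j]) \<psi>" for js
      by (induction js) auto
    then have "smooth (partial_deriv j \<psi>)" using s unfolding smooth_def by metis
    moreover have "partial_deriv j \<psi> x = 0" if x: "x \<notin> K" for x
    proof -
      let ?S = "(\<lambda>t::real. x + t *\<^sub>R axis j 1) -` (- K)"
      have "open (- K)" by (intro open_Compl compact_imp_closed K(1))
      then have "open ?S" by (rule open_vimage) (intro continuous_intros)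
      then have "((\<lambda>t. \<psi> (x + t *\<^sub>R axis j 1)) has_vector_derivative 0) (at 0)"
        by (rule has_vector_derivative_transform_within_open[of "\<lambda>_. 0", rotated]) (use x K(2) in auto)
      then show ?thesis unfolding partial_deriv_def by (rule vector_derivative_at)
    qed
    ultimately show ?thesis using K(1) unfolding test_functions_def by blast
  qed
  have wp: "wpair j (g js) (g (js @ [j]))" if "Suc (length js) \<le> k" for j js
    unfolding wpair_def
  proof
    fix \<psi> :: "real^'a \<Rightarrow> complex" assume \<psi>: "\<psi> \<in> test_functions"
    have it: "iter_partial js (partial_deriv j \<psi>) = iter_partial (js @ [j]) \<psi>"
      by (induction js) auto
    have 1: "(LINT x|lebesgue. m x * iter_partial (js @ [j]) \<psi> x) = (-1) ^ length js * (LINT x|lebesgue. g js x * partial_deriv j \<psi> x)"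
      using g(1)[of js] that test[OF \<psi>, of j] unfolding weak_deriv_def it[symmetric] by auto
    have 2: "(LINT x|lebesgue. m x * iter_partial (js @ [j]) \<psi> x) = (-1) ^ Suc (length js) * (LINT x|lebesgue. g (js @ [j]) x * \<psi> x)"
      using g(1)[of "js @ [j]"] that \<psi> unfolding weak_deriv_def by auto
    have "(-1) ^ length js * (LINT x|lebesgue. g js x * partial_deriv j \<psi> x)
       = (-1) ^ length js * (- (LINT x|lebesgue. g (js @ [j]) x * \<psi> x))"
      using 1 2 by simp
    then show "(LINT x|lebesgue. g js x * partial_deriv j \<psi> x) = - (LINT x|lebesgue. g (js @ [j]) x * \<psi> x)"
      by (simp only: mult_cancel_left) auto
  qed
  have "length js + l \<le> k \<Longrightarrow> tame l (length js) (g js)" for l js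
  proof (induction l arbitrary: js)
    case 0 then show ?case using gr by simp
  next
    case (Suc l)
    have "\<exists>G'. wpair j (g js) G' \<and> tame l (Suc (length js)) G'" for j
      using wp[of js j] Suc.IH[of "js @ [j]"] Suc.prems by (intro exI[of _ "g (js @ [j])"]) auto
    then show ?case using gr Suc.prems by simp
  qed
  from this[of "[]" k] have "tame k 0 (g [])" by simp
  moreover have wd: "weak_deriv [] m (g [])" by (rule g) simp
  then have "m \<in> borel_measurable lebesgue" by (auto simp: weak_deriv_def locally_integrable_def)
  ultimately show ?thesis using that AE_eq_of_weak_deriv_Nil[OF wd] by blast
qed

section \<open>The Bargmann transform of Hermite functions\<close>

text \<open>The Bargmann kernel splits into \<open>bconst z\<close> and a factor \<open>ker z\<close> that is square integrable in the real variable.\<close>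

definition ker :: "complex^'n::finite \<Rightarrow> real^'n \<Rightarrow> complex" where
  "ker z u = of_real (exp (- (norm u)\<^sup>2 / 2)) * exp (cdot (cvec u) z)"

definition bconst :: "complex^'n::finite \<Rightarrow> complex" where
  "bconst z = of_real (pi powr (- real CARD('n) / 4)) * exp (- cdot z z / 4)"

lemma continuous_on_cvec [continuous_intros]: "continuous_on S cvec"
  unfolding cvec_def by (intro continuous_intros)

lemma continuous_on_cdot [continuous_intros]:
  "continuous_on S f \<Longrightarrow> continuous_on S g \<Longrightarrow> continuous_on S (\<lambda>x. cdot (f x) (g x))"
  unfolding cdot_def by (intro continuous_intros)

lemma continuous_on_ker: "continuous_on S (ker z)"
  unfolding ker_def by (intro continuous_intros) auto

lemma ker_measurable [measurable]: "ker z \<in> borel_measurable borel"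
  by (rule borel_measurable_continuous_onI[OF continuous_on_ker])

lemma slow_exp_cdot: "slow (\<lambda>u::real^'n::finite. exp (cdot (cvec u) z))"
proof (rule slow_mono[OF slow_exp_norm[of "\<Sum>j\<in>UNIV. cmod (z $ j)"]])
  fix u :: "real^'n"
  have "Re (cdot (cvec u) z) \<le> cmod (cdot (cvec u) z)" by (rule complex_Re_le_cmod)
  also have "\<dots> \<le> (\<Sum>j\<in>UNIV. cmod (cvec u $ j * z $ j))" unfolding cdot_def by (rule norm_sum)
  also have "\<dots> \<le> (\<Sum>j\<in>UNIV. norm u * cmod (z $ j))"
    by (intro sum_mono) (auto simp: norm_mult cvec_def intro!: mult_right_mono component_le_norm_cart)
  finally show "norm (exp (cdot (cvec u) z)) \<le> norm (exp ((\<Sum>j\<in>UNIV. cmod (z $ j)) * norm u))"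
    by (simp add: sum_distrib_left mult.commute)
qed

lemma gdec_ker: "gdec (ker z)"
proof (rule gdec_slow[OF slow_exp_cdot gdec_gaussian[of "1/2"]])
  show "norm (ker z u) \<le> norm (exp (cdot (cvec u) z)) * norm (exp (- (1/2) * (norm u)\<^sup>2))" for u
    by (simp add: ker_def norm_mult)
qed simp

lemma sqint_ker: "sqint lebesgue (\<lambda>u. cnj (ker z u))"
  by (intro sqint_cnj sqint_gdec gdec_ker ker_measurable)

lemma bargmann_eq_ip: "bargmann f z = bconst z * ip lebesgue f (\<lambda>u. cnj (ker z u))"
  by (simp add: bargmann_def bconst_def ip_def ker_def mult.assoc)

lemma bargmann_add:
  "sqint lebesgue f \<Longrightarrow> sqint lebesgue g \<Longrightarrow> bargmann (\<lambda>x. f x + g x) z = bargmann f z + bargmann g z"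
  by (simp add: bargmann_eq_ip ip_add_left sqint_ker distrib_left)

lemma bargmann_scale: "bargmann (\<lambda>x. c * f x) z = c * bargmann f z"
  by (simp add: bargmann_eq_ip ip_scale_left)

lemma bargmann_cong_AE:
  "sqint lebesgue f \<Longrightarrow> sqint lebesgue g \<Longrightarrow> AE x in lebesgue. f x = g x \<Longrightarrow> bargmann f = bargmann g"
  by (rule ext, unfold bargmann_eq_ip, rule arg_cong[where f="(*) _"], rule ip_cong_AE[OF _ _ sqint_ker])

lemma ker_has_vector_derivative:
  "((\<lambda>t. ker z (u + t *\<^sub>R axis j 1)) has_vector_derivative (z $ j - of_real (u $ j)) * ker z u) (at 0)"
proof -
  define E where "E = - of_real ((norm u)\<^sup>2 / 2) + cdot (cvec u) z"
  define a where "a = z $ j - of_real (u $ j)"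
  have E: "ker z u = exp E" 
    unfolding ker_def E_def exp_of_real[symmetric] mult_exp_exp by (rule arg_cong[where f=exp]) simp
  have k: "ker z (u + t *\<^sub>R axis j 1) = exp (E + of_real t * a - (of_real t)\<^sup>2 / 2)" for t
  proof -
    have n: "(norm (u + t *\<^sub>R axis j 1))\<^sup>2 = (norm u)\<^sup>2 + 2 * t * u $ j + t\<^sup>2"
      unfolding power2_norm_eq_inner
      by (simp add: inner_add_left inner_add_right inner_axis inner_axis' power2_eq_square algebra_simps)
    have c: "cdot (cvec (u + t *\<^sub>R axis j 1)) z = cdot (cvec u) z + of_real t * z $ j"
      by (simp add: cdot_def cvec_def axis_def distrib_right sum.distrib if_distrib[of "\<lambda>a. a * _"]
          if_distrib[of "\<lambda>a. _ * a"] if_distrib[of complex_of_real] cong: if_cong)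
    show ?thesis unfolding ker_def n c exp_of_real[symmetric] mult_exp_exp E_def a_def
      by (rule arg_cong[where f=exp]) (simp add: field_simps)
  qed
  have "((\<lambda>t. exp (E + t * a - t\<^sup>2 / 2)) has_field_derivative exp E * a) (at (complex_of_real 0))"
    by (auto intro!: derivative_eq_intros)
  then have "((\<lambda>t. exp (E + of_real t * a - (of_real t)\<^sup>2 / 2)) has_vector_derivative exp E * a) (at 0)"
    by (rule has_vector_derivative_real_field)
  then show ?thesis unfolding k E a_def by (simp add: mult.commute)
qed

text \<open>The creation operator becomes multiplication by \<open>z $ j\<close>: integrate by parts and use
  \<open>(x\<^sub>j + \<partial>\<^sub>j) ker z = z\<^sub>j ker z\<close>.\<close>

lemma bargmann_hermite_inc:
  "of_real (sqrt (2 * real (Suc (\<alpha> j)))) * bargmann (hermite_fun (inc j \<alpha>)) z = z $ j * bargmann (hermite_fun \<alpha>) z"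
proof -
  let ?s = "complex_of_real (sqrt (2 * real (Suc (\<alpha> j))))"
  let ?f' = "\<lambda>u. z $ j * (hermite_fun \<alpha> u * ker z u) - ?s * (hermite_fun (inc j \<alpha>) u * ker z u)"
  have g: "gdec (\<lambda>u. hermite_fun \<beta> u * ker z u)" for \<beta> by (intro gdec_mult gdec_hermite_fun gdec_ker)
  have m [measurable]: "(\<lambda>u. hermite_fun \<beta> u * ker z u) \<in> borel_measurable borel" for \<beta> by measurable
  have i: "integrable lborel (\<lambda>u. hermite_fun \<beta> u * ker z u)" for \<beta>
    by (rule integrable_gdec[OF g m])
  have ci: "continuous_on UNIV (hermite_fun \<beta>)" for \<beta> :: "'a \<Rightarrow> nat"
    unfolding hermite_fun_eq_hr[abs_def] by (intro continuous_on_of_real sm_continuous sm_hr)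
  have "(LINT u|lborel. ?f' u) = 0"
  proof (rule integral_directional_derivative_zero)
    fix u :: "real^'a"
    have r: "complex_of_real (rpd j (hr \<alpha>) u) = of_real (u $ j) * hermite_fun \<alpha> u - ?s * hermite_fun (inc j \<alpha>) u"
      using hr_raise[of u j \<alpha>] unfolding hermite_fun_eq_hr by (simp add: algebra_simps flip: of_real_mult of_real_diff del: of_nat_Suc)
    have h: "((\<lambda>t. hermite_fun \<alpha> (u + t *\<^sub>R axis j 1)) has_vector_derivative of_real (rpd j (hr \<alpha>) u)) (at 0)"
      unfolding hermite_fun_eq_hr by (rule has_vector_derivative_of_real[OF DERIV_rpd[OF sm_hr]])
    have "((\<lambda>t. hermite_fun \<alpha> (u + t *\<^sub>R axis j 1) * ker z (u + t *\<^sub>R axis j 1)) has_vector_derivative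
       hermite_fun \<alpha> (u + 0 *\<^sub>R axis j 1) * ((z $ j - of_real (u $ j)) * ker z u) + of_real (rpd j (hr \<alpha>) u) * ker z (u + 0 *\<^sub>R axis j 1)) (at 0)"
      by (rule has_vector_derivative_mult[OF h ker_has_vector_derivative])
    then show "((\<lambda>t. hermite_fun \<alpha> (u + t *\<^sub>R axis j 1) * ker z (u + t *\<^sub>R axis j 1)) has_vector_derivative ?f' u) (at 0)"
      unfolding r by (simp add: algebra_simps del: of_nat_Suc)
  next
    show "continuous_on UNIV ?f'" by (intro continuous_intros ci continuous_on_ker)
    show "integrable lborel (\<lambda>u. hermite_fun \<alpha> u * ker z u)" by (rule i)
    show "integrable lborel ?f'" by (intro Bochner_Integration.integrable_diff integrable_mult_right i)
  qed
  then have "z $ j * (LINT u|lborel. hermite_fun \<alpha> u * ker z u) = ?s * (LINT u|lborel. hermite_fun (inc j \<alpha>) u * ker z u)"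
    by (simp add: i del: of_nat_Suc)
  moreover have "bargmann (hermite_fun \<beta>) z = bconst z * (LINT u|lborel. hermite_fun \<beta> u * ker z u)" for \<beta>
    unfolding bargmann_eq_ip ip_def complex_cnj_cnj by (subst integral_completion) auto
  ultimately show ?thesis by (simp only: mult.left_commute)
qed

lemma sum_Basis_vec: "(\<Sum>b\<in>(Basis :: (real^'n::finite) set). f b) = (\<Sum>j\<in>UNIV. f (axis j 1))"
proof -
  have B: "(Basis :: (real^'n) set) = range (\<lambda>j. axis j 1)" by (auto simp: Basis_vec_def)
  show ?thesis unfolding B by (subst sum.reindex) (auto simp: inj_on_def axis_eq_axis)
qed

lemma bargmann_hermite_0: "bargmann (hermite_fun (\<lambda>_. 0)) z = 1" for z :: "complex^'n::finite"
proof -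
  let ?n = "CARD('n)"
  let ?c = "(1 / sqrt (sqrt pi)) ^ ?n"
  have 1: "hermite_fun (\<lambda>_. 0) u * ker z u = of_real ?c * (of_real (exp (- (norm u)\<^sup>2)) * exp (\<Sum>b\<in>Basis. of_real (u \<bullet> b) * cdot (cvec b) z))" for u
  proof -
    have "(\<Sum>b\<in>Basis. of_real (u \<bullet> b) * cdot (cvec b) z) = cdot (cvec u) z"
      unfolding sum_Basis_vec
      by (simp add: cdot_def cvec_def axis_def inner_axis[unfolded axis_def] if_distrib[of "\<lambda>a. a * _"] if_distrib[of complex_of_real] cong: if_cong)
    moreover have "exp (- (norm u)\<^sup>2) = exp (- (1/2) * (norm u)\<^sup>2) * exp (- (norm u)\<^sup>2 / 2)"
      unfolding mult_exp_exp by simp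
    ultimately show ?thesis unfolding hermite_fun_eq_hr hr_0 ker_def by (simp add: mult_ac)
  qed
  have 2: "(\<Sum>b\<in>(Basis::(real^'n) set). (cdot (cvec b) z)\<^sup>2) = cdot z z"
    unfolding sum_Basis_vec
    by (simp add: cdot_def cvec_def axis_def if_distrib[of "\<lambda>a. a * _"] if_distrib[of complex_of_real] power2_eq_square cong: if_cong)
  have "bargmann (hermite_fun (\<lambda>_. 0)) z = bconst z * (LINT u|lborel. hermite_fun (\<lambda>_. 0) u * ker z u)"
    unfolding bargmann_eq_ip ip_def complex_cnj_cnj by (subst integral_completion) auto
  also have "(LINT u|lborel. hermite_fun (\<lambda>_. 0) u * ker z u) = of_real ?c * (of_real (sqrt pi ^ DIM(real^'n)) * exp (cdot z z / 4))"
    using has_bochner_integral_gaussian_euclidean[of "\<lambda>b. cdot (cvec b) z"]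
    unfolding 1 2 by (simp add: has_bochner_integral_iff)
  also have "bconst z * (of_real ?c * (of_real (sqrt pi ^ DIM(real^'n)) * exp (cdot z z / 4)))
     = of_real (pi powr (- real ?n / 4) * (?c * sqrt pi ^ ?n)) * (exp (- cdot z z / 4) * exp (cdot z z / 4))"
    by (simp add: bconst_def mult_ac)
  also have "exp (- cdot z z / 4) * exp (cdot z z / 4) = 1" by (simp flip: exp_add)
  also have "?c * sqrt pi ^ ?n = pi powr (real ?n / 4)"
  proof -
    have q: "sqrt (sqrt pi) = pi powr (1/4)"
      by (simp add: powr_half_sqrt[symmetric] powr_powr)
    have "?c * sqrt pi ^ ?n = (sqrt (sqrt pi)) ^ ?n"
      unfolding power_mult_distrib[symmetric] by (simp add: real_div_sqrt)
    also have "\<dots> = (pi powr (1/4)) powr real ?n"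
      unfolding q by (rule powr_realpow[symmetric]) simp
    finally show ?thesis by (simp add: powr_powr)
  qed
  also have "pi powr (- real ?n / 4) * pi powr (real ?n / 4) = 1" by (simp flip: powr_add)
  finally show ?thesis by simp
qed

definition zmon :: "('n::finite \<Rightarrow> nat) \<Rightarrow> complex^'n \<Rightarrow> complex" where
  "zmon \<alpha> z = (\<Prod>j\<in>UNIV. z $ j ^ \<alpha> j)"

definition znorm :: "('n::finite \<Rightarrow> nat) \<Rightarrow> real" where
  "znorm \<alpha> = (\<Prod>j\<in>UNIV. sqrt (2 ^ \<alpha> j * fact (\<alpha> j)))"

lemma znorm_pos: "0 < znorm \<alpha>" unfolding znorm_def by (intro prod_pos) auto

lemma znorm_inc: "znorm (inc j \<alpha>) = sqrt (2 * real (Suc (\<alpha> j))) * znorm \<alpha>"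
proof -
  have "znorm (inc j \<alpha>) = sqrt (2 ^ Suc (\<alpha> j) * fact (Suc (\<alpha> j))) * (\<Prod>i\<in>UNIV - {j}. sqrt (2 ^ \<alpha> i * fact (\<alpha> i)))"
    unfolding znorm_def by (subst prod.remove[of UNIV j]) (auto intro!: prod.cong)
  also have "sqrt (2 ^ Suc (\<alpha> j) * fact (Suc (\<alpha> j))) = sqrt (2 * real (Suc (\<alpha> j))) * sqrt (2 ^ \<alpha> j * fact (\<alpha> j))"
    by (simp add: algebra_simps flip: real_sqrt_mult)
  finally show ?thesis unfolding znorm_def by (subst prod.remove[of UNIV j]) auto
qed

lemma zmon_remove: "zmon \<alpha> z = z $ j ^ \<alpha> j * (\<Prod>i\<in>UNIV - {j}. z $ i ^ \<alpha> i)"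
  unfolding zmon_def by (subst prod.remove[of UNIV j]) auto

lemma zmon_inc: "zmon (inc j \<alpha>) z = z $ j * zmon \<alpha> z"
  unfolding zmon_remove[of _ _ j] by (auto intro!: prod.cong)

lemma zmon_0 [simp]: "zmon (\<lambda>_. 0) z = 1" by (simp add: zmon_def)

lemma znorm_0 [simp]: "znorm (\<lambda>_. 0) = 1" by (simp add: znorm_def)

lemma zmon_rotate: "zmon \<alpha> (\<omega> *s z) = \<omega> ^ (\<Sum>j\<in>UNIV. \<alpha> j) * zmon \<alpha> z"
  by (simp add: zmon_def power_mult_distrib prod.distrib power_sum)

lemma bargmann_hermite: "bargmann (hermite_fun \<alpha>) z = zmon \<alpha> z / of_real (znorm \<alpha>)"
proof (induction \<alpha> rule: multiindex_induct)
  case zero then show ?case by (simp add: bargmann_hermite_0)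
next
  case (inc \<alpha> j)
  have p: "0 < sqrt (2 * real (Suc (\<alpha> j)))" by simp
  then have nz: "complex_of_real (sqrt (2 * real (Suc (\<alpha> j)))) \<noteq> 0" by (simp del: of_nat_Suc)
  have "of_real (sqrt (2 * real (Suc (\<alpha> j)))) * bargmann (hermite_fun (inc j \<alpha>)) z
     = of_real (sqrt (2 * real (Suc (\<alpha> j)))) * (zmon (inc j \<alpha>) z / of_real (znorm (inc j \<alpha>)))"
    unfolding bargmann_hermite_inc inc zmon_inc znorm_inc using nz by (simp add: field_simps del: of_nat_Suc)
  then show ?case using nz by (simp only: mult_cancel_left) auto
qed

section \<open>Orthonormality of the monomials in the Fock space\<close>

lemma zmon_dec_deriv:
  "((\<lambda>t. zmon \<alpha> (z + t *\<^sub>R axis j \<omega>)) has_vector_derivative \<omega> * of_nat (\<alpha> j) * zmon (dec j \<alpha>) z) (at 0)"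
proof -
  let ?R = "\<Prod>i\<in>UNIV - {j}. z $ i ^ \<alpha> i"
  have e: "zmon \<alpha> (z + t *\<^sub>R axis j \<omega>) = (z $ j + of_real t * \<omega>) ^ \<alpha> j * ?R" for t
  proof -
    have ax: "(z + t *\<^sub>R axis j \<omega>) $ i = z $ i + (if i = j then of_real t * \<omega> else 0)" for i
      by (simp add: axis_def) (simp add: scaleR_conv_of_real)
    show ?thesis
      by (simp only: zmon_remove[of _ _ j] ax) (auto intro!: prod.cong)
  qed
  have d: "zmon (dec j \<alpha>) z = z $ j ^ (\<alpha> j - 1) * ?R"
    unfolding zmon_remove[of _ _ j] by (auto intro!: prod.cong)
  have "((\<lambda>t. (z $ j + t * \<omega>) ^ \<alpha> j * ?R) has_field_derivative of_nat (\<alpha> j) * (z $ j) ^ (\<alpha> j - 1) * \<omega> * ?R) (at (complex_of_real 0))"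
    by (auto intro!: derivative_eq_intros)
  then have "((\<lambda>t. (z $ j + of_real t * \<omega>) ^ \<alpha> j * ?R) has_vector_derivative of_nat (\<alpha> j) * (z $ j) ^ (\<alpha> j - 1) * \<omega> * ?R) (at 0)"
    by (rule has_vector_derivative_real_field)
  then show ?thesis unfolding e d by (simp add: mult_ac)
qed

lemma continuous_on_zmon: "continuous_on S (zmon \<alpha>)"
  unfolding zmon_def[abs_def] by (intro continuous_intros)

lemma slow_zmon: "slow (zmon \<alpha>)"
  unfolding zmon_def[abs_def]
  by (intro slow_prod slow_power slow_bounded_linear bounded_linear_vec_nth)

lemma slow_cnj: "slow f \<Longrightarrow> slow (\<lambda>x. cnj (f x))"
  by (simp add: slow_def)

text \<open>The Gram matrix of the monomials, up to the normalisation of the Gaussian measure.\<close>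

definition fmat :: "('n::finite \<Rightarrow> nat) \<Rightarrow> ('n \<Rightarrow> nat) \<Rightarrow> complex" where
  "fmat \<alpha> \<beta> = (LINT z|lborel. zmon \<alpha> z * cnj (zmon \<beta> z) * of_real (exp (- (1/2) * (norm z)\<^sup>2)))"

lemma gdec_fmat: "slow f \<Longrightarrow> gdec (\<lambda>z. f z * of_real (exp (- (1/2) * (norm z)\<^sup>2)))"
  for f :: "'a::real_normed_vector \<Rightarrow> complex"
  by (rule gdec_slow[OF _ gdec_gaussian[of "1/2"]]) (auto simp: norm_mult)

lemma integrable_fmat:
  fixes f :: "'a::euclidean_space \<Rightarrow> complex"
  assumes "slow f" "continuous_on UNIV f"
  shows "integrable lborel (\<lambda>z. f z * of_real (exp (- (1/2) * (norm z)\<^sup>2)))"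
  by (rule integrable_gdec[OF gdec_fmat[OF assms(1)]])
     (intro borel_measurable_continuous_onI continuous_intros assms(2))

text \<open>Integration by parts along the Wirtinger derivative \<open>\<partial>/\<partial>z\<^sub>j\<close>, which is the combination of the
  directions \<open>axis j 1\<close> and \<open>axis j \<i>\<close> that annihilates \<open>cnj (zmon \<beta> z)\<close>.\<close>

lemma fmat_inc: "fmat \<alpha> (inc j \<beta>) = 2 * of_nat (\<alpha> j) * fmat (dec j \<alpha>) \<beta>"
proof -
  let ?g = "\<lambda>z::complex^'a. complex_of_real (exp (- (1/2) * (norm z)\<^sup>2))"
  define D where "D \<omega> z = (\<omega> * of_nat (\<alpha> j) * zmon (dec j \<alpha>) z * cnj (zmon \<beta> z)
     + zmon \<alpha> z * cnj (\<omega> * of_nat (\<beta> j) * zmon (dec j \<beta>) z)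
     - of_real (Re (cnj \<omega> * z $ j)) * (zmon \<alpha> z * cnj (zmon \<beta> z)))" for \<omega> and z :: "complex^'a"
  have sD: "slow (D \<omega>)" and cD: "continuous_on UNIV (D \<omega>)" for \<omega>
  proof -
    have "bounded_linear (\<lambda>z::complex^'a. Re (cnj \<omega> * z $ j))"
      by (intro bounded_linear_compose[OF bounded_linear_Re] bounded_linear_compose[OF bounded_linear_mult_right] bounded_linear_vec_nth)
    then have l: "slow (\<lambda>z::complex^'a. complex_of_real (Re (cnj \<omega> * z $ j)))"
      by (intro slow_of_real slow_bounded_linear)
    have "slow (\<lambda>z. (\<omega> * of_nat (\<alpha> j) * zmon (dec j \<alpha>) z * cnj (zmon \<beta> z)
     + zmon \<alpha> z * cnj (\<omega> * of_nat (\<beta> j) * zmon (dec j \<beta>) z))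
     + (- 1) * (of_real (Re (cnj \<omega> * z $ j)) * (zmon \<alpha> z * cnj (zmon \<beta> z))))"
      by (intro slow_add slow_mult slow_const slow_cnj slow_zmon l)
    then show "slow (D \<omega>)" by (simp add: D_def[abs_def])
    show "continuous_on UNIV (D \<omega>)" unfolding D_def[abs_def] by (intro continuous_intros continuous_on_zmon)
  qed
  have zero: "(LINT z|lborel. D \<omega> z * ?g z) = 0" if \<omega>: "cmod \<omega> = 1" for \<omega>
  proof (rule integral_directional_derivative_zero[where v="axis j \<omega>"])
    fix z :: "complex^'a"
    have n: "(norm (z + t *\<^sub>R axis j \<omega>))\<^sup>2 = (norm z)\<^sup>2 + 2 * t * Re (cnj \<omega> * z $ j) + t\<^sup>2" for t
    proof -
      have "\<omega> \<bullet> \<omega> = 1" using \<omega> by (simp add: dot_square_norm)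
      moreover have "z $ j \<bullet> \<omega> = Re (cnj \<omega> * z $ j)" by (simp add: inner_complex_def mult.commute)
      moreover have "\<omega> \<bullet> z $ j = Re (cnj \<omega> * z $ j)" by (simp add: inner_complex_def)
      ultimately show ?thesis unfolding power2_norm_eq_inner
        by (simp add: inner_add_left inner_add_right inner_axis inner_axis' power2_eq_square algebra_simps)
    qed
    have "((\<lambda>t. exp (- (1/2) * (norm (z + t *\<^sub>R axis j \<omega>))\<^sup>2)) has_real_derivative - Re (cnj \<omega> * z $ j) * exp (- (1/2) * (norm z)\<^sup>2)) (at 0)"
    proof -
      have "((\<lambda>t. exp (- (1/2) * (A + 2 * t * r + t\<^sup>2))) has_real_derivative - r * exp (- (1/2) * A)) (at 0)" for A r :: real
        by (auto intro!: derivative_eq_intros)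
      then show ?thesis unfolding n .
    qed
    then have 3: "((\<lambda>t. ?g (z + t *\<^sub>R axis j \<omega>)) has_vector_derivative of_real (- Re (cnj \<omega> * z $ j) * exp (- (1/2) * (norm z)\<^sup>2))) (at 0)"
      by (rule has_vector_derivative_of_real)
    have 2: "((\<lambda>t. cnj (zmon \<beta> (z + t *\<^sub>R axis j \<omega>))) has_vector_derivative cnj (\<omega> * of_nat (\<beta> j) * zmon (dec j \<beta>) z)) (at 0)"
      by (rule has_vector_derivative_cnj[OF zmon_dec_deriv])
    show "((\<lambda>t. (zmon \<alpha> (z + t *\<^sub>R axis j \<omega>) * cnj (zmon \<beta> (z + t *\<^sub>R axis j \<omega>))) * ?g (z + t *\<^sub>R axis j \<omega>)) has_vector_derivative D \<omega> z * ?g z) (at 0)"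
      by (rule has_vector_derivative_eq_rhs[OF has_vector_derivative_mult[OF has_vector_derivative_mult[OF zmon_dec_deriv 2] 3]])
         (simp add: D_def algebra_simps)
  next
    show "continuous_on UNIV (\<lambda>z. D \<omega> z * ?g z)" by (intro continuous_intros cD)
    show "integrable lborel (\<lambda>z. D \<omega> z * ?g z)" by (rule integrable_fmat[OF sD cD])
    show "integrable lborel (\<lambda>z. (zmon \<alpha> z * cnj (zmon \<beta> z)) * ?g z)"
      by (rule integrable_fmat) (intro slow_mult slow_zmon slow_cnj continuous_intros continuous_on_zmon)+
  qed
  have i: "integrable lborel (\<lambda>z. (zmon \<gamma> z * cnj (zmon \<delta> z)) * ?g z)" for \<gamma> \<delta>
    by (rule integrable_fmat) (intro slow_mult slow_zmon slow_cnj continuous_intros continuous_on_zmon)+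
  have W: "D 1 z - \<i> * D \<i> z = 2 * of_nat (\<alpha> j) * (zmon (dec j \<alpha>) z * cnj (zmon \<beta> z)) - zmon \<alpha> z * cnj (zmon (inc j \<beta>) z)" for z
  proof -
    have c: "cnj (z $ j) = of_real (Re (z $ j)) - \<i> * of_real (Im (z $ j))" by (simp add: complex_eq_iff)
    show ?thesis unfolding D_def zmon_inc complex_cnj_mult c by (simp add: algebra_simps)
  qed
  have eq: "D 1 z * ?g z - \<i> * (D \<i> z * ?g z) = 2 * of_nat (\<alpha> j) * ((zmon (dec j \<alpha>) z * cnj (zmon \<beta> z)) * ?g z)
      - (zmon \<alpha> z * cnj (zmon (inc j \<beta>) z)) * ?g z" for z
    using arg_cong[OF W[of z], of "\<lambda>w. w * ?g z"] by (simp only: left_diff_distrib mult.assoc)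
  have iD: "integrable lborel (\<lambda>z. D \<omega> z * ?g z)" for \<omega> by (rule integrable_fmat[OF sD cD])
  have "0 = (LINT z|lborel. D 1 z * ?g z) - \<i> * (LINT z|lborel. D \<i> z * ?g z)"
    unfolding zero[OF norm_one] zero[OF norm_ii] by simp
  also have "\<dots> = (LINT z|lborel. D 1 z * ?g z - \<i> * (D \<i> z * ?g z))"
    by (simp only: Bochner_Integration.integral_diff[OF iD integrable_mult_right[OF iD]] integral_mult_right_zero)
  also have "\<dots> = 2 * of_nat (\<alpha> j) * fmat (dec j \<alpha>) \<beta> - fmat \<alpha> (inc j \<beta>)"
    unfolding eq fmat_def
    by (simp only: Bochner_Integration.integral_diff[OF integrable_mult_right[OF i] i] integral_mult_right_zero)
  finally show ?thesis by simp
qed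

lemma fmat_commute: "fmat \<alpha> \<beta> = cnj (fmat \<beta> \<alpha>)"
  unfolding fmat_def Bochner_Integration.integral_cnj[symmetric] by (simp add: mult_ac)

lemma fmat_0: "fmat (\<lambda>_. 0) (\<lambda>_::'n::finite. 0) = of_real ((2 * pi) ^ CARD('n))"
proof -
  have "fmat (\<lambda>_. 0) (\<lambda>_::'n. 0) = of_real (sqrt (pi / (1/2)) ^ DIM(complex^'n))"
    unfolding fmat_def zmon_0 complex_cnj_one mult_1
    by (subst integral_complex_of_real, subst integral_gaussian) auto
  also have "sqrt (pi / (1/2)) ^ DIM(complex^'n) = (2 * pi) ^ CARD('n)"
    by (simp add: power_mult mult.commute[of _ 2])
  finally show ?thesis .
qed

lemma fmat_eq: "fmat \<alpha> \<beta> = (if \<alpha> = \<beta> then of_real ((2 * pi) ^ CARD('n) * (znorm \<alpha>)\<^sup>2) else 0)"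
  for \<alpha> \<beta> :: "'n::finite \<Rightarrow> nat"
proof (induction \<beta> arbitrary: \<alpha> rule: multiindex_induct)
  case zero
  show ?case
  proof (cases "\<alpha> = (\<lambda>_. 0)")
    case False
    then obtain j where j: "0 < \<alpha> j" by auto
    have "fmat (\<lambda>_. 0) (inc j (dec j \<alpha>)) = 0" unfolding fmat_inc by simp
    then show ?thesis using j False fmat_commute[of \<alpha> "\<lambda>_. 0"] by simp
  qed (simp add: fmat_0)
next
  case (inc \<beta> j)
  show ?case
  proof (cases "\<alpha> j = 0")
    case True
    then have "\<alpha> \<noteq> inc j \<beta>" by auto
    then show ?thesis using True by (simp add: fmat_inc)
  next
    case False
    then have a: "inc j (dec j \<alpha>) = \<alpha>" by simp
    then have iff: "dec j \<alpha> = \<beta> \<longleftrightarrow> \<alpha> = inc j \<beta>" by auto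
    have "(znorm (inc j \<beta>))\<^sup>2 = 2 * real (Suc (\<beta> j)) * (znorm \<beta>)\<^sup>2"
      unfolding znorm_inc by (simp add: power_mult_distrib)
    then show ?thesis unfolding fmat_inc inc iff by (auto simp: iff)
  qed
qed

lemma integral_fock:
  fixes f :: "complex^'n::finite \<Rightarrow> complex"
  assumes "f \<in> borel_measurable borel"
  shows "(LINT z|fock_measure. f z) = of_real ((2 * pi) powr (- real CARD('n))) * (LINT z|lborel. f z * of_real (exp (- (1/2) * (norm z)\<^sup>2)))"
    and "integrable fock_measure f \<longleftrightarrow> integrable lborel (\<lambda>z. f z * of_real (exp (- (1/2) * (norm z)\<^sup>2)))"
proof -
  have e: "((2 * pi) powr (- real CARD('n)) * exp (- (norm z)\<^sup>2 / 2)) *\<^sub>R f z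
      = of_real ((2 * pi) powr (- real CARD('n))) * (f z * of_real (exp (- (1/2) * (norm z)\<^sup>2)))" for z
    by (simp add: scaleR_conv_of_real mult_ac)
  let ?C = "complex_of_real ((2 * pi) powr (- real CARD('n)))"
  let ?h = "\<lambda>z. f z * complex_of_real (exp (- (1/2) * (norm z)\<^sup>2))"
  have fm: "f \<in> borel_measurable lborel" using assms by simp
  have wm: "(\<lambda>z::complex^'n. (2 * pi) powr (- real CARD('n)) * exp (- (norm z)\<^sup>2 / 2)) \<in> borel_measurable lborel"
    by measurable
  have w0: "AE z::complex^'n in lborel. 0 \<le> (2 * pi) powr (- real CARD('n)) * exp (- (norm z)\<^sup>2 / 2)"
    by simp
  show "(LINT z|fock_measure. f z) = ?C * (LINT z|lborel. ?h z)"
    unfolding fock_measure_def integral_density[OF fm wm w0] e by (rule integral_mult_right_zero)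
  have nz: "?C \<noteq> 0" by simp
  have "integrable lborel ?h" if "integrable lborel (\<lambda>z. ?C * ?h z)"
  proof -
    have "inverse ?C * (?C * ?h z) = ?h z" for z using nz by simp
    then show ?thesis using integrable_mult_right[OF that, of "inverse ?C"] by (simp only:)
  qed
  moreover have "integrable lborel (\<lambda>z. ?C * ?h z)" if "integrable lborel ?h"
    using that by (rule integrable_mult_right)
  ultimately show "integrable fock_measure f \<longleftrightarrow> integrable lborel ?h"
    unfolding fock_measure_def integrable_density[OF fm wm w0] e by blast
qed

lemma sets_fock [measurable_cong, simp]: "sets fock_measure = sets borel"
  by (simp add: fock_measure_def)

lemma space_fock [simp]: "space fock_measure = UNIV"
  by (simp add: fock_measure_def)

lemma zmon_measurable [measurable]: "zmon \<alpha> \<in> borel_measurable borel"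
  by (rule borel_measurable_continuous_onI[OF continuous_on_zmon])

text \<open>The phase \<open>\<omega>\<^bsup>|\<alpha>|\<^esup>\<close> is carried along to treat the rotated transform
  \<open>z \<mapsto> bargmann f (\<omega> z)\<close> at the same time.\<close>

definition zbasis :: "complex \<Rightarrow> ('n::finite \<Rightarrow> nat) \<Rightarrow> complex^'n \<Rightarrow> complex" where
  "zbasis \<omega> \<alpha> z = zmon \<alpha> (\<omega> *s z) / of_real (znorm \<alpha>)"

lemma zbasis_eq: "zbasis \<omega> \<alpha> z = (\<omega> ^ (\<Sum>j\<in>UNIV. \<alpha> j) / of_real (znorm \<alpha>)) * zmon \<alpha> z"
  by (simp add: zbasis_def zmon_rotate)

lemma orthonormal_zbasis:
  assumes "cmod \<omega> = 1"
  shows "orthonormal fock_measure (zbasis \<omega> :: ('n::finite \<Rightarrow> nat) \<Rightarrow> _)"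
proof -
  have m [measurable]: "zbasis \<omega> \<alpha> \<in> borel_measurable borel" for \<alpha> :: "'n \<Rightarrow> nat"
    unfolding zbasis_eq[abs_def] by measurable
  define c where "c \<alpha> = \<omega> ^ (\<Sum>j\<in>UNIV. \<alpha> j) / of_real (znorm \<alpha>)" for \<alpha> :: "'n \<Rightarrow> nat"
  have ip: "ip fock_measure (zbasis \<omega> \<alpha>) (zbasis \<omega> \<beta>) = (if \<alpha> = \<beta> then 1 else 0)" for \<alpha> \<beta> :: "'n \<Rightarrow> nat"
  proof -
    have cc: "c \<alpha> * cnj (c \<alpha>) * of_real ((znorm \<alpha>)\<^sup>2) = 1"
    proof -
      have "cmod (c \<alpha>) * znorm \<alpha> = 1" using znorm_pos[of \<alpha>] assms by (simp add: c_def norm_divide norm_power)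
      then have "(cmod (c \<alpha>))\<^sup>2 * (znorm \<alpha>)\<^sup>2 = 1" by (metis power_mult_distrib power_one)
      then show ?thesis unfolding complex_norm_square[symmetric] by (metis of_real_1 of_real_mult)
    qed
    have pw: "(2 * pi) powr (- real CARD('n)) * (2 * pi) ^ CARD('n) = 1"
      by (simp add: powr_minus powr_realpow field_simps)
    have "ip fock_measure (zbasis \<omega> \<alpha>) (zbasis \<omega> \<beta>) = of_real ((2 * pi) powr (- real CARD('n))) *
       (LINT z|lborel. (c \<alpha> * cnj (c \<beta>)) * (zmon \<alpha> z * cnj (zmon \<beta> z) * of_real (exp (- (1/2) * (norm z)\<^sup>2))))"
      unfolding ip_def zbasis_eq c_def[symmetric]
      by (subst integral_fock)
         (auto intro!: borel_measurable_continuous_onI continuous_intros continuous_on_zmon simp: mult_ac)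
    also have "\<dots> = of_real ((2 * pi) powr (- real CARD('n))) * (c \<alpha> * cnj (c \<beta>)) * fmat \<alpha> \<beta>"
      unfolding integral_mult_right_zero fmat_def by simp
    also have "\<dots> = (if \<alpha> = \<beta> then 1 else 0)"
    proof (cases "\<alpha> = \<beta>")
      case True
      have "of_real ((2 * pi) powr (- real CARD('n))) * (c \<alpha> * cnj (c \<beta>)) * fmat \<alpha> \<beta>
         = of_real ((2 * pi) powr (- real CARD('n)) * (2 * pi) ^ CARD('n)) * (c \<alpha> * cnj (c \<alpha>) * of_real ((znorm \<alpha>)\<^sup>2))"
        unfolding fmat_eq True by simp
      then show ?thesis unfolding pw cc using True by simp
    qed (simp add: fmat_eq)
    finally show ?thesis .
  qed
  have "sqint fock_measure (zbasis \<omega> \<alpha>)" for \<alpha> :: "'n \<Rightarrow> nat"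
  proof -
    have s: "slow (zbasis \<omega> \<alpha>)" unfolding zbasis_eq[abs_def] by (intro slow_mult slow_const slow_zmon)
    have "slow (\<lambda>z. complex_of_real ((cmod (zbasis \<omega> \<alpha> z))\<^sup>2))"
      by (intro slow_of_real slow_power) (simp add: slow_norm_iff s)
    moreover have "continuous_on UNIV (\<lambda>z. complex_of_real ((cmod (zbasis \<omega> \<alpha> z))\<^sup>2))"
      unfolding zbasis_eq by (intro continuous_intros continuous_on_zmon)
    ultimately have "integrable fock_measure (\<lambda>z. complex_of_real ((cmod (zbasis \<omega> \<alpha> z))\<^sup>2))"
      by (subst integral_fock(2)) (measurable, rule integrable_fmat)
    then show ?thesis unfolding sqint_def by (simp only: complex_of_real_integrable_eq) simp
  qed
  then show ?thesis using ip by (simp add: orthonormal_def)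
qed

section \<open>Unitarity of the Bargmann transform\<close>

lemma bargmann_lc: "finite A \<Longrightarrow> bargmann (lc A c) (\<omega> *s z) = (\<Sum>\<alpha>\<in>A. c \<alpha> * zbasis \<omega> \<alpha> z)"
proof (induction A rule: finite_induct)
  case empty
  then show ?case by (simp add: lc_def[abs_def] bargmann_eq_ip ip_def)
next
  case (insert \<alpha> A)
  have "lc (insert \<alpha> A) c = (\<lambda>x. c \<alpha> * hermite_fun \<alpha> x + lc A c x)"
    using insert by (auto simp: lc_def)
  then show ?case
    using insert by (simp add: bargmann_add sqint_scale sqint_hermite_fun sqint_lc bargmann_scale bargmann_hermite zbasis_def)
qed

lemma tendsto_bargmann:
  assumes "sqint lebesgue f" "\<And>k. sqint lebesgue (g k)" "((\<lambda>k. nsq lebesgue (\<lambda>x. f x - g k x)) \<longlongrightarrow> 0) F"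
  shows "((\<lambda>k. bargmann (g k) z) \<longlongrightarrow> bargmann f z) F"
  unfolding bargmann_eq_ip by (intro tendsto_mult tendsto_const tendsto_ip assms sqint_ker)

text \<open>The transform is continuous in \<open>f\<close> at each point because its kernel is square integrable.\<close>

lemma bargmann_has_sum:
  assumes f: "sqint lebesgue f"
  shows "((\<lambda>\<alpha>. hc f \<alpha> * zbasis \<omega> \<alpha> z) has_sum bargmann f (\<omega> *s z)) UNIV"
  unfolding has_sum_def
proof (rule Lim_transform_eventually)
  show "((\<lambda>A. bargmann (lc A (hc f)) (\<omega> *s z)) \<longlongrightarrow> bargmann f (\<omega> *s z)) (finite_subsets_at_top UNIV)"
    by (rule tendsto_bargmann[OF f sqint_lc]) (use hermite_expansion_tendsto[OF f] in \<open>simp add: lc_def[abs_def]\<close>)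
  show "\<forall>\<^sub>F A in finite_subsets_at_top UNIV. bargmann (lc A (hc f)) (\<omega> *s z) = (\<Sum>\<alpha>\<in>A. hc f \<alpha> * zbasis \<omega> \<alpha> z)"
    by (rule eventually_finite_subsets_at_top_weakI) (rule bargmann_lc)
qed

lemma nsq_diff_comb:
  assumes e: "orthonormal M e" and "finite A" "finite B"
  shows "nsq M (\<lambda>x. (\<Sum>i\<in>A. c i * e i x) - (\<Sum>i\<in>B. c i * e i x))
    = (\<Sum>i\<in>A \<union> B. (cmod ((if i \<in> A then c i else 0) - (if i \<in> B then c i else 0)))\<^sup>2)"
proof -
  have "(\<Sum>i\<in>A. c i * e i x) - (\<Sum>i\<in>B. c i * e i x)
     = (\<Sum>i\<in>A \<union> B. ((if i \<in> A then c i else 0) - (if i \<in> B then c i else 0)) * e i x)" for x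
  proof -
    have "(\<Sum>i\<in>A. c i * e i x) = (\<Sum>i\<in>A \<union> B. (if i \<in> A then c i else 0) * e i x)"
      using assms by (intro sum.mono_neutral_cong_left) auto
    moreover have "(\<Sum>i\<in>B. c i * e i x) = (\<Sum>i\<in>A \<union> B. (if i \<in> B then c i else 0) * e i x)"
      using assms by (intro sum.mono_neutral_cong_left) auto
    ultimately show ?thesis by (simp add: sum_subtractf left_diff_distrib)
  qed
  then show ?thesis using nsq_comb[OF e, of "A \<union> B"] assms by simp
qed

text \<open>Finite Hermite expansions \<open>f\<^sub>k \<rightarrow> f\<close> have transforms that form a Cauchy sequence in the Fock
  norm and converge pointwise, so Fatou's lemma applies.\<close>

lemma bargmann_isometry:
  fixes f :: "real^'n::finite \<Rightarrow> complex"
  assumes f: "sqint lebesgue f" and \<omega>: "cmod \<omega> = 1"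
  shows "sqint fock_measure (\<lambda>z. bargmann f (\<omega> *s z))"
    and "nsq fock_measure (\<lambda>z. bargmann f (\<omega> *s z)) = nsq lebesgue f"
proof -
  have "\<exists>A. finite A \<and> nsq lebesgue (\<lambda>x. f x - lc A (hc f) x) < 1 / real (Suc k)" for k
  proof -
    have "\<forall>\<^sub>F A in finite_subsets_at_top UNIV. nsq lebesgue (\<lambda>x. f x - (\<Sum>\<alpha>\<in>A. hc f \<alpha> * hermite_fun \<alpha> x)) < 1 / real (Suc k)"
      by (rule order_tendstoD(2)[OF hermite_expansion_tendsto[OF f]]) simp
    then show ?thesis unfolding lc_def by (auto simp: eventually_finite_subsets_at_top)
  qed
  then obtain A where A: "\<And>k. finite (A k)" "\<And>k. nsq lebesgue (\<lambda>x. f x - lc (A k) (hc f) x) < 1 / real (Suc k)"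
    by metis
  define p where "p k = lc (A k) (hc f)" for k
  define g where "g k z = bargmann (p k) (\<omega> *s z)" for k z
  have p: "sqint lebesgue (p k)" for k unfolding p_def by (rule sqint_lc)
  have g: "g k z = (\<Sum>\<alpha>\<in>A k. hc f \<alpha> * zbasis \<omega> \<alpha> z)" for k z
    unfolding g_def p_def by (rule bargmann_lc[OF A(1)])
  note on = orthonormal_zbasis[OF \<omega>, where 'n='n]
  have sg: "sqint fock_measure (g k)" for k
    unfolding g[abs_def] by (rule orthonormal_sqint_comb[OF on])
  have lim: "(\<lambda>k. nsq lebesgue (\<lambda>x. f x - p k x)) \<longlonglongrightarrow> 0"
  proof (rule tendsto_sandwich[where f="\<lambda>_. 0" and h="\<lambda>k. 1 / real (Suc k)"])
    show "\<forall>\<^sub>F k in sequentially. nsq lebesgue (\<lambda>x. f x - p k x) \<le> 1 / real (Suc k)"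
      unfolding p_def using A(2) by (auto intro!: always_eventually less_imp_le)
    show "(\<lambda>k. 1 / real (Suc k)) \<longlonglongrightarrow> 0" by real_asymp
  qed auto
  have same: "nsq fock_measure (\<lambda>z. g l z - g k z) = nsq lebesgue (\<lambda>x. p l x - p k x)" for k l
    unfolding g p_def lc_def
    using nsq_diff_comb[OF on A(1) A(1), of "hc f" l k] nsq_diff_comb[OF orthonormal_hermite_fun A(1) A(1), of "hc f" l k]
    by simp
  have cauchy: "nsq fock_measure (\<lambda>z. g l z - g k z) \<le> 4 / real (Suc k)" if "k \<le> l" for k l
  proof -
    have "nsq lebesgue (\<lambda>x. p l x - p k x) = nsq lebesgue (\<lambda>x. (p l x - f x) + (f x - p k x))" by simp
    also have "\<dots> \<le> 2 * nsq lebesgue (\<lambda>x. p l x - f x) + 2 * nsq lebesgue (\<lambda>x. f x - p k x)"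
      by (intro nsq_add_le sqint_diff p f)
    also have "nsq lebesgue (\<lambda>x. p l x - f x) = nsq lebesgue (\<lambda>x. f x - p l x)" by (rule nsq_minus_commute)
    also have "2 * nsq lebesgue (\<lambda>x. f x - p l x) + 2 * nsq lebesgue (\<lambda>x. f x - p k x) \<le> 2 * (1 / real (Suc l)) + 2 * (1 / real (Suc k))"
      unfolding p_def using A(2)[of l] A(2)[of k] by (intro add_mono mult_left_mono) auto
    also have "\<dots> \<le> 2 * (1 / real (Suc k)) + 2 * (1 / real (Suc k))"
      using that by (intro add_mono mult_left_mono divide_left_mono) auto
    finally show ?thesis unfolding same by simp
  qed
  have pt: "(\<lambda>k. g k z) \<longlonglongrightarrow> bargmann f (\<omega> *s z)" for z
    unfolding g_def by (rule tendsto_bargmann[OF f p lim])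
  have meas: "(\<lambda>z. bargmann f (\<omega> *s z)) \<in> borel_measurable fock_measure"
    by (rule borel_measurable_LIMSEQ_metric[OF _ pt]) (use sg in \<open>auto simp: sqint_def\<close>)
  note L = sqint_limit[OF sg meas _ cauchy]
  show s: "sqint fock_measure (\<lambda>z. bargmann f (\<omega> *s z))" by (rule L(1)) (auto intro!: AE_I2 pt)
  have "(\<lambda>k. nsq fock_measure (\<lambda>z. bargmann f (\<omega> *s z) - g k z)) \<longlonglongrightarrow> 0"
  proof (rule tendsto_sandwich[where f="\<lambda>_. 0" and h="\<lambda>k. 4 / real (Suc k)"])
    show "\<forall>\<^sub>F k in sequentially. nsq fock_measure (\<lambda>z. bargmann f (\<omega> *s z) - g k z) \<le> 4 / real (Suc k)"
      by (intro always_eventually allI L(2)) (auto intro!: AE_I2 pt)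
    show "(\<lambda>k. 4 / real (Suc k)) \<longlonglongrightarrow> 0" by real_asymp
  qed auto
  from tendsto_nsq[OF s sg this] have "(\<lambda>k. nsq fock_measure (g k)) \<longlonglongrightarrow> nsq fock_measure (\<lambda>z. bargmann f (\<omega> *s z))" .
  moreover have "nsq fock_measure (g k) = nsq lebesgue (p k)" for k
    unfolding g[abs_def] p_def lc_def[abs_def] using nsq_comb[OF on A(1)] nsq_comb[OF orthonormal_hermite_fun A(1)] by simp
  moreover have "(\<lambda>k. nsq lebesgue (p k)) \<longlonglongrightarrow> nsq lebesgue f" by (rule tendsto_nsq[OF f p lim])
  ultimately show "nsq fock_measure (\<lambda>z. bargmann f (\<omega> *s z)) = nsq lebesgue f"
    using LIMSEQ_unique by simp
qed

lemma bargmann_unitary: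
  fixes f g :: "real^'n::finite \<Rightarrow> complex"
  assumes f: "sqint lebesgue f" and g: "sqint lebesgue g" and \<omega>: "cmod \<omega> = 1"
  shows "ip fock_measure (\<lambda>z. bargmann f (\<omega> *s z)) (\<lambda>z. bargmann g (\<omega> *s z)) = ip lebesgue f g"
proof (rule ip_eq_of_nsq_eq[where U="\<lambda>f z. bargmann f (\<omega> *s z)", OF f g])
  fix c
  have "(\<lambda>z. bargmann f (\<omega> *s z) + c * bargmann g (\<omega> *s z)) = (\<lambda>z. bargmann (\<lambda>x. f x + c * g x) (\<omega> *s z))"
    by (simp add: bargmann_add[OF f sqint_scale[OF g]] bargmann_scale)
  then show "nsq fock_measure (\<lambda>z. bargmann f (\<omega> *s z) + c * bargmann g (\<omega> *s z)) = nsq lebesgue (\<lambda>x. f x + c * g x)"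
    using bargmann_isometry(2)[OF sqint_add[OF f sqint_scale[OF g]] \<omega>] by simp
qed (intro bargmann_isometry f g \<omega>)+

text \<open>Rotating the argument of the transform multiplies the Hermite coefficients by phases; for
  \<open>\<omega> = \<plusminus>\<i>\<close> this is the Fourier transform.\<close>

lemma bargmann_rotate:
  assumes f: "sqint lebesgue f" and \<omega>: "cmod \<omega> = 1"
  obtains g where "sqint lebesgue g" "\<And>\<alpha>. cmod (hc g \<alpha>) = cmod (hc f \<alpha>)" "\<And>z. bargmann g z = bargmann f (\<omega> *s z)"
proof -
  define a where "a \<alpha> = \<omega> ^ (\<Sum>j\<in>UNIV. \<alpha> j) * hc f \<alpha>" for \<alpha>
  have a: "cmod (a \<alpha>) = cmod (hc f \<alpha>)" for \<alpha> by (simp add: a_def norm_mult norm_power \<omega>)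
  have "(\<lambda>\<alpha>. (cmod (a \<alpha>))\<^sup>2) summable_on UNIV"
    unfolding a using hermite_Parseval[OF f] by (rule has_sum_imp_summable)
  then obtain g where g: "sqint lebesgue g" "\<And>\<alpha>. hc g \<alpha> = a \<alpha>" using hermite_Riesz_Fischer by blast
  have "bargmann g z = bargmann f (\<omega> *s z)" for z
  proof -
    have "hc g \<alpha> * zbasis 1 \<alpha> z = hc f \<alpha> * zbasis \<omega> \<alpha> z" for \<alpha>
      by (simp add: g a_def zbasis_eq)
    then show ?thesis
      using bargmann_has_sum[OF g(1), of 1 z] bargmann_has_sum[OF f, of \<omega> z] has_sum_unique by simp
  qed
  with g a show ?thesis using that by simp
qed

section \<open>The Fock--Sobolev scale\<close>

lemma L2_iff: "f \<in> L2 \<longleftrightarrow> sqint lebesgue f"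
  by (simp add: L2_def sqint_def)

lemma L2_inner_eq: "L2_inner f g = ip lebesgue f g"
  by (simp add: L2_inner_def ip_def)

lemma L2_nrm_eq: "L2_nrm f = sqrt (nsq lebesgue f)"
  by (simp add: L2_nrm_def nsq_def)

lemma fock_inner_eq: "fock_inner F G = ip fock_measure F G"
  by (simp add: fock_inner_def ip_def)

abbreviation sobolev_summable :: "nat \<Rightarrow> (real^'n::finite \<Rightarrow> complex) \<Rightarrow> bool" where
  "sobolev_summable k f \<equiv> (\<lambda>\<alpha>. lam \<alpha> ^ k * (cmod (hc f \<alpha>))\<^sup>2) summable_on UNIV"

text \<open>The squared Hermite--Sobolev norm, read off from the Hermite coefficients.\<close>

definition ssq :: "nat \<Rightarrow> (real^'n::finite \<Rightarrow> complex) \<Rightarrow> real" where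
  "ssq k f = (\<Sum>\<^sub>\<infinity>\<alpha>. lam \<alpha> ^ k * (cmod (hc f \<alpha>))\<^sup>2)"

lemma lam_powr_half: "(lam \<alpha> powr (real k / 2))\<^sup>2 = lam \<alpha> ^ k"
proof -
  have "(lam \<alpha> powr (real k / 2))\<^sup>2 = lam \<alpha> powr real k"
    by (simp add: power2_eq_square flip: powr_add)
  then show ?thesis using lam_pos(1)[of \<alpha>] by (simp add: powr_realpow)
qed

lemma hermite_power_iff:
  "hermite_power s f g \<longleftrightarrow> sqint lebesgue f \<and> sqint lebesgue g \<and> (\<forall>\<alpha>. hc g \<alpha> = of_real (lam \<alpha> powr s) * hc f \<alpha>)"
  by (simp add: hermite_power_def L2_iff L2_inner_eq hc_def)

lemma hermite_power_nsq:
  assumes "hermite_power (real k / 2) f g"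
  shows "sobolev_summable k f" "nsq lebesgue g = ssq k f"
proof -
  have g: "sqint lebesgue g" and h: "\<And>\<alpha>. hc g \<alpha> = of_real (lam \<alpha> powr (real k / 2)) * hc f \<alpha>"
    using assms by (auto simp: hermite_power_iff)
  have e: "(cmod (hc g \<alpha>))\<^sup>2 = lam \<alpha> ^ k * (cmod (hc f \<alpha>))\<^sup>2" for \<alpha>
    unfolding h by (simp add: norm_mult power_mult_distrib lam_powr_half)
  have "((\<lambda>\<alpha>. lam \<alpha> ^ k * (cmod (hc f \<alpha>))\<^sup>2) has_sum nsq lebesgue g) UNIV"
    using hermite_Parseval[OF g] unfolding e .
  then show "sobolev_summable k f" "nsq lebesgue g = ssq k f"
    unfolding ssq_def by (auto simp: has_sum_imp_summable infsumI)
qed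

text \<open>The spectral domain of \<open>H\<^bsup>k/2\<^esup>\<close> is a condition on coefficients; Riesz--Fischer supplies the image function.\<close>

lemma hermite_sobolev_iff: "f \<in> hermite_sobolev k \<longleftrightarrow> sqint lebesgue f \<and> sobolev_summable k f"
proof
  assume "f \<in> hermite_sobolev k"
  then show "sqint lebesgue f \<and> sobolev_summable k f"
    unfolding hermite_sobolev_def using hermite_power_nsq(1) by (auto simp: L2_iff)
next
  assume f: "sqint lebesgue f \<and> sobolev_summable k f"
  have "(\<lambda>\<alpha>. (cmod (of_real (lam \<alpha> powr (real k / 2)) * hc f \<alpha>))\<^sup>2) summable_on UNIV"
    using f by (simp add: norm_mult power_mult_distrib lam_powr_half)
  from hermite_Riesz_Fischer[OF this]
  obtain g where "sqint lebesgue g" "\<forall>\<alpha>. hc g \<alpha> = of_real (lam \<alpha> powr (real k / 2)) * hc f \<alpha>"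
    by blast
  then show "f \<in> hermite_sobolev k"
    using f unfolding hermite_sobolev_def by (auto simp: L2_iff hermite_power_iff)
qed

lemma hermite_sobolev_nrm_eq:
  assumes "f \<in> hermite_sobolev k" shows "hermite_sobolev_nrm k f = sqrt (ssq k f)"
proof -
  have "\<exists>g. hermite_power (real k / 2) f g" using assms by (auto simp: hermite_sobolev_def)
  then have "hermite_power (real k / 2) f (SOME g. hermite_power (real k / 2) f g)" by (rule someI_ex)
  then show ?thesis unfolding hermite_sobolev_nrm_def L2_nrm_eq by (simp add: hermite_power_nsq(2))
qed

lemma one_smult [simp]: "(1::complex) *s z = z" by (simp add: vec_eq_iff)

lemma ip_bargmann: "sqint lebesgue f \<Longrightarrow> sqint lebesgue g \<Longrightarrow> fock_inner (bargmann f) (bargmann g) = ip lebesgue f g"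
  using bargmann_unitary[of f g 1] by (simp add: fock_inner_eq)

text \<open>Unitarity shows that \<open>f\<close> itself qualifies for the choice in \<open>bargmann_adj\<close>, and that every admissible choice has
  the coefficients of \<open>f\<close>.\<close>

lemma hc_bargmann_adj:
  assumes f: "sqint lebesgue f"
  shows "sqint lebesgue (bargmann_adj (bargmann f))" "hc (bargmann_adj (bargmann f)) \<alpha> = hc f \<alpha>"
proof -
  let ?P = "\<lambda>h. h \<in> L2 \<and> (\<forall>g\<in>L2. fock_inner (bargmann g) (bargmann f) = L2_inner g h)"
  have "?P f" using f by (auto simp: L2_iff L2_inner_eq ip_bargmann)
  then have P: "?P (bargmann_adj (bargmann f))" unfolding bargmann_adj_def by (rule someI[of ?P])
  then show s: "sqint lebesgue (bargmann_adj (bargmann f))" by (simp add: L2_iff)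
  have "ip lebesgue (hermite_fun \<alpha>) (bargmann_adj (bargmann f)) = ip lebesgue (hermite_fun \<alpha>) f"
    using P by (simp add: L2_iff L2_inner_eq ip_bargmann sqint_hermite_fun f)
  then show "hc (bargmann_adj (bargmann f)) \<alpha> = hc f \<alpha>"
    unfolding hc_def by (subst (1 2) ip_commute) simp
qed

lemma fock_sobolev_nrm_bargmann:
  assumes "sqint lebesgue f" "sobolev_summable k f"
  shows "fock_sobolev_nrm k (bargmann f) = sqrt (ssq k f)"
proof -
  have "bargmann_adj (bargmann f) \<in> hermite_sobolev k"
    using assms by (simp add: hermite_sobolev_iff hc_bargmann_adj)
  then show ?thesis
    unfolding fock_sobolev_nrm_def using assms by (simp add: hermite_sobolev_nrm_eq ssq_def hc_bargmann_adj)
qed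

text \<open>Every element of the Fock--Sobolev space is the rotated transform of a function of the same norm; in this
  representation \<open>S\<^sub>\<phi>\<close> is a multiplication operator.\<close>

definition rbarg :: "(real^'n::finite \<Rightarrow> complex) \<Rightarrow> complex^'n \<Rightarrow> complex" where
  "rbarg f z = bargmann f (\<i> *s z)"

lemma rbarg_props:
  assumes f: "sqint lebesgue f" and s: "sobolev_summable k f"
  shows "rbarg f \<in> fock_sobolev k" "fock_sobolev_nrm k (rbarg f) = sqrt (ssq k f)"
proof -
  obtain g where g: "sqint lebesgue g" "\<And>\<alpha>. cmod (hc g \<alpha>) = cmod (hc f \<alpha>)" "\<And>z. bargmann g z = bargmann f (\<i> *s z)"
    using bargmann_rotate[OF f norm_ii] by blast
  have e: "rbarg f = bargmann g" by (simp add: rbarg_def[abs_def] g(3) fun_eq_iff)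
  have sg: "sobolev_summable k g" "ssq k g = ssq k f" using s by (simp_all add: g(2) ssq_def)
  show "rbarg f \<in> fock_sobolev k"
    unfolding fock_sobolev_def e using g(1) sg(1) by (intro imageI) (simp add: hermite_sobolev_iff)
  show "fock_sobolev_nrm k (rbarg f) = sqrt (ssq k f)"
    unfolding e using fock_sobolev_nrm_bargmann[OF g(1) sg(1)] sg(2) by simp
qed

lemma fock_sobolev_rbarg:
  assumes "F \<in> fock_sobolev k"
  obtains f where "sqint lebesgue f" "sobolev_summable k f" "F = rbarg f"
proof -
  obtain h where h: "sqint lebesgue h" "sobolev_summable k h" "F = bargmann h"
    using assms by (auto simp: fock_sobolev_def hermite_sobolev_iff)
  have "cmod (- \<i>) = 1" by simp
  then obtain f where f: "sqint lebesgue f" "\<And>\<alpha>. cmod (hc f \<alpha>) = cmod (hc h \<alpha>)" "\<And>z. bargmann f z = bargmann h ((- \<i>) *s z)"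
    using bargmann_rotate[OF h(1)] by blast
  have "F = rbarg f"
    unfolding h(3) rbarg_def[abs_def] f(3) by (simp add: vector_smult_assoc fun_eq_iff)
  with f(1,2) h(2) show ?thesis using that by simp
qed

lemma rbarg_inj:
  assumes f: "sqint lebesgue f" and g: "sqint lebesgue g" and eq: "rbarg f = rbarg g"
  shows "AE x in lebesgue. f x = g x"
proof (rule hermite_unique[OF f g])
  fix \<alpha>
  have "ip lebesgue f (hermite_fun \<alpha>) = ip lebesgue g (hermite_fun \<alpha>)"
    using bargmann_unitary[OF f sqint_hermite_fun norm_ii] bargmann_unitary[OF g sqint_hermite_fun norm_ii] eq
    by (simp add: rbarg_def[abs_def])
  then show "hc f \<alpha> = hc g \<alpha>" by (simp add: hc_def)
qed

section \<open>The operator \<open>S\<^sub>\<phi>\<close> as a conjugated multiplication operator\<close>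

lemma cdot_cnjv: "cnj (cdot z w) = cdot (cnjv z) (cnjv w)"
  by (simp add: cdot_def cnjv_def)

text \<open>With \<open>q\<close> the conjugate of \<open>m\<close> times the kernel at \<open>\<i>z\<close>, the integral kernel of \<open>S\<^sub>\<phi>\<close> at \<open>(z, w)\<close> is, up to a factor in
  \<open>z\<close>, the conjugate of the rotated transform of \<open>q\<close> at \<open>w\<close>. So \<open>S\<^sub>\<phi>\<close> applied to the rotated transform of \<open>p\<close> is a Fock inner
  product of two rotated transforms. Unitarity turns it into \<open>\<integral> p q\<^sup>*\<close>, which is the rotated
  transform of \<open>m p\<close> at \<open>z\<close>, up to the same factor and a constant.\<close>

lemma S_op_eq_multiplication:
  fixes m :: "real^'n::finite \<Rightarrow> complex"
  assumes m: "\<And>f. sqint lebesgue f \<Longrightarrow> sqint lebesgue (\<lambda>x. m x * f x)" and p: "sqint lebesgue p"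
  shows "S_op (gauss_bargmann m) (rbarg p) z = of_real (pi powr (real CARD('n) / 2)) * rbarg (\<lambda>x. m x * p x) z"
proof -
  let ?c = "complex_of_real (pi powr (- real CARD('n) / 4))"
  define q where "q u = cnj (m u) * cnj (ker (\<i> *s z) u)" for u
  have q: "sqint lebesgue q"
    using sqint_cnj[OF m[OF sqint_cnj[OF sqint_ker[of "\<i> *s z"]]]] by (simp add: q_def[abs_def])
  have cz: "?c \<noteq> 0" by simp
  have kern: "?c * (gauss_bargmann m (z - cnjv w) * exp (cdot z (cnjv w) / 2)) = exp (cdot z z / 4) * cnj (rbarg q w)" for w
  proof -
    have ptw: "m u * exp (- cdot (cvec u - (\<i> / 2) *s (z - cnjv w)) (cvec u - (\<i> / 2) *s (z - cnjv w))) * exp (cdot z (cnjv w) / 2)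
       = exp (cdot z z / 4) * (exp (cdot (cnjv w) (cnjv w) / 4) * (m u * ker (\<i> *s z) u * cnj (ker (\<i> *s w) u)))" for u
    proof -
      have lhs: "- cdot (cvec u - (\<i> / 2) *s (z - cnjv w)) (cvec u - (\<i> / 2) *s (z - cnjv w)) + cdot z (cnjv w) / 2
        = cdot z z / 4 + cdot (cnjv w) (cnjv w) / 4 - of_real ((norm u)\<^sup>2) + cdot (cvec u) (\<i> *s z) + cnj (cdot (cvec u) (\<i> *s w))"
        unfolding cdot_def norm_power2_vec
        by (simp add: cvec_def cnjv_def sum_divide_distrib sum_negf[symmetric] sum.distrib[symmetric] sum_subtractf[symmetric] del: sum_negf sum.distrib sum_subtractf)
           (intro sum.cong refl, simp add: power2_eq_square field_simps)
      have k: "ker (\<i> *s z) u * cnj (ker (\<i> *s w) u) = exp (- of_real ((norm u)\<^sup>2) + cdot (cvec u) (\<i> *s z) + cnj (cdot (cvec u) (\<i> *s w)))"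
        unfolding ker_def complex_cnj_mult complex_cnj_complex_of_real exp_cnj exp_of_real[symmetric] mult_exp_exp
        by (rule arg_cong[where f=exp]) (simp add: field_simps)
      show ?thesis
        unfolding mult.assoc[of "m u"] k mult_exp_exp lhs
        by (simp add: mult.left_commute[of _ "m u"] mult_exp_exp algebra_simps)
    qed
    have "gauss_bargmann m (z - cnjv w) * exp (cdot z (cnjv w) / 2)
       = (LINT u|lebesgue. exp (cdot z z / 4) * (exp (cdot (cnjv w) (cnjv w) / 4) * (m u * ker (\<i> *s z) u * cnj (ker (\<i> *s w) u))))"
      unfolding gauss_bargmann_def ptw[symmetric] by simp
    also have "\<dots> = exp (cdot z z / 4) * (exp (cdot (cnjv w) (cnjv w) / 4) * (LINT u|lebesgue. m u * ker (\<i> *s z) u * cnj (ker (\<i> *s w) u)))"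
      by (simp only: integral_mult_right_zero)
    also have "(LINT u|lebesgue. m u * ker (\<i> *s z) u * cnj (ker (\<i> *s w) u)) = cnj (ip lebesgue q (\<lambda>u. cnj (ker (\<i> *s w) u)))"
      unfolding ip_def Bochner_Integration.integral_cnj[symmetric] by (simp add: q_def)
    finally have "?c * (gauss_bargmann m (z - cnjv w) * exp (cdot z (cnjv w) / 2))
      = exp (cdot z z / 4) * ((?c * exp (cdot (cnjv w) (cnjv w) / 4)) * cnj (ip lebesgue q (\<lambda>u. cnj (ker (\<i> *s w) u))))"
      by (simp add: mult_ac)
    also have "?c * exp (cdot (cnjv w) (cnjv w) / 4) = cnj (bconst (\<i> *s w))"
    proof -
      have "cdot (\<i> *s w) (\<i> *s w) = - cdot w w" by (simp add: cdot_def sum_negf[symmetric] algebra_simps)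
      then show ?thesis by (simp add: bconst_def cdot_cnjv[symmetric] exp_cnj)
    qed
    finally show ?thesis by (simp add: rbarg_def bargmann_eq_ip)
  qed
  have "?c * S_op (gauss_bargmann m) (rbarg p) z
     = (LINT w|fock_measure. rbarg p w * (?c * (gauss_bargmann m (z - cnjv w) * exp (cdot z (cnjv w) / 2))))"
    unfolding S_op_def by (subst integral_mult_right_zero[symmetric]) (simp only: mult_ac)
  also have "\<dots> = (LINT w|fock_measure. exp (cdot z z / 4) * (rbarg p w * cnj (rbarg q w)))"
    unfolding kern by (simp only: mult.left_commute)
  also have "\<dots> = exp (cdot z z / 4) * ip fock_measure (rbarg p) (rbarg q)"
    by (simp only: integral_mult_right_zero ip_def)
  also have "ip fock_measure (rbarg p) (rbarg q) = ip lebesgue p q"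
    using bargmann_unitary[OF p q norm_ii] by (simp add: rbarg_def[abs_def])
  also have "ip lebesgue p q = ip lebesgue (\<lambda>x. m x * p x) (\<lambda>u. cnj (ker (\<i> *s z) u))"
    by (simp add: ip_def q_def mult_ac)
  finally have "?c * (?c * S_op (gauss_bargmann m) (rbarg p) z)
     = (?c * exp (cdot z z / 4)) * ip lebesgue (\<lambda>x. m x * p x) (\<lambda>u. cnj (ker (\<i> *s z) u))"
    by simp
  also have "?c * exp (cdot z z / 4) = bconst (\<i> *s z)"
  proof -
    have "cdot (\<i> *s z) (\<i> *s z) = - cdot z z" by (simp add: cdot_def sum_negf[symmetric] algebra_simps)
    then show ?thesis by (simp add: bconst_def)
  qed
  also have "bconst (\<i> *s z) * ip lebesgue (\<lambda>x. m x * p x) (\<lambda>u. cnj (ker (\<i> *s z) u)) = rbarg (\<lambda>x. m x * p x) z"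
    by (simp only: rbarg_def bargmann_eq_ip)
  finally have main: "?c * ?c * S_op (gauss_bargmann m) (rbarg p) z = rbarg (\<lambda>x. m x * p x) z"
    by (simp only: mult.assoc)
  have one: "complex_of_real (pi powr (real CARD('n) / 2)) * (?c * ?c) = 1"
    by (simp add: flip: powr_add of_real_mult)
  show ?thesis unfolding main[symmetric] mult.assoc[symmetric] using one by (simp add: mult.assoc)
qed

section \<open>Boundedness of \<open>S\<^sub>\<phi>\<close>\<close>

text \<open>Monomials are rotated transforms of multiples of Hermite functions; the powers of \<open>\<i>\<close> undo the rotation.\<close>

lemma holomorphic_polynomial_rbarg:
  fixes P :: "complex^'n::finite \<Rightarrow> complex"
  assumes "P \<in> holomorphic_polynomials"
  obtains p where "sqint lebesgue p" "P = rbarg p"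
proof -
  obtain A c where A: "finite A" "P = (\<lambda>z. \<Sum>\<alpha>\<in>A. c \<alpha> * zmon \<alpha> z)"
    using assms unfolding holomorphic_polynomials_def zmon_def by blast
  \<comment> \<open>coefficients that compensate normalisation and phase of \<open>zbasis \<i>\<close>\<close>
  define d where "d \<alpha> = c \<alpha> * of_real (znorm \<alpha>) / \<i> ^ (\<Sum>j\<in>UNIV. \<alpha> j)" for \<alpha> :: "'n \<Rightarrow> nat"
  have "znorm \<alpha> \<noteq> 0" for \<alpha> :: "'n \<Rightarrow> nat" by (metis znorm_pos less_irrefl)
  then have "P = rbarg (lc A d)"
    unfolding A(2) rbarg_def[abs_def] bargmann_lc[OF A(1)]
    by (intro ext sum.cong refl) (simp add: d_def zbasis_eq)
  then show ?thesis using that sqint_lc by blast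
qed

theorem theorem1p7:
  fixes k :: nat and \<phi> :: "complex^'n::finite \<Rightarrow> complex"
  assumes "\<phi> \<in> fock_sobolev0 k"
  shows "S_bounded k \<phi>"
proof -
  obtain m0 where m0: "m0 \<in> L_infty k" "\<phi> = gauss_bargmann m0"
    using assms by (auto simp: fock_sobolev0_def)
  obtain m where m: "tame k 0 m" and mm: "AE x in lebesgue. m0 x = m x" and m0m: "m0 \<in> borel_measurable lebesgue"
    using tame_of_L_infty[OF m0(1)] by blast
  have m_meas: "m \<in> borel_measurable lebesgue" using tame_growth[OF m] by (simp add: growth_def)
  have \<phi>: "\<phi> = gauss_bargmann m"
  proof
    fix z :: "complex^'n"
    have "(\<lambda>u. exp (- cdot (cvec u - (\<i> / 2) *s z) (cvec u - (\<i> / 2) *s z))) \<in> borel_measurable lebesgue"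
      by (intro measurable_completion) 
         (auto intro!: borel_measurable_continuous_onI continuous_intros)
    then show "\<phi> z = gauss_bargmann m z"
      unfolding m0(2) gauss_bargmann_def
      by (intro integral_cong_AE borel_measurable_times m0m m_meas) (use mm in auto)
  qed
  obtain K where K: "0 \<le> K" and sq: "\<And>f. sqint lebesgue f \<Longrightarrow> sqint lebesgue (\<lambda>x. m x * f x)"
    and bd: "\<And>f B. sqint lebesgue f \<Longrightarrow> sobolev_summable k f \<Longrightarrow> finite B \<Longrightarrow>
       (\<Sum>\<beta>\<in>B. lam \<beta> ^ k * (cmod (hc (\<lambda>x. m x * f x) \<beta>))\<^sup>2) \<le> K * ssq k f"
    using multiplication_bounded_sobolev[OF m] unfolding ssq_def by blast
  define \<kappa> where "\<kappa> = complex_of_real (pi powr (real CARD('n) / 2))"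
  define N where "N f = (\<lambda>x. \<kappa> * (m x * f x))" for f :: "real^'n \<Rightarrow> complex"
  have N: "sqint lebesgue (N f)" if "sqint lebesgue f" for f
    unfolding N_def by (intro sqint_scale sq that)
  have rN: "rbarg (N f) z = \<kappa> * rbarg (\<lambda>x. m x * f x) z" for f z
    by (simp add: rbarg_def N_def bargmann_scale)
  have NS: "sobolev_summable k (N f)" "ssq k (N f) \<le> (cmod \<kappa>)\<^sup>2 * K * ssq k f"
    if f: "sqint lebesgue f" "sobolev_summable k f" for f
  proof -
    have le: "(\<Sum>\<beta>\<in>B. lam \<beta> ^ k * (cmod (hc (N f) \<beta>))\<^sup>2) \<le> (cmod \<kappa>)\<^sup>2 * K * ssq k f" if "finite B" for B
    proof -
      have "(\<Sum>\<beta>\<in>B. lam \<beta> ^ k * (cmod (hc (N f) \<beta>))\<^sup>2) = (cmod \<kappa>)\<^sup>2 * (\<Sum>\<beta>\<in>B. lam \<beta> ^ k * (cmod (hc (\<lambda>x. m x * f x) \<beta>))\<^sup>2)"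
        unfolding N_def hc_scale sum_distrib_left by (intro sum.cong refl) (simp add: norm_mult power_mult_distrib mult_ac)
      also have "\<dots> \<le> (cmod \<kappa>)\<^sup>2 * (K * ssq k f)" by (intro mult_left_mono bd f that) auto
      finally show ?thesis by (simp add: mult.assoc)
    qed
    have nn: "0 \<le> lam \<beta> ^ k * (cmod (hc (N f) \<beta>))\<^sup>2" for \<beta>
      by (intro mult_nonneg_nonneg zero_le_power lam_pos(2)) auto
    show s: "sobolev_summable k (N f)"
      by (rule nonneg_bdd_above_summable_on) (use le nn in \<open>auto simp: bdd_above_def\<close>)
    show "ssq k (N f) \<le> (cmod \<kappa>)\<^sup>2 * K * ssq k f"
      unfolding ssq_def[of k "N f"] by (rule infsum_le_finite_sums[OF s]) (use le in auto)
  qed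
  \<comment> \<open>The rotated transform is injective up to null sets, so an arbitrary preimage defines \<open>T\<close>.\<close>
  define pick where "pick F = (SOME f. sqint lebesgue f \<and> F = rbarg f)" for F :: "complex^'n \<Rightarrow> complex"
  define T where "T F = rbarg (N (pick F))" for F
  have T: "T (rbarg f) = rbarg (N f)" if f: "sqint lebesgue f" for f
  proof -
    have "sqint lebesgue (pick (rbarg f)) \<and> rbarg f = rbarg (pick (rbarg f))"
      unfolding pick_def by (rule someI[where x=f]) (use f in simp)
    then have g: "sqint lebesgue (pick (rbarg f))" "rbarg f = rbarg (pick (rbarg f))" by auto
    have "AE x in lebesgue. f x = pick (rbarg f) x" by (rule rbarg_inj[OF f g])
    then have "AE x in lebesgue. N (pick (rbarg f)) x = N f x" by eventually_elim (simp add: N_def)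
    from bargmann_cong_AE[OF N[OF g(1)] N[OF f] this]
    show ?thesis by (simp add: T_def rbarg_def[abs_def])
  qed
  have radd: "rbarg (\<lambda>x. f x + g x) = (\<lambda>z. rbarg f z + rbarg g z)" if "sqint lebesgue f" "sqint lebesgue g" for f g :: "real^'n \<Rightarrow> complex"
    by (simp add: rbarg_def[abs_def] bargmann_add[OF that])
  have rscale: "rbarg (\<lambda>x. c * f x) = (\<lambda>z. c * rbarg f z)" for c and f :: "real^'n \<Rightarrow> complex"
    by (simp add: rbarg_def[abs_def] bargmann_scale)
  show ?thesis unfolding S_bounded_def
  proof (intro exI[of _ T] conjI ballI allI)
    fix F :: "complex^'n \<Rightarrow> complex" assume "F \<in> fock_sobolev k"
    then obtain f where f: "sqint lebesgue f" "sobolev_summable k f" "F = rbarg f" by (rule fock_sobolev_rbarg)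
    show "T F \<in> fock_sobolev k"
      unfolding f(3) T[OF f(1)] by (rule rbarg_props(1)[OF N[OF f(1)] NS(1)[OF f(1,2)]])
    show "T (\<lambda>z. c * F z) = (\<lambda>z. c * T F z)" for c
    proof -
      have "T (\<lambda>z. c * F z) = rbarg (N (\<lambda>x. c * f x))"
        unfolding f(3) rscale[symmetric] by (rule T[OF sqint_scale[OF f(1)]])
      also have "N (\<lambda>x. c * f x) = (\<lambda>x. c * N f x)" by (auto simp: N_def)
      finally show ?thesis unfolding f(3) T[OF f(1)] rscale .
    qed
    fix G :: "complex^'n \<Rightarrow> complex" assume "G \<in> fock_sobolev k"
    then obtain g where g: "sqint lebesgue g" "sobolev_summable k g" "G = rbarg g" by (rule fock_sobolev_rbarg)
    have "T (\<lambda>z. F z + G z) = rbarg (N (\<lambda>x. f x + g x))"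
      unfolding f(3) g(3) radd[OF f(1) g(1), symmetric] by (rule T[OF sqint_add[OF f(1) g(1)]])
    also have "N (\<lambda>x. f x + g x) = (\<lambda>x. N f x + N g x)" by (auto simp: N_def distrib_left)
    finally show "T (\<lambda>z. F z + G z) = (\<lambda>z. T F z + T G z)"
      unfolding f(3) g(3) T[OF f(1)] T[OF g(1)] radd[OF N[OF f(1)] N[OF g(1)]] .
  next
    have "fock_sobolev_nrm k (T F) \<le> sqrt ((cmod \<kappa>)\<^sup>2 * K) * fock_sobolev_nrm k F"
      if "F \<in> fock_sobolev k" for F :: "complex^'n \<Rightarrow> complex"
    proof -
      from \<open>F \<in> fock_sobolev k\<close>
      obtain f where f: "sqint lebesgue f" "sobolev_summable k f" "F = rbarg f" by (rule fock_sobolev_rbarg)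
      have "fock_sobolev_nrm k (T F) = sqrt (ssq k (N f))"
        unfolding f(3) T[OF f(1)] by (rule rbarg_props(2)[OF N[OF f(1)] NS(1)[OF f(1,2)]])
      also have "\<dots> \<le> sqrt ((cmod \<kappa>)\<^sup>2 * K * ssq k f)" by (intro real_sqrt_le_mono NS(2) f)
      also have "\<dots> = sqrt ((cmod \<kappa>)\<^sup>2 * K) * fock_sobolev_nrm k F"
        unfolding f(3) rbarg_props(2)[OF f(1,2)] by (rule real_sqrt_mult)
      finally show ?thesis .
    qed
    then show "\<exists>C. \<forall>F\<in>fock_sobolev k. fock_sobolev_nrm k (T F) \<le> C * fock_sobolev_nrm k F" by blast
  next
    fix P :: "complex^'n \<Rightarrow> complex" assume "P \<in> holomorphic_polynomials"
    then obtain p where p: "sqint lebesgue p" "P = rbarg p" by (rule holomorphic_polynomial_rbarg)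
    show "T P = S_op \<phi> P"
      unfolding p(2) T[OF p(1)] \<phi> by (rule ext) (simp only: rN S_op_eq_multiplication[OF sq p(1)] \<kappa>_def)
  qed
qed

end
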